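(* Let $K$ be an imaginary quadratic field and $\tau\in K\cap\mathbb{H}$. Then $1/w(\tau)$ is an algebraic integer.
   Context: $\mathbb{H}$ is the complex upper half-plane, $q=e^{2\pi i\tau}$ for $\tau\in\mathbb{H}$, $q^r=e^{2\pi i r\tau}$ for rational $r$, and $\eta(\tau)=q^{1/24}\prod_{n=1}^\infty(1-q^n)$ is the Dedekind eta function. Define $$X(\tau)=\dfrac{\eta(\tau)\eta^2(6\tau)}{\eta^2(2\tau)\eta(3\tau)},\qquad w(\tau):=X(\tau)X(3\tau).$$ $K$ is regarded as a subfield of $\mathbb{C}$. *)

theory Defs
  imports "HOL-Analysis.Analysis" "HOL-Computational_Algebra.Polynomial"
begin

definition upper_half_plane :: "complex set" where
  "upper_half_plane = {\<tau>. Im \<tau> > 0}"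

text \<open>\<open>q_pow r \<tau>\<close> is $q^r = e^{2\pi i r\tau}$; it is not a principal power of $q$.\<close>

definition q_pow :: "rat \<Rightarrow> complex \<Rightarrow> complex" where
  "q_pow r \<tau> = exp (2 * of_real pi * \<i> * of_rat r * \<tau>)"

text \<open>The product over $n \ge 1$ is indexed from \<open>0\<close>, hence the exponent \<open>Suc n\<close>.\<close>

definition dedekind_eta :: "complex \<Rightarrow> complex" where
  "dedekind_eta \<tau> = q_pow (1 / 24) \<tau> * (\<Prod>n. 1 - q_pow 1 \<tau> ^ Suc n)"

definition X :: "complex \<Rightarrow> complex" where
  "X \<tau> = (dedekind_eta \<tau> * dedekind_eta (6 * \<tau>) ^ 2) /
         (dedekind_eta (2 * \<tau>) ^ 2 * dedekind_eta (3 * \<tau>))"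

definition w :: "complex \<Rightarrow> complex" where
  "w \<tau> = X \<tau> * X (3 * \<tau>)"

definition complex_subfield :: "complex set \<Rightarrow> bool" where
  "complex_subfield K \<longleftrightarrow>
     0 \<in> K \<and> 1 \<in> K \<and>
     (\<forall>x\<in>K. \<forall>y\<in>K. x + y \<in> K \<and> x * y \<in> K) \<and>
     (\<forall>x\<in>K. - x \<in> K \<and> inverse x \<in> K)"

definition rat_scale :: "rat \<Rightarrow> complex \<Rightarrow> complex" where
  "rat_scale r z = of_rat r * z"

lemma vector_space_rat_scale: "vector_space rat_scale"
  by unfold_locales (simp_all add: rat_scale_def algebra_simps of_rat_add of_rat_mult)

text \<open>
  A subfield of $\mathbb{C}$ of degree 2 over $\mathbb{Q}$ that is not real. The library's
  \<open>dim\<close> is \<open>0\<close> for infinite-dimensional spaces, so the value \<open>2\<close> does mean that there is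
  a basis with two elements.
\<close>

definition imaginary_quadratic_field :: "complex set \<Rightarrow> bool" where
  "imaginary_quadratic_field K \<longleftrightarrow>
     complex_subfield K \<and> vector_space.dim rat_scale K = 2 \<and> \<not> K \<subseteq> \<real>"

end

theory Submission
  imports Defs "HOL-Complex_Analysis.Complex_Analysis" "Jordan_Normal_Form.Char_Poly"
begin

text \<open>
  Because \<open>\<eta>(3\<tau>)\<close> and \<open>\<eta>(6\<tau>)\<close> cancel in \<open>w(\<tau>) = X(\<tau>) X(3\<tau>)\<close>, the 24th power of \<open>1 / w\<close> is the quotient
  \<open>g(\<tau>) = \<Delta>(2\<tau>)\<^sup>2 \<Delta>(9\<tau>) / (\<Delta>(\<tau>) \<Delta>(18\<tau>)\<^sup>2)\<close>, where \<open>\<Delta> = \<eta>\<^sup>2\<^sup>4\<close>. It suffices to show that \<open>g(\<tau>)\<close> is an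
  algebraic integer. The proof is the classical one by integrality over the ring generated by the \<open>j\<close>-function. It is
  made elementary by two choices: the coefficients range over all algebraic integers, and finite sets of functions
  stand in for modular groups of higher level.

  The finitely many functions \<open>g \<circ> \<gamma>\<close>, with \<open>\<gamma>\<close> in the modular group, all have Fourier expansions with algebraic
  integer coefficients (\<open>eta_quot_orbit_family\<close>). Indeed, by the Hermite normal form, \<open>g \<circ> \<gamma>\<close> is a quotient of
  functions \<open>\<Delta>((a\<tau> + b) / d)\<close>, whose expansions begin with roots of unity, times a constant. This constant is
  the twelfth power of a divisor of \<open>9\<close>, because the contributions of the prime \<open>2\<close> cancel. So the
  coefficients of \<open>\<Prod> (T - g \<circ> \<gamma>)\<close> are modular invariants with integral expansions.

  A modular invariant with an integral expansion is a polynomial in \<open>j\<close> with algebraic integer coefficients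
  (\<open>modular_invariant_eq_poly_shifted_j\<close>): subtract multiples of powers of \<open>j\<close> until no pole remains, and conclude with the
  maximum principle (\<open>modular_invariant_bounded_constant\<close>). Hence \<open>g(\<tau>)\<close> is an algebraic integer whenever \<open>j(\<tau>)\<close> is one
  (\<open>modular_family_algebraic_int\<close>).

  For imaginary quadratic \<open>\<tau>\<close> there is an integer matrix that fixes \<open>\<tau>\<close> and whose determinant \<open>n\<close> is positive and not a
  square. The product of all \<open>j - j \<circ> A\<close> with \<open>det A = n\<close> is again a polynomial in \<open>j\<close>. It vanishes at \<open>\<tau>\<close>, and its
  leading coefficient is a unit as \<open>n\<close> is not a square. Thus \<open>j(\<tau>)\<close> is an algebraic integer
  (\<open>shifted_j_quadratic_algebraic_int\<close>).

  The analytic input is \<open>\<Delta>(- 1 / \<tau>) = \<tau>\<^sup>1\<^sup>2 \<Delta>(\<tau>)\<close> (\<open>eta24_inversion\<close>), from which the function \<open>j\<close> is built as well. By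
  analytic continuation only \<open>\<tau> = \<i>y\<close> matters. There, the logarithm of the eta product is a Lambert series. The partial
  fractions of the hyperbolic cotangent turn it into a double series that is formally symmetric under \<open>y \<mapsto> 1 / y\<close>
  but not absolutely convergent. Summing over squares keeps the symmetry, and the error is an arctangent integral
  that yields the term \<open>ln y / 2\<close>. The algebraic input, that algebraic integers form an integrally closed ring,
  comes from characteristic polynomials of integer matrices.
\<close>

section \<open>Finitely generated rings of algebraic integers\<close>

interpretation int_module: Modules.module "\<lambda>(n::int) (z::complex). of_int n * z"
  by unfold_locales (auto simp: algebra_simps)

text \<open>
  A subring of \<open>\<complex>\<close> whose additive group is finitely generated. Closure under addition and
  negation comes with being a span, so only \<open>1\<close> and products have to be demanded.
\<close>

definition fin_int_ring :: "complex set \<Rightarrow> bool" where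
  "fin_int_ring R \<longleftrightarrow>
     1 \<in> R \<and> (\<forall>x\<in>R. \<forall>y\<in>R. x * y \<in> R) \<and> (\<exists>B. finite B \<and> R = int_module.span B)"

lemma fin_int_ring_closed:
  assumes "fin_int_ring R"
  shows "1 \<in> R" "x \<in> R \<Longrightarrow> y \<in> R \<Longrightarrow> x * y \<in> R" "x \<in> R \<Longrightarrow> y \<in> R \<Longrightarrow> x + y \<in> R"
    "x \<in> R \<Longrightarrow> - x \<in> R" "of_int n \<in> R"
proof -
  obtain B where B: "R = int_module.span B"
    using assms by (auto simp: fin_int_ring_def)
  show one: "1 \<in> R" and "x \<in> R \<Longrightarrow> y \<in> R \<Longrightarrow> x * y \<in> R"
    using assms by (auto simp: fin_int_ring_def)
  show "x \<in> R \<Longrightarrow> y \<in> R \<Longrightarrow> x + y \<in> R" "x \<in> R \<Longrightarrow> - x \<in> R"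
    using B int_module.span_add int_module.span_neg by blast+
  show "of_int n \<in> R"
    using one int_module.span_scale[of 1 B n] B by simp
qed

text \<open>
  Multiplication by \<open>z\<close> on the generators is given by an integer matrix \<open>M\<close>. The vector of
  generators is an eigenvector of \<open>M\<close> for the eigenvalue \<open>z\<close>, so \<open>z\<close> is a root of the
  characteristic polynomial of \<open>M\<close>, which is monic with integer coefficients.
\<close>

lemma fin_int_ring_algebraic_int:
  assumes "fin_int_ring R" "z \<in> R"
  shows "algebraic_int z"
proof -
  obtain B where B: "finite B" "R = int_module.span B"
    using assms by (auto simp: fin_int_ring_def)
  define n where "n = card B"
  obtain f where f: "bij_betw f {..<n} B"
    using B(1) ex_bij_betw_nat_finite[of B] by (auto simp: n_def atLeast0LessThan)
  have "\<exists>u. z * b = (\<Sum>v\<in>B. of_int (u v) * v)" if "b \<in> B" for b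
  proof -
    have "z * b \<in> int_module.span B"
      using that assms B fin_int_ring_closed(2)[OF assms(1)] int_module.span_base by auto
    thus ?thesis
      unfolding int_module.span_finite[OF B(1)] by auto
  qed
  then obtain u where u: "\<And>b. b \<in> B \<Longrightarrow> z * b = (\<Sum>v\<in>B. of_int (u b v) * v)"
    by metis
  define M :: "int mat" where "M = Matrix.mat n n (\<lambda>(i, j). u (f i) (f j))"
  define M' :: "complex mat" where "M' = map_mat of_int M"
  define x where "x = Matrix.vec n f"
  have M: "M \<in> carrier_mat n n" and M': "M' \<in> carrier_mat n n"
    by (auto simp: M_def M'_def)
  have "M' *\<^sub>v x = z \<cdot>\<^sub>v x"
  proof (rule Matrix.eq_vecI)
    fix i assume "i < dim_vec (z \<cdot>\<^sub>v x)"
    hence i: "i < n" by (simp add: x_def)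
    have "f i \<in> B"
      using f i by (auto simp: bij_betw_def)
    hence "z * f i = (\<Sum>v\<in>B. of_int (u (f i) v) * v)"
      by (rule u)
    also have "\<dots> = (\<Sum>j<n. of_int (u (f i) (f j)) * f j)"
      by (rule sum.reindex_bij_betw[OF f, symmetric])
    finally show "vec_index (M' *\<^sub>v x) i = vec_index (z \<cdot>\<^sub>v x) i"
      using i by (simp add: M'_def M_def x_def scalar_prod_def atLeast0LessThan)
  qed (auto simp: M'_def M_def x_def)
  moreover have "x \<noteq> 0\<^sub>v n"
  proof
    assume "x = 0\<^sub>v n"
    hence "vec_index x i = 0" if "i < n" for i
      using that by simp
    hence "B \<subseteq> {0}"
      using f by (auto simp: x_def bij_betw_def)
    hence "R \<subseteq> {0}"
      using int_module.span_minimal[of B "{0}"] B(2) by (simp add: int_module.subspace_def)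
    thus False
      using fin_int_ring_closed(1)[OF assms(1)] by auto
  qed
  ultimately have "eigenvalue M' z"
    unfolding eigenvalue_def eigenvector_def using M' by (intro exI[of _ x]) (auto simp: x_def)
  hence "poly (char_poly M') z = 0"
    using eigenvalue_root_char_poly[OF M'] by simp
  hence "poly (map_poly of_int (char_poly M)) z = 0"
    unfolding M'_def by (simp add: of_int_hom.char_poly_hom[OF M])
  thus ?thesis
    unfolding algebraic_int_altdef_ipoly using degree_monic_char_poly[OF M] by auto
qed

text \<open>
  If \<open>B\<close> generates \<open>R\<close> and \<open>z\<close> satisfies a monic equation of degree \<open>n\<close> over \<open>R\<close>, the products
  \<open>b * z ^ i\<close> with \<open>i < n\<close> generate the ring \<open>R[z]\<close>. Together with the previous lemma this one step
  gives both that algebraic integers form a ring and that this ring is integrally closed.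
\<close>

lemma fin_int_ring_adjoin:
  assumes R: "fin_int_ring R"
    and p: "lead_coeff p = 1" "\<And>i. coeff p i \<in> R" "poly p z = 0"
  obtains R' where "fin_int_ring R'" "R \<subseteq> R'" "z \<in> R'"
proof -
  obtain B where B: "finite B" "R = int_module.span B"
    using R by (auto simp: fin_int_ring_def)
  define n where "n = degree p"
  have n: "n > 0"
    using p by (intro Nat.gr0I) (auto simp: n_def elim!: degree_eq_zeroE)
  define C where "C = (\<lambda>(b, i). b * z ^ i) ` (B \<times> {..<n})"
  define S where "S = int_module.span C"
  have base: "b * z ^ i \<in> S" if "b \<in> B" "i < n" for b i
    unfolding S_def by (rule int_module.span_base) (use that in \<open>auto simp: C_def\<close>)
  have sub: "int_module.subspace S"
    by (simp add: S_def)
  have minimal: "P s" if "s \<in> S" "\<And>b i. b \<in> B \<Longrightarrow> i < n \<Longrightarrow> P (b * z ^ i)"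
    "int_module.subspace (Collect P)" for P s
    by (rule int_module.span_induct[of s C P])
       (use that in \<open>auto simp: S_def C_def\<close>)
  have RS: "r * z ^ i \<in> S" if "r \<in> R" "i < n" for r i
  proof -
    have "int_module.subspace {r. r * z ^ i \<in> S}"
      using sub unfolding int_module.subspace_def
        by (auto simp: distrib_left distrib_right mult.assoc mult.left_commute[of _ "of_int _"])
    thus ?thesis
      using int_module.span_induct[of r B "\<lambda>r. r * z ^ i \<in> S"] that base B(2) by auto
  qed
  have zS: "z * s \<in> S" if "s \<in> S" for s
  proof (rule minimal[OF that])
    fix b i assume b: "b \<in> B" and i: "i < n"
    show "z * (b * z ^ i) \<in> S"
    proof (cases "Suc i < n")
      case True
      thus ?thesis using base[OF b, of "Suc i"] by (simp add: algebra_simps)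
    next
      case False
      hence i': "n = Suc i" using i by simp
      have "0 = b * poly p z" using p by simp
      also have "\<dots> = (\<Sum>j\<le>n. b * coeff p j * z ^ j)"
        by (simp add: poly_altdef n_def sum_distrib_left mult_ac)
      also have "\<dots> = b * z ^ n + (\<Sum>j<n. b * coeff p j * z ^ j)"
        using p(1) by (simp add: n_def flip: lessThan_Suc_atMost)
      finally have "z * (b * z ^ i) = - (\<Sum>j<n. b * coeff p j * z ^ j)"
        by (simp add: i' algebra_simps eq_neg_iff_add_eq_0)
      moreover have "b \<in> R" using b B(2) int_module.span_base by auto
      hence "(\<Sum>j<n. b * coeff p j * z ^ j) \<in> S"
        unfolding S_def
        by (intro int_module.span_sum RS[unfolded S_def] fin_int_ring_closed(2)[OF R] p) auto
      ultimately show ?thesis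
        by (simp add: S_def int_module.span_neg)
    qed
  next
    show "int_module.subspace {s. z * s \<in> S}"
      using sub unfolding int_module.subspace_def
        by (auto simp: distrib_left distrib_right mult.assoc mult.left_commute[of _ "of_int _"])
  qed
  have zkS: "z ^ k * s \<in> S" if "s \<in> S" for k s
    by (induction k) (use that zS in \<open>auto simp: mult.assoc\<close>)
  have RmS: "r * s \<in> S" if "r \<in> R" "s \<in> S" for r s
  proof (rule minimal[OF that(2)])
    fix b i assume "b \<in> B" "i < n"
    thus "r * (b * z ^ i) \<in> S"
      using RS[of "r * b" i] fin_int_ring_closed(2)[OF R that(1)] B(2) int_module.span_base
      by (auto simp: mult.assoc)
  next
    show "int_module.subspace {s. r * s \<in> S}"
      using sub unfolding int_module.subspace_def
        by (auto simp: distrib_left distrib_right mult.assoc mult.left_commute[of _ "of_int _"])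
  qed
  have mult: "x * s \<in> S" if "x \<in> S" "s \<in> S" for x s
  proof (rule minimal[OF that(1)])
    fix b i assume b: "b \<in> B" "i < n"
    have "b * (z ^ i * s) \<in> S"
      by (intro RmS zkS that) (use b B(2) int_module.span_base in auto)
    thus "b * z ^ i * s \<in> S" by (simp add: mult.assoc)
  next
    show "int_module.subspace {x. x * s \<in> S}"
      using sub unfolding int_module.subspace_def
        by (auto simp: distrib_left distrib_right mult.assoc mult.left_commute[of _ "of_int _"])
  qed
  have RsubS: "R \<subseteq> S"
    using RS[of _ 0] n by auto
  have one: "1 \<in> S"
    using RsubS fin_int_ring_closed(1)[OF R] by auto
  have "fin_int_ring S"
    unfolding fin_int_ring_def using one mult B(1)
    by (intro conjI ballI exI[of _ C]) (auto simp: S_def C_def)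
  moreover have "z \<in> S"
    using zS[OF one] by simp
  ultimately show ?thesis
    using that RsubS by blast
qed

lemma fin_int_ring_Ints: "fin_int_ring \<int>"
proof -
  have "int_module.span {1} = \<int>"
    by (auto simp: int_module.span_finite Ints_def)
  thus ?thesis
    unfolding fin_int_ring_def by (intro conjI exI[of _ "{1}"]) auto
qed

lemma fin_int_ring_adjoin_algebraic_int:
  assumes R: "fin_int_ring R" and z: "algebraic_int z"
  obtains R' where "fin_int_ring R'" "R \<subseteq> R'" "z \<in> R'"
proof -
  obtain p where p: "lead_coeff p = 1" "\<forall>i. coeff p i \<in> \<int>" "poly p z = 0"
    using z by (auto simp: algebraic_int.simps)
  have "coeff p i \<in> R" for i
    using p(2) fin_int_ring_closed(5)[OF R] by (metis Ints_cases)
  thus ?thesis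
    using fin_int_ring_adjoin[OF R p(1) _ p(3)] that by blast
qed

lemma fin_int_ring_of_algebraic_ints:
  assumes "finite A" "\<And>x. x \<in> A \<Longrightarrow> algebraic_int x"
  obtains R where "fin_int_ring R" "A \<subseteq> R"
  using assms
proof (induction A arbitrary: thesis rule: finite_induct)
  case empty
  thus ?case using fin_int_ring_Ints by blast
next
  case (insert x A)
  obtain R where R: "fin_int_ring R" "A \<subseteq> R"
    using insert by blast
  obtain R' where "fin_int_ring R'" "R \<subseteq> R'" "x \<in> R'"
    using fin_int_ring_adjoin_algebraic_int[OF R(1), of x] insert.prems by blast
  thus ?case using insert.prems(1)[of R'] R by auto
qed

lemma algebraic_int_add:
  assumes "algebraic_int (x::complex)" "algebraic_int y"
  shows "algebraic_int (x + y)"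
  by (rule fin_int_ring_of_algebraic_ints[of "{x, y}"])
     (use assms fin_int_ring_algebraic_int fin_int_ring_closed(3) in auto)

lemma algebraic_int_mult:
  assumes "algebraic_int (x::complex)" "algebraic_int y"
  shows "algebraic_int (x * y)"
  by (rule fin_int_ring_of_algebraic_ints[of "{x, y}"])
     (use assms fin_int_ring_algebraic_int fin_int_ring_closed(2) in auto)

lemma algebraic_int_pow:
  assumes "algebraic_int (x::complex)"
  shows "algebraic_int (x ^ n)"
  by (induction n) (use assms algebraic_int_mult in auto)

lemma algebraic_int_sum:
  assumes "\<And>i. i \<in> I \<Longrightarrow> algebraic_int (f i :: complex)"
  shows "algebraic_int (sum f I)"
  using assms by (induction I rule: infinite_finite_induct) (auto intro: algebraic_int_add)

lemma algebraic_int_poly: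
  assumes "\<And>i. algebraic_int (coeff p i)" "algebraic_int (x::complex)"
  shows "algebraic_int (poly p x)"
  unfolding poly_altdef by (intro algebraic_int_sum algebraic_int_mult algebraic_int_pow assms)

lemma algebraic_int_integral:
  fixes p :: "complex poly"
  assumes "lead_coeff p = 1" "\<And>i. algebraic_int (coeff p i)" "poly p z = 0"
  shows "algebraic_int z"
proof -
  obtain R where R: "fin_int_ring R" "set (coeffs p) \<subseteq> R"
    by (rule fin_int_ring_of_algebraic_ints[of "set (coeffs p)"])
       (use assms in \<open>auto simp: coeffs_def split: if_splits\<close>)
  have "coeff p i \<in> R" for i
  proof (cases "coeff p i = 0")
    case True
    thus ?thesis using fin_int_ring_closed(5)[OF R(1), of 0] by simp
  next
    case False
    thus ?thesis
      using R(2) coeff_in_coeffs[of p i] le_degree[of p i] by (cases "p = 0") auto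
  qed
  then obtain R' where "fin_int_ring R'" "z \<in> R'"
    using fin_int_ring_adjoin[OF R(1) assms(1) _ assms(3)] by blast
  thus ?thesis by (rule fin_int_ring_algebraic_int)
qed

lemma algebraic_int_of_power:
  assumes "algebraic_int (z ^ n :: complex)" "n > 0"
  shows "algebraic_int z"
  by (rule algebraic_int_root[OF assms(1), of "monom 1 n"])
     (use assms(2) in \<open>auto simp: poly_monom degree_monom_eq\<close>)



section \<open>Power series with algebraic integer coefficients\<close>

text \<open>
  The holomorphic functions on the unit disc whose Taylor series at \<open>0\<close> has algebraic integer
  coefficients: these are the power series in \<open>q\<close> (or a root of it) that modular functions are
  expanded in. Working over all algebraic integers instead of \<open>\<int>\<close> makes roots of unity into
  harmless constants, so that no Galois argument is required anywhere.
\<close>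

definition intdisc :: "(complex \<Rightarrow> complex) \<Rightarrow> bool" where
  "intdisc h \<longleftrightarrow> h holomorphic_on ball 0 1 \<and>
     (\<exists>F. h has_fps_expansion F \<and> (\<forall>n. algebraic_int (fps_nth F n)))"

lemma algebraic_int_fps_mult:
  fixes F G :: "complex fps"
  assumes "\<And>n. algebraic_int (fps_nth F n)" "\<And>n. algebraic_int (fps_nth G n)"
  shows "algebraic_int (fps_nth (F * G) n)"
  unfolding fps_mult_nth by (intro algebraic_int_sum algebraic_int_mult assms)

lemma algebraic_int_fps_inverse:
  fixes F :: "complex fps"
  assumes "\<And>n. algebraic_int (fps_nth F n)" "algebraic_int (inverse (fps_nth F 0))"
  shows "algebraic_int (fps_nth (inverse F) n)"
proof (induction n rule: less_induct)
  case (less n)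
  show ?case
  proof (cases n)
    case 0
    thus ?thesis using assms(2) by simp
  next
    case (Suc m)
    have "fps_nth (inverse F) n =
        - inverse (fps_nth F 0) * (\<Sum>i=1..n. fps_nth F i * fps_nth (inverse F) (n - i))"
      using Suc by (simp add: fps_inverse_def sum_distrib_left)
    also have "algebraic_int \<dots>"
      by (intro algebraic_int_mult algebraic_int_minus algebraic_int_sum assms less.IH) auto
    finally show ?thesis .
  qed
qed

lemma intdisc_const: "algebraic_int c \<Longrightarrow> intdisc (\<lambda>_. c)"
  unfolding intdisc_def
  by (intro conjI exI[of _ "fps_const c"] holomorphic_intros fps_expansion_intros) auto

lemma intdisc_power_id: "intdisc (\<lambda>u. u ^ m)"
  unfolding intdisc_def
  by (intro conjI exI[of _ "fps_X ^ m"] holomorphic_intros fps_expansion_intros) auto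

lemma intdisc_add:
  assumes "intdisc f" "intdisc g"
  shows "intdisc (\<lambda>u. f u + g u)"
proof -
  obtain F G where "f has_fps_expansion F" "\<And>n. algebraic_int (fps_nth F n)"
    "g has_fps_expansion G" "\<And>n. algebraic_int (fps_nth G n)"
    using assms by (auto simp: intdisc_def)
  thus ?thesis
    using assms unfolding intdisc_def
    by (intro conjI exI[of _ "F + G"] holomorphic_intros fps_expansion_intros allI)
       (auto intro: algebraic_int_add)
qed

lemma intdisc_mult:
  assumes "intdisc f" "intdisc g"
  shows "intdisc (\<lambda>u. f u * g u)"
proof -
  obtain F G where "f has_fps_expansion F" "\<And>n. algebraic_int (fps_nth F n)"
    "g has_fps_expansion G" "\<And>n. algebraic_int (fps_nth G n)"
    using assms by (auto simp: intdisc_def)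
  thus ?thesis
    using assms unfolding intdisc_def
    by (intro conjI exI[of _ "F * G"] holomorphic_intros fps_expansion_intros allI)
       (auto intro: algebraic_int_fps_mult)
qed

lemma intdisc_minus: "intdisc f \<Longrightarrow> intdisc (\<lambda>u. - f u)"
  using intdisc_mult[OF intdisc_const[of "-1"], of f] by simp

lemma intdisc_power: "intdisc f \<Longrightarrow> intdisc (\<lambda>u. f u ^ m)"
  by (induction m) (auto intro: intdisc_mult intdisc_const)

lemma intdisc_inverse:
  assumes "intdisc f" "\<And>u. norm u < 1 \<Longrightarrow> f u \<noteq> 0" "algebraic_int (inverse (f 0))"
  shows "intdisc (\<lambda>u. inverse (f u))"
proof -
  obtain F where F: "f has_fps_expansion F" "\<And>n. algebraic_int (fps_nth F n)"
    using assms by (auto simp: intdisc_def)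
  have 0: "fps_nth F 0 = f 0"
    using F(1) has_fps_expansion_imp_0_eq_fps_nth_0 by metis
  thus ?thesis
    using assms F unfolding intdisc_def
    by (intro conjI exI[of _ "inverse F"] holomorphic_intros has_fps_expansion_inverse allI
          algebraic_int_fps_inverse) auto
qed

lemma intdisc_0: "intdisc f \<Longrightarrow> algebraic_int (f 0)"
  using has_fps_expansion_imp_0_eq_fps_nth_0 unfolding intdisc_def by metis

lemma intdisc_holomorphic: "intdisc f \<Longrightarrow> f holomorphic_on ball 0 1"
  by (simp add: intdisc_def)

lemma intdisc_compose:
  assumes f: "intdisc f" and c: "algebraic_int c" "norm c \<le> 1" and m: "m > 0"
  shows "intdisc (\<lambda>u. f (c * u ^ m))"
proof -
  obtain F where F: "f has_fps_expansion F" "\<And>n. algebraic_int (fps_nth F n)"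
    using assms by (auto simp: intdisc_def)
  define G where "G = fps_const c * fps_X ^ m"
  have "(\<lambda>u. c * u ^ m) has_fps_expansion G"
    unfolding G_def by (intro fps_expansion_intros)
  hence "(f \<circ> (\<lambda>u. c * u ^ m)) has_fps_expansion fps_compose F G"
    using F(1) m by (intro has_fps_expansion_compose) (auto simp: G_def)
  moreover have "algebraic_int (fps_nth (fps_compose F G) n)" for n
  proof -
    have "G ^ i = fps_const (c ^ i) * fps_X ^ (m * i)" for i
      by (simp add: G_def power_mult_distrib fps_const_power power_mult)
    hence "algebraic_int (fps_nth (G ^ i) n)" for i
      using c(1) by (auto intro: algebraic_int_pow)
    thus ?thesis
      unfolding fps_compose_nth by (intro algebraic_int_sum algebraic_int_mult F)
  qed
  moreover have "(\<lambda>u. f (c * u ^ m)) holomorphic_on ball 0 1"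
  proof -
    have "(f \<circ> (\<lambda>u. c * u ^ m)) holomorphic_on ball 0 1"
    proof (rule holomorphic_on_compose_gen)
      show "(\<lambda>u. c * u ^ m) ` ball 0 1 \<subseteq> ball 0 1"
      proof safe
        fix u :: complex assume "u \<in> ball 0 1"
        hence "norm u ^ m < 1" using m by (simp add: power_less_one_iff)
        moreover have "norm c * norm u ^ m \<le> norm u ^ m"
          using c(2) by (intro mult_left_le_one_le) auto
        ultimately show "c * u ^ m \<in> ball 0 1"
          by (simp add: norm_mult norm_power)
      qed
    qed (use intdisc_holomorphic[OF f] in \<open>auto intro!: holomorphic_intros\<close>)
    thus ?thesis by (simp add: o_def)
  qed
  ultimately show ?thesis
    unfolding intdisc_def by (auto simp: o_def)
qed

lemma intdisc_divide_id:
  assumes f: "intdisc f" and f0: "f 0 = 0"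
  obtains g where "intdisc g" "\<And>u. norm u < 1 \<Longrightarrow> f u = u * g u"
proof -
  obtain F where F: "f has_fps_expansion F" "\<And>n. algebraic_int (fps_nth F n)"
    using assms by (auto simp: intdisc_def)
  show ?thesis
  proof (cases "F = 0")
    case True
    have "f u = 0" if "norm u < 1" for u
      using has_fps_expansion_0_analytic_continuation[of f "ball 0 1" u]
        F True intdisc_holomorphic[OF f] that by auto
    thus ?thesis
      using that[of "\<lambda>_. 0"] by (auto intro: intdisc_const)
  next
    case False
    have "fps_nth F 0 = 0"
      using F(1) f0 has_fps_expansion_imp_0_eq_fps_nth_0 by metis
    hence "1 \<le> subdegree F"
      using False by (metis One_nat_def Suc_leI not_gr_zero subdegree_eq_0_iff)
    define g where "g = (\<lambda>u. if u = 0 then fps_nth F 1 else f u / u ^ 1)"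
    have g: "g has_fps_expansion fps_shift 1 F"
      unfolding g_def by (rule has_fps_expansion_shift) (use F \<open>1 \<le> subdegree F\<close> in auto)
    have "g holomorphic_on ball 0 1"
    proof (rule no_isolated_singularity')
      have "isCont g 0"
        using has_fps_expansion_imp_continuous[OF g] .
      thus "(g \<longlongrightarrow> g z) (at z within ball 0 1)" if "z \<in> {0}" for z
        using that by (auto simp: isCont_def intro: tendsto_within_subset)
      have "(\<lambda>u. f u / u) holomorphic_on ball 0 1 - {0}"
        using intdisc_holomorphic[OF f] by (auto intro!: holomorphic_intros)
      thus "g holomorphic_on ball 0 1 - {0}"
        by (rule holomorphic_transform) (auto simp: g_def)
    qed auto
    hence "intdisc g"
      unfolding intdisc_def using g F(2) by auto
    moreover have "f u = u * g u" for u
      using f0 by (auto simp: g_def)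
    ultimately show ?thesis using that by blast
  qed
qed

lemma convergent_prod_one_minus_powers:
  fixes u :: "'a :: {real_normed_field, banach}"
  assumes "norm u < 1"
  shows "convergent_prod (\<lambda>n. 1 - u ^ Suc n)"
proof -
  have "summable (\<lambda>n. norm (- (u ^ Suc n)))"
    using assms summable_geometric[of "norm u"] by (simp add: norm_power norm_mult summable_mult)
  hence "convergent_prod (\<lambda>n. 1 + (- (u ^ Suc n)))"
    by (intro abs_convergent_prod_imp_convergent_prod)
       (simp add: abs_convergent_prod_conv_summable)
  thus ?thesis by simp
qed

text \<open>
  The partial products are polynomials with integer coefficients that converge locally uniformly.
  Hence each Taylor coefficient of the limit is a limit of integers, and so an integer.
\<close>

lemma intdisc_euler_product: "intdisc (\<lambda>u. \<Prod>n. 1 - u ^ Suc n)"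
proof -
  define P where "P = (\<lambda>N (u::complex). \<Prod>n<N. 1 - u ^ Suc n)"
  define f where "f = (\<lambda>u::complex. \<Prod>n. 1 - u ^ Suc n)"
  have lim: "(\<lambda>N. P N u) \<longlonglongrightarrow> f u" if "norm u < 1" for u
    using convergent_prod_LIMSEQ[OF convergent_prod_one_minus_powers[OF that]]
    unfolding P_def f_def by (subst (asm) LIMSEQ_lessThan_iff_atMost[symmetric]) auto
  have ulim: "uniform_limit (cball 0 r) P f sequentially" if r: "r < 1" for r
  proof (cases "r < 0")
    case True
    thus ?thesis by (simp add: uniform_limit_iff)
  next
    case False
    have "uniformly_convergent_on (cball 0 r) (\<lambda>N x. \<Prod>n<N. 1 - x ^ Suc n :: complex)"
    proof (rule uniformly_convergent_on_prod')
      have "uniformly_convergent_on (cball 0 r) (\<lambda>N x. \<Sum>n<N. norm (1 - x ^ Suc n - (1::complex)))"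
      proof (rule Weierstrass_m_test')
        show "norm (norm (1 - x ^ Suc n - (1::complex))) \<le> r ^ Suc n" if "x \<in> cball 0 r" for n x
        proof -
          have "norm (1 - x ^ Suc n - 1) = norm x ^ Suc n"
            by (simp add: norm_power norm_mult)
          also have "\<dots> \<le> r ^ Suc n"
            using that by (intro power_mono) auto
          finally show ?thesis by simp
        qed
        show "summable (\<lambda>n. r ^ Suc n)"
          using r False by (auto intro!: summable_mult summable_geometric)
      qed
      thus "uniformly_convergent_on (cball 0 r)
          (\<lambda>N x. \<Sum>n<N. norm (1 - x ^ Suc n - (1::complex)))" .
    qed (auto intro!: continuous_intros)
    then obtain g where g: "uniform_limit (cball 0 r) P g sequentially"
      unfolding P_def uniformly_convergent_on_def by blast
    have "g x = f x" if "x \<in> cball 0 r" for x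
      using LIMSEQ_unique[OF tendsto_uniform_limitI[OF g that] lim[of x]] that r by auto
    thus ?thesis
      using g uniform_limit_cong' by metis
  qed
  have hol: "f holomorphic_on ball 0 1"
  proof (rule holomorphic_uniform_sequence)
    show "\<exists>d>0. cball x d \<subseteq> ball 0 1 \<and> uniform_limit (cball x d) P f sequentially"
      if "x \<in> ball 0 1" for x
    proof -
      define d where "d = (1 - norm x) / 2"
      have d: "d > 0" "norm x + d < 1"
        using that by (auto simp: d_def field_simps)
      have sub: "cball x d \<subseteq> cball 0 (norm x + d)"
        by (auto simp: dist_norm intro: order_trans[OF norm_triangle_sub])
           (smt (verit) norm_minus_commute norm_triangle_sub)
      hence "cball x d \<subseteq> ball 0 1"
        using d(2) by force
      thus ?thesis
        using d sub uniform_limit_on_subset[OF ulim[OF d(2)] sub] by blast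
    qed
  qed (auto simp: P_def intro!: holomorphic_intros)
  have F: "f has_fps_expansion fps_expansion f 0"
    by (rule has_fps_expansion_fps_expansion[OF _ _ hol]) auto
  have "fps_nth (fps_expansion f 0) n \<in> \<int>" for n
  proof (rule Lim_in_closed_set[OF closed_Ints])
    define Q where "Q = (\<lambda>N. \<Prod>k<N. (1 - fps_X ^ Suc k :: complex fps))"
    have Q: "P N has_fps_expansion Q N" for N
      unfolding P_def Q_def by (intro fps_expansion_intros)
    have Q_Ints: "\<forall>n. fps_nth (Q N) n \<in> \<int>" for N
    proof (induction N)
      case (Suc N)
      have "fps_nth (1 - fps_X ^ Suc N :: complex fps) n \<in> \<int>" for n
        by (auto simp: fps_X_power_nth simp del: power_Suc)
      thus ?case
        using Suc by (auto simp: Q_def fps_mult_nth intro!: Ints_sum Ints_mult simp del: power_Suc)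
    qed (auto simp: Q_def)
    show "\<forall>\<^sub>F N in sequentially. fps_nth (Q N) n \<in> \<int>"
      using Q_Ints by auto
    have "P N holomorphic_on ball 0 (1/2)" for N
      unfolding P_def by (intro holomorphic_intros)
    moreover have "uniform_limit (ball 0 (1/2)) P f sequentially"
      by (rule uniform_limit_on_subset[OF ulim[of "1/2"]]) auto
    ultimately have "(\<lambda>N. (deriv ^^ n) (P N) 0 / fact n) \<longlonglongrightarrow> (deriv ^^ n) f 0 / fact n"
      by (intro tendsto_intros higher_deriv_complex_uniform_limit[where A = "ball 0 (1/2)"])
         auto
    thus "(\<lambda>N. fps_nth (Q N) n) \<longlonglongrightarrow> fps_nth (fps_expansion f 0) n"
      by (simp add: fps_nth_fps_expansion[OF Q] fps_nth_fps_expansion[OF F])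
  qed auto
  thus ?thesis
    using F hol unfolding intdisc_def f_def[symmetric] by (auto intro: int_imp_algebraic_int)
qed

lemma prodinf_one_minus_powers_nonzero:
  assumes "norm (u::complex) < 1"
  shows "(\<Prod>n. 1 - u ^ Suc n) \<noteq> 0"
proof (rule prodinf_nonzero[OF convergent_prod_one_minus_powers[OF assms]])
  show "1 - u ^ Suc n \<noteq> 0" for n
  proof
    assume "1 - u ^ Suc n = 0"
    hence "norm u ^ Suc n = 1"
      by (metis norm_one norm_power right_minus_eq)
    moreover have "norm u ^ Suc n < 1"
      using assms by (subst power_less_one_iff) auto
    ultimately show False by simp
  qed
qed



section \<open>Partial fractions and the arctangent integral\<close>

text \<open>
  This is the logarithmic derivative of Euler's reflection formula
  \<open>rGamma z * rGamma (1 - z) = sin (pi * z) / pi\<close> at \<open>z = \<i> * x\<close>: it expresses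
  \<open>Digamma (1 - z) - Digamma z\<close> through the cotangent, and the series of the Digamma function turn
  the left-hand side into the partial fractions.
\<close>

lemma coth_partial_fractions:
  assumes x: "x > (0::real)"
  shows "(\<lambda>k. x / (x\<^sup>2 + (real (Suc k))\<^sup>2)) sums
           (pi * (1 / (exp (2 * pi * x) - 1) + 1 / 2) - 1 / (2 * x))"
proof -
  define z where "z = \<i> * of_real x"
  have z_ne: "z + of_nat k \<noteq> 0" "1 - z + of_nat k \<noteq> 0" "z \<noteq> 0" for k
    using x by (auto simp: z_def complex_eq_iff)
  have nonpos: "z \<notin> \<int>\<^sub>\<le>\<^sub>0" "1 - z \<notin> \<int>\<^sub>\<le>\<^sub>0"
    using x by (auto simp: z_def complex_eq_iff elim!: nonpos_Ints_cases)
  define s where "s = sin (of_real pi * z)"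
  have reflect: "(Digamma (1 - z) - Digamma z) * s = of_real pi * cos (of_real pi * z)"
  proof -
    have "((\<lambda>z. rGamma z * rGamma (1 - z)) has_field_derivative
        (-rGamma z * Digamma z) * rGamma (1 - z) +
        (-rGamma (1 - z) * Digamma (1 - z)) * (-1) * rGamma z) (at z)"
      using nonpos by (auto intro!: derivative_eq_intros)
    hence "((\<lambda>z. rGamma z * rGamma (1 - z)) has_field_derivative
        (Digamma (1 - z) - Digamma z) * (rGamma z * rGamma (1 - z))) (at z)"
      by (simp add: algebra_simps)
    hence "((\<lambda>z. sin (of_real pi * z) / of_real pi) has_field_derivative
        (Digamma (1 - z) - Digamma z) * (sin (of_real pi * z) / of_real pi)) (at z)"
      by (simp only: rGamma_reflection_complex)
    moreover have "((\<lambda>z. sin (of_real pi * z) / of_real pi) has_field_derivative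
        cos (of_real pi * z)) (at z)"
      by (auto intro!: derivative_eq_intros)
    ultimately have "(Digamma (1 - z) - Digamma z) * (sin (of_real pi * z) / of_real pi) =
        cos (of_real pi * z)"
      by (rule DERIV_unique)
    thus ?thesis
      by (simp add: s_def field_simps)
  qed
  define a where "a = (\<lambda>k. inverse (z + of_nat k) - inverse (1 - z + of_nat k))"
  define b where "b = (\<lambda>k. -2 * \<i> * of_real (x / (x\<^sup>2 + (real (Suc k))\<^sup>2)))"
  have "a sums (Digamma (1 - z) - Digamma z)"
  proof -
    have "(\<lambda>k. (inverse (of_nat (Suc k)) - inverse (1 - z + of_nat k)) -
           (inverse (of_nat (Suc k)) - inverse (z + of_nat k))) sums
           ((Digamma (1 - z) + euler_mascheroni) - (Digamma z + euler_mascheroni))"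
      using summable_Digamma[of "1 - z"] summable_Digamma[of z] z_ne(2)[of 0] z_ne(3)
      by (intro sums_diff) (simp_all add: Digamma_def summable_sums)
    thus ?thesis by (simp add: a_def)
  qed
  \<comment> \<open>The terms of \<open>a\<close> pair \<open>z + k\<close> with \<open>k + 1 - z\<close>. Subtracting this telescoping series pairs \<open>k + 1 + z\<close> with \<open>k + 1 - z\<close>.\<close>
  moreover have "(\<lambda>k. inverse (z + of_nat k) - inverse (z + of_nat (Suc k))) sums
      (inverse (z + of_nat 0) - 0)"
    by (intro telescope_sums' filterlim_compose[OF tendsto_inverse_0]
          tendsto_add_filterlim_at_infinity[OF tendsto_const] tendsto_of_nat)
  ultimately have "(\<lambda>k. a k - (inverse (z + of_nat k) - inverse (z + of_nat (Suc k)))) sums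
      (Digamma (1 - z) - Digamma z - inverse z)"
    by (intro sums_diff) auto
  also have "(\<lambda>k. a k - (inverse (z + of_nat k) - inverse (z + of_nat (Suc k)))) = b"
  proof
    fix k
    have eq: "inverse (z + c) - inverse (c - z) = -2 * \<i> * (x / (x\<^sup>2 + c\<^sup>2))"
      if "z + c \<noteq> 0" "c - z \<noteq> 0" for c
    proof -
      have "inverse (z + c) - inverse (c - z) = - 2 * z / ((c - z) * (c + z))"
        using that by (simp add: field_simps)
      also have "(c - z) * (c + z) = x\<^sup>2 + c\<^sup>2"
        by (simp add: z_def algebra_simps power2_eq_square)
      finally show ?thesis by (simp add: z_def)
    qed
    show "a k - (inverse (z + of_nat k) - inverse (z + of_nat (Suc k))) = b k"
      using eq[of "of_nat (Suc k)"] z_ne(1)[of "Suc k"] z_ne(2)[of k]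
      by (simp add: a_def b_def algebra_simps)
  qed
  finally have "(\<lambda>k. b k * (\<i> / 2)) sums ((Digamma (1 - z) - Digamma z - inverse z) * (\<i> / 2))"
    by (rule sums_mult2)
  moreover have "(Digamma (1 - z) - Digamma z - inverse z) * (\<i> / 2) =
      of_real (pi * (1 / (exp (2 * pi * x) - 1) + 1 / 2) - 1 / (2 * x))"
  proof -
    define q where "q = exp (pi * x)"
    have q: "q > 1" using x by (simp add: q_def)
    have q2: "exp (2 * pi * x) = q * q"
      by (simp add: q_def flip: exp_add)
    have e: "exp (\<i> * (of_real pi * z)) = of_real (1 / q)" "exp (- (\<i> * (of_real pi * z))) = of_real q"
      by (simp_all add: z_def q_def exp_minus field_simps flip: exp_of_real)
    have s: "s = of_real (1 / q - q) / (2 * \<i>)"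
      by (simp only: s_def sin_exp_eq e) simp
    have c: "cos (of_real pi * z) = of_real ((1 / q + q) / 2)"
      by (simp only: cos_exp_eq e) simp
    have qq: "1 / q - q \<noteq> 0"
      using q by (simp add: field_simps) (smt (verit) mult_less_cancel_left2)
    have "s \<noteq> 0" unfolding s using qq by (metis complex_i_not_zero divide_eq_0_iff mult_eq_0_iff of_real_eq_0_iff zero_neq_numeral)
    hence "Digamma (1 - z) - Digamma z = of_real pi * cos (of_real pi * z) / s"
      using reflect by (simp add: field_simps)
    also have "\<dots> = \<i> * of_real (pi * (1 / q + q) / (1 / q - q))"
    proof -
      have "of_real pi * of_real (C / 2) / (of_real D / (2 * \<i>)) = \<i> * of_real (pi * C / D)"
        if "D \<noteq> 0" for C D
        using that by (simp add: field_simps)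
      from this[OF qq] show ?thesis unfolding s c .
    qed
    finally have D: "Digamma (1 - z) - Digamma z = \<i> * of_real (pi * (1 / q + q) / (1 / q - q))" .
    have "(\<i> * of_real t - inverse z) * (\<i> / 2) = of_real (- t / 2 - 1 / (2 * x))" for t
      using x by (simp add: z_def field_simps)
    hence "(Digamma (1 - z) - Digamma z - inverse z) * (\<i> / 2) =
       of_real (- (pi * (1 / q + q) / (1 / q - q)) / 2 - 1 / (2 * x))"
      unfolding D .
    also have "- (pi * (1 / q + q) / (1 / q - q)) / 2 - 1 / (2 * x) =
        pi * (1 / (exp (2 * pi * x) - 1) + 1 / 2) - 1 / (2 * x)"
    proof -
      have "q * q - 1 \<noteq> 0"
        using q less_1_mult[of q q] by simp
      moreover have "1 / q + q = (1 + q * q) / q" "1 / q - q = (1 - q * q) / q"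
        using q by (simp_all add: field_simps)
      hence "(1 / q + q) / (1 / q - q) = (1 + q * q) / (1 - q * q)"
        using q by simp
      ultimately show ?thesis
        unfolding q2 by (simp add: divide_simps) (simp add: algebra_simps)
    qed
    finally show ?thesis .
  qed
  moreover have "(\<lambda>k. b k * (\<i> / 2)) = (\<lambda>k. of_real (x / (x\<^sup>2 + (real (Suc k))\<^sup>2)))"
  proof -
    have "-2 * \<i> * c * (\<i> / 2) = c" for c by (simp add: algebra_simps)
    thus ?thesis by (simp only: b_def)
  qed
  ultimately show ?thesis
    by (simp only: sums_of_real_iff)
qed

text \<open>
  Comparison of the sum of a decreasing function with its integral; the antiderivative of \<open>c / (c\<^sup>2 + t\<^sup>2)\<close> that
  is used here is \<open>- arctan (c / t)\<close>, because it vanishes at infinity.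
\<close>

lemma arctan_tail_bounds:
  assumes c: "c > (0::real)" and M: "M > 0"
  defines "r \<equiv> (\<Sum>k. c / (c\<^sup>2 + (real (Suc (k + M)))\<^sup>2))"
  shows "r \<le> arctan (c / M)" "arctan (c / M) \<le> r + c / (real M)\<^sup>2"
proof -
  define g where "g = (\<lambda>t. c / (c\<^sup>2 + t\<^sup>2))"
  define d where "d = (\<lambda>k. arctan (c / real (k + M)) - arctan (c / real (Suc k + M)))"
  have g_nonneg: "g t \<ge> 0" for t
    using c by (simp add: g_def)
  \<comment> \<open>By the mean value theorem \<open>d k\<close> is a value of the decreasing function \<open>g\<close> between \<open>k + M\<close> and \<open>k + M + 1\<close>.\<close>
  have d_bounds: "g (real (Suc (k + M))) \<le> d k \<and> d k \<le> g (real (k + M))" for k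
  proof -
    define t where "t = real (k + M)"
    have t: "t > 0" using M by (simp add: t_def)
    have "\<exists>z. t < z \<and> z < t + 1 \<and>
       (- arctan (c / (t + 1))) - (- arctan (c / t)) = ((t + 1) - t) * g z"
    proof (rule MVT2)
      fix u assume u: "t \<le> u" "u \<le> t + 1"
      hence "u \<noteq> 0" using t by simp
      thus "((\<lambda>t. - arctan (c / t)) has_real_derivative g u) (at u)"
        using c u t unfolding g_def
        by (auto intro!: derivative_eq_intros simp: divide_simps add_pos_pos)
           (simp add: power2_eq_square algebra_simps)
    qed auto
    then obtain z where z: "t < z" "z < t + 1" "arctan (c / t) - arctan (c / (t + 1)) = g z"
      by auto
    have "g (t + 1) \<le> g z"
      unfolding g_def using z t c by (intro divide_left_mono add_left_mono power_mono mult_pos_pos add_pos_pos) auto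
    moreover have "g z \<le> g t"
      unfolding g_def using z t c by (intro divide_left_mono add_left_mono power_mono mult_pos_pos add_pos_pos) auto
    moreover have "d k = g z"
      using z(3) by (simp add: d_def t_def add_ac)
    ultimately show ?thesis by (simp add: t_def add_ac)
  qed
  have "(\<lambda>k. arctan (c / real (k + M))) \<longlonglongrightarrow> arctan 0"
    by (intro tendsto_arctan tendsto_divide_0[OF tendsto_const] filterlim_at_top_imp_at_infinity
        filterlim_compose[OF filterlim_real_sequentially] filterlim_add_const_nat_at_top)
  hence d: "d sums arctan (c / M)"
    unfolding d_def using telescope_sums'[of "\<lambda>k. arctan (c / real (k + M))" "arctan 0"] by simp
  have sg1: "summable (\<lambda>k. g (real (Suc (k + M))))"
    by (rule summable_comparison_test'[OF sums_summable[OF d], of 0])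
       (use d_bounds g_nonneg in auto)
  have r: "r = (\<Sum>k. g (real (Suc (k + M))))"
    by (simp only: r_def g_def)
  show "r \<le> arctan (c / M)"
    unfolding r sums_unique[OF d]
    using d_bounds by (intro suminf_le sg1 sums_summable[OF d]) blast
  have sg0: "summable (\<lambda>k. g (real (k + M)))"
    using sg1 by (subst summable_Suc_iff[symmetric]) simp
  have "arctan (c / M) \<le> (\<Sum>k. g (real (k + M)))"
    unfolding sums_unique[OF d]
    using d_bounds by (intro suminf_le sg0 sums_summable[OF d]) blast
  also have "\<dots> = r + g M"
    using suminf_split_head[OF sg0] by (simp add: r_def g_def)
  also have "g M \<le> c / (real M)\<^sup>2"
    unfolding g_def using c M by (intro divide_left_mono) (auto intro!: mult_pos_pos add_nonneg_pos)
  finally show "arctan (c / M) \<le> r + c / (real M)\<^sup>2" by simp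
qed

definition arctan_quot :: "real \<Rightarrow> real" where
  "arctan_quot u = (if u = 0 then 1 else arctan u / u)"

definition arctan_int :: "real \<Rightarrow> real" where
  "arctan_int y = integral {0..y} arctan_quot"

lemma arctan_quot_continuous: "continuous_on A arctan_quot"
proof -
  have "isCont arctan_quot u" for u
  proof (cases "u = 0")
    case True
    have "((\<lambda>u. (arctan u - arctan 0) / (u - 0)) \<longlongrightarrow> inverse (1 + 0\<^sup>2)) (at 0)"
      using DERIV_arctan[of 0] unfolding has_field_derivative_iff by simp
    hence "((\<lambda>u. (arctan u - arctan 0) / (u - 0)) \<longlongrightarrow> 1) (at (0::real))"
      by simp
    hence "(arctan_quot \<longlongrightarrow> 1) (at 0)"
      by (rule Lim_transform_eventually)
         (auto simp: arctan_quot_def eventually_at intro!: exI[of _ 1])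
    thus ?thesis by (simp add: isCont_def arctan_quot_def True)
  next
    case False
    have "\<forall>\<^sub>F v in nhds u. v \<in> - {0}"
      by (intro eventually_nhds_in_open) (use False in auto)
    hence ev: "\<forall>\<^sub>F v in nhds u. arctan_quot v = arctan v / v"
      by eventually_elim (auto simp: arctan_quot_def)
    have "isCont (\<lambda>v. arctan v / v) u"
      using False by (intro continuous_intros)
    thus ?thesis
      using isCont_cong[OF ev] by simp
  qed
  thus ?thesis
    by (simp add: continuous_at_imp_continuous_on)
qed

lemma arctan_quot_antimono:
  assumes "0 \<le> u" "u \<le> v"
  shows "arctan_quot v \<le> arctan_quot u"
proof -
  have deriv_neg: "inverse (1 + t\<^sup>2) * t \<le> arctan t" if "t \<ge> 0" for t :: real
  proof -
    have "(\<lambda>t. arctan t - inverse (1 + t\<^sup>2) * t) 0 \<le> (\<lambda>t. arctan t - inverse (1 + t\<^sup>2) * t) t"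
    proof (rule DERIV_nonneg_imp_nondecreasing[OF that])
      fix s :: real assume "0 \<le> s"
      have "1 + s\<^sup>2 \<noteq> 0"
        by (smt (verit) zero_le_power2)
      hence "((\<lambda>t. arctan t - inverse (1 + t\<^sup>2) * t) has_real_derivative
          inverse (1 + s\<^sup>2) - (- (inverse (1 + s\<^sup>2) * (2 * s) * inverse (1 + s\<^sup>2)) * s +
            inverse (1 + s\<^sup>2))) (at s)"
        by (auto intro!: derivative_eq_intros)
      also have "inverse (1 + s\<^sup>2) - (- (inverse (1 + s\<^sup>2) * (2 * s) * inverse (1 + s\<^sup>2)) * s +
            inverse (1 + s\<^sup>2)) = 2 * (inverse (1 + s\<^sup>2) * s)\<^sup>2"
        by (simp add: power2_eq_square)
      finally show "\<exists>y. ((\<lambda>t. arctan t - inverse (1 + t\<^sup>2) * t) has_real_derivative y) (at s) \<and> 0 \<le> y"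
        by (auto intro!: exI)
    qed
    thus ?thesis by simp
  qed
  have pos: "arctan_quot v \<le> arctan_quot u" if "0 < u" "u \<le> v" for u v
  proof -
    have "(\<lambda>t. arctan t / t) v \<le> (\<lambda>t. arctan t / t) u"
    proof (rule DERIV_nonpos_imp_nonincreasing[OF that(2)])
      fix t assume "u \<le> t"
      hence t: "t > 0" using that by simp
      have "((\<lambda>t. arctan t / t) has_real_derivative (inverse (1 + t\<^sup>2) * t - arctan t) / (t * t)) (at t)"
        using t by (auto intro!: derivative_eq_intros)
      moreover have "(inverse (1 + t\<^sup>2) * t - arctan t) / (t * t) \<le> 0"
        using deriv_neg[of t] t by (intro divide_nonpos_pos) auto
      ultimately show "\<exists>y. ((\<lambda>t. arctan t / t) has_real_derivative y) (at t) \<and> y \<le> 0" by blast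
    qed
    thus ?thesis using that by (simp add: arctan_quot_def)
  qed
  show ?thesis
  proof (cases "u = 0")
    case True
    have "arctan v \<le> v" using arctan_le_self assms by simp
    thus ?thesis using True assms by (auto simp: arctan_quot_def field_simps)
  next
    case False
    thus ?thesis using pos assms by simp
  qed
qed

lemma arctan_int_deriv:
  assumes "y > 0"
  shows "(arctan_int has_real_derivative arctan y / y) (at y)"
proof -
  have "(arctan_int has_real_derivative arctan_quot y) (at y within {0..y + 1})"
    unfolding arctan_int_def
    by (rule integral_has_real_derivative[OF arctan_quot_continuous]) (use assms in auto)
  moreover have "at y within {0..y + 1} = at y"
    using assms by (intro at_within_interior) (auto simp: interior_cbox)
  ultimately show ?thesis using assms by (simp add: arctan_quot_def)
qed

lemma arctan_int_increment:
  assumes "0 \<le> a" "a < b"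
  shows "(b - a) * arctan_quot b \<le> arctan_int b - arctan_int a"
    "arctan_int b - arctan_int a \<le> (b - a) * arctan_quot a"
proof -
  have I: "arctan_quot integrable_on {s..t}" for s t
    by (intro integrable_continuous_real arctan_quot_continuous)
  have "arctan_int b = arctan_int a + integral {a..b} arctan_quot"
    unfolding arctan_int_def
    using assms by (intro Henstock_Kurzweil_Integration.integral_combine[symmetric] I) auto
  moreover have "integral {a..b} (\<lambda>_. arctan_quot b) \<le> integral {a..b} arctan_quot"
    using assms by (intro integral_le I arctan_quot_antimono) auto
  moreover have "integral {a..b} arctan_quot \<le> integral {a..b} (\<lambda>_. arctan_quot a)"
    using assms by (intro integral_le I arctan_quot_antimono) auto
  ultimately show "(b - a) * arctan_quot b \<le> arctan_int b - arctan_int a"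
    "arctan_int b - arctan_int a \<le> (b - a) * arctan_quot a"
    using assms by auto
qed

text \<open>
  Both sides vanish at \<open>1\<close> and have the same derivative, because \<open>arctan t + arctan (1 / t) = pi / 2\<close>. This is where
  the logarithm, and hence the factor \<open>\<tau> ^ 12\<close> in the transformation law, comes from.
\<close>

lemma arctan_int_inversion:
  assumes "y > 0"
  shows "arctan_int y - arctan_int (1 / y) = pi / 2 * ln y"
proof -
  define D where "D = (\<lambda>y. arctan_int y - arctan_int (1 / y) - pi / 2 * ln y)"
  have "(D has_real_derivative 0) (at t within {0<..})" if "t \<in> {0<..}" for t
  proof -
    have t: "t > 0" using that by simp
    have "(D has_real_derivative (arctan t / t - (arctan (1 / t) / (1 / t)) * (- 1 / t\<^sup>2) - pi / 2 * (1 / t))) (at t)"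
      unfolding D_def using t
      by (auto intro!: derivative_eq_intros arctan_int_deriv DERIV_chain2[OF arctan_int_deriv]
            simp: power2_eq_square)
    also have "arctan t / t - (arctan (1 / t) / (1 / t)) * (- 1 / t\<^sup>2) - pi / 2 * (1 / t) = 0"
      using t arctan_inverse[of t] by (simp add: inverse_eq_divide field_simps power2_eq_square)
    finally show ?thesis by (rule has_field_derivative_at_within)
  qed
  then obtain c where "\<And>t. t \<in> {0<..} \<Longrightarrow> D t = c"
    using has_field_derivative_zero_constant[of "{0<..}" D] convex_real_interval(3)[of 0] by metis
  hence "D y = D 1" using assms by simp
  thus ?thesis by (simp add: D_def)
qed

text \<open>
  The sums are Riemann sums of the decreasing function \<open>arctan_quot\<close> on \<open>[0, y]\<close>, so they differ
  from the integral by at most one mesh width.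
\<close>

lemma arctan_sum_limit:
  assumes y: "y > 0"
  shows "(\<lambda>M. \<Sum>m=1..M. arctan (real m * y / real M) / real m) \<longlonglongrightarrow> arctan_int y"
proof -
  have bounds: "norm ((\<Sum>m=1..M. arctan (real m * y / real M) / real m) - arctan_int y) \<le> y / M"
    if M: "M > 0" for M :: nat
  proof -
    define p where "p = (\<lambda>m. real m * y / M)"
    have step: "p (Suc m) - p m = y / M" for m
      using M by (simp add: p_def field_simps)
    have p: "0 \<le> p m" "p m < p (Suc m)" for m
      using M y by (auto simp: p_def field_simps)
    have eq: "(\<Sum>m=1..M. arctan (real m * y / real M) / real m) = (\<Sum>m<M. y / M * arctan_quot (p (Suc m)))"
      using M y by (intro sum.reindex_bij_witness[of _ Suc "\<lambda>m. m - 1"])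
         (auto simp: p_def arctan_quot_def field_simps)
    have ends: "p 0 = 0" "p M = y"
      using M by (auto simp: p_def)
    have tel: "arctan_int y = (\<Sum>m<M. arctan_int (p (Suc m)) - arctan_int (p m))"
      by (subst sum_lessThan_telescope) (simp add: ends, simp add: arctan_int_def)
    have up: "(\<Sum>m<M. y / M * arctan_quot (p (Suc m))) \<le> arctan_int y"
      unfolding tel using arctan_int_increment(1)[OF p] by (intro sum_mono) (simp add: step)
    have "arctan_int y \<le> (\<Sum>m<M. y / M * arctan_quot (p m))"
      unfolding tel using arctan_int_increment(2)[OF p] by (intro sum_mono) (simp add: step)
    also have "\<dots> = (\<Sum>m<M. y / M * arctan_quot (p (Suc m))) +
        (\<Sum>m<M. y / M * arctan_quot (p m) - y / M * arctan_quot (p (Suc m)))"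
      by (simp add: sum_subtractf)
    also have "(\<Sum>m<M. y / M * arctan_quot (p m) - y / M * arctan_quot (p (Suc m))) =
        y / M * arctan_quot (p 0) - y / M * arctan_quot (p M)"
      by (rule sum_lessThan_telescope')
    also have "\<dots> \<le> y / M"
      using y by (simp add: ends arctan_quot_def)
    finally show ?thesis
      using up unfolding eq real_norm_def by linarith
  qed
  have "(\<lambda>M. y / real M) \<longlonglongrightarrow> 0"
    by (rule lim_const_over_n)
  hence "(\<lambda>M. (\<Sum>m=1..M. arctan (real m * y / real M) / real m) - arctan_int y) \<longlonglongrightarrow> 0"
    by (rule Lim_null_comparison[rotated])
       (use bounds in \<open>auto intro!: eventually_mono[OF eventually_gt_at_top[of 0]]\<close>)
  thus ?thesis
    by (simp add: LIM_zero_iff)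
qed

lemma box_sum_symmetric:
  assumes "y > (0::real)"
  shows "(\<Sum>m=1..M. \<Sum>k=1..M. (1 / y) / ((real m * (1 / y))\<^sup>2 + (real k)\<^sup>2)) =
         (\<Sum>m=1..M. \<Sum>k=1..M. y / ((real m * y)\<^sup>2 + (real k)\<^sup>2))"
proof -
  have "(1 / y) / ((real m * (1 / y))\<^sup>2 + (real k)\<^sup>2) = y / ((real k * y)\<^sup>2 + (real m)\<^sup>2)"
    if "m \<ge> 1" "k \<ge> 1" for m k
  proof -
    have "(real m * (1 / y))\<^sup>2 + (real k)\<^sup>2 = ((real k * y)\<^sup>2 + (real m)\<^sup>2) / y\<^sup>2"
      using assms by (simp add: field_simps)
    thus ?thesis using assms by (simp add: power2_eq_square)
  qed
  hence "(\<Sum>m=1..M. \<Sum>k=1..M. (1 / y) / ((real m * (1 / y))\<^sup>2 + (real k)\<^sup>2)) =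
      (\<Sum>m=1..M. \<Sum>k=1..M. y / ((real k * y)\<^sup>2 + (real m)\<^sup>2))"
    by (intro sum.cong refl) auto
  also have "\<dots> = (\<Sum>m=1..M. \<Sum>k=1..M. y / ((real m * y)\<^sup>2 + (real k)\<^sup>2))"
    by (rule sum.swap)
  finally show ?thesis .
qed

section \<open>Lambert series and the inversion formula on the imaginary axis\<close>

text \<open>
  Insert the partial fractions of the hyperbolic cotangent into the Lambert series and cut the inner
  sum at \<open>k = M\<close>. The double sum over the square is kept, because it is invariant under
  \<open>y \<mapsto> 1 / y\<close>; the tails \<open>k > M\<close> converge to an arctangent integral. The double series itself
  diverges, so the order of summation matters: the limit on the right measures exactly this.
\<close>

lemma Lambert_partial_sum_asymptotics:
  assumes y: "y > (0::real)"
  shows "(\<lambda>M. (\<Sum>m=1..M. 1 / (real m * (exp (2 * pi * (real m * y)) - 1)))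
              + (\<Sum>m=1..M. 1 / real m) / 2
              - 1 / (2 * pi * y) * (\<Sum>m=1..M. 1 / (real m)\<^sup>2)
              - 1 / pi * (\<Sum>m=1..M. \<Sum>k=1..M. y / ((real m * y)\<^sup>2 + (real k)\<^sup>2)))
         \<longlonglongrightarrow> arctan_int y / pi"
proof -
  define r where "r = (\<lambda>M c. \<Sum>k. c / (c\<^sup>2 + (real (Suc (k + M)))\<^sup>2))"
  have summand: "1 / (real m * (exp (2 * pi * (real m * y)) - 1)) + 1 / real m / 2
      - 1 / (2 * pi * y) * (1 / (real m)\<^sup>2)
      - 1 / pi * (\<Sum>k=1..M. y / ((real m * y)\<^sup>2 + (real k)\<^sup>2)) = r M (real m * y) / real m / pi"
    if m: "m \<ge> 1" for m M
  proof -
    define c where "c = real m * y"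
    have c: "c > 0" using m y by (simp add: c_def)
    define t where "t = (\<lambda>k. c / (c\<^sup>2 + (real (Suc k))\<^sup>2))"
    have t: "t sums (pi * (1 / (exp (2 * pi * c) - 1) + 1 / 2) - 1 / (2 * c))"
      unfolding t_def by (rule coth_partial_fractions[OF c])
    have "suminf t = r M c + (\<Sum>k<M. t k)"
      using suminf_split_initial_segment[OF sums_summable[OF t], of M] by (simp add: r_def t_def)
    also have "(\<Sum>k<M. t k) = real m * (\<Sum>k=1..M. y / (c\<^sup>2 + (real k)\<^sup>2))"
      unfolding t_def sum_distrib_left
      by (intro sum.reindex_bij_witness[of _ "\<lambda>k. k - 1" Suc]) (auto simp: c_def)
    finally have "pi * (1 / (exp (2 * pi * c) - 1) + 1 / 2) - 1 / (2 * c) =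
        r M c + real m * (\<Sum>k=1..M. y / (c\<^sup>2 + (real k)\<^sup>2))"
      using sums_unique[OF t] by simp
    hence "r M c = pi * (1 / (exp (2 * pi * c) - 1) + 1 / 2) - 1 / (2 * c) -
        real m * (\<Sum>k=1..M. y / (c\<^sup>2 + (real k)\<^sup>2))"
      by simp
    moreover have "exp (2 * pi * c) - 1 \<noteq> 0"
      using c by simp
    ultimately show ?thesis
      unfolding c_def[symmetric] using m y c
      by (simp add: diff_divide_distrib add_divide_distrib) (simp add: c_def field_simps power2_eq_square)
  qed
  \<comment> \<open>Each of the \<open>M\<close> tails is within \<open>y / M\<^sup>2\<close> of its arctangent.\<close>
  have close: "norm ((\<Sum>m=1..M. r M (real m * y) / real m) - (\<Sum>m=1..M. arctan (real m * y / real M) / real m)) \<le> y / M"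
    if M: "M > 0" for M
  proof -
    have b: "r M (real m * y) / real m \<le> arctan (real m * y / real M) / real m \<and>
        arctan (real m * y / real M) / real m \<le> r M (real m * y) / real m + y / (real M)\<^sup>2" if "m \<ge> 1" for m
    proof -
      have c: "real m * y > 0" using that y by simp
      have "arctan (real m * y / real M) / real m \<le> (r M (real m * y) + real m * y / (real M)\<^sup>2) / m"
        using arctan_tail_bounds(2)[OF c M] that
        by (intro divide_right_mono) (auto simp: r_def)
      also have "\<dots> = r M (real m * y) / real m + y / (real M)\<^sup>2"
        using that by (simp add: add_divide_distrib)
      finally show ?thesis
        using arctan_tail_bounds(1)[OF c M] that by (auto simp: r_def intro!: divide_right_mono)
    qed
    have "(\<Sum>m=1..M. r M (real m * y) / real m) \<le> (\<Sum>m=1..M. arctan (real m * y / real M) / real m)"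
      using b by (intro sum_mono) auto
    moreover have "(\<Sum>m=1..M. arctan (real m * y / real M) / real m) \<le>
        (\<Sum>m=1..M. r M (real m * y) / real m + y / (real M)\<^sup>2)"
      using b by (intro sum_mono) auto
    moreover have "(\<Sum>m=1..M. r M (real m * y) / real m + y / (real M)\<^sup>2) =
        (\<Sum>m=1..M. r M (real m * y) / real m) + y / M"
      using M by (simp add: sum.distrib power2_eq_square)
    ultimately show ?thesis unfolding real_norm_def by linarith
  qed
  have "(\<lambda>M. y / real M) \<longlonglongrightarrow> 0"
    by (rule lim_const_over_n)
  hence "(\<lambda>M. (\<Sum>m=1..M. r M (real m * y) / real m) - (\<Sum>m=1..M. arctan (real m * y / real M) / real m)) \<longlonglongrightarrow> 0"
    by (rule Lim_null_comparison[rotated])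
       (use close in \<open>auto intro!: eventually_mono[OF eventually_gt_at_top[of 0]]\<close>)
  from tendsto_add[OF this arctan_sum_limit[OF y]]
  have "(\<lambda>M. (\<Sum>m=1..M. r M (real m * y) / real m) / pi) \<longlonglongrightarrow> arctan_int y / pi"
    by (intro tendsto_divide) auto
  moreover have "(\<Sum>m=1..M. r M (real m * y) / real m) / pi =
      (\<Sum>m=1..M. 1 / (real m * (exp (2 * pi * (real m * y)) - 1)))
              + (\<Sum>m=1..M. 1 / real m) / 2
              - 1 / (2 * pi * y) * (\<Sum>m=1..M. 1 / (real m)\<^sup>2)
              - 1 / pi * (\<Sum>m=1..M. \<Sum>k=1..M. y / ((real m * y)\<^sup>2 + (real k)\<^sup>2))" for M
    unfolding sum_divide_distrib sum_distrib_left[of "1 / (2 * pi * y)"]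
      sum_distrib_left[of "1 / pi" "\<lambda>m. \<Sum>k=1..M. y / ((real m * y)\<^sup>2 + (real k)\<^sup>2)"]
      sum.distrib[symmetric] sum_subtractf[symmetric]
    by (intro sum.cong refl, subst summand) auto
  ultimately show ?thesis by simp
qed

text \<open>
  Expand \<open>- ln (1 - q ^ n)\<close> into powers of \<open>q\<close> and interchange the two sums of nonnegative terms.
\<close>

lemma prodinf_eq_exp_Lambert:
  assumes q: "0 < q" "q < (1::real)"
  shows "(\<lambda>m. q ^ Suc m / (real (Suc m) * (1 - q ^ Suc m))) sums - ln (\<Prod>n. 1 - q ^ Suc n)"
    and "(\<Prod>n. 1 - q ^ Suc n) > 0"
proof -
  define f where "f = (\<lambda>(n, m). (q ^ Suc n) ^ Suc m / real (Suc m))"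
  have qn: "0 < q ^ Suc n" "q ^ Suc n < 1" for n
    using q by (simp, subst power_less_one_iff) auto
  have row: "(\<lambda>m. f (n, m)) sums (- ln (1 - q ^ Suc n))" for n
  proof -
    have "(\<lambda>m. - ((q ^ Suc n) ^ m) / of_nat m) sums ln (1 - q ^ Suc n)"
      using ln_series'[of "- (q ^ Suc n)"] qn[of n] by simp
    hence "(\<lambda>m. - (- ((q ^ Suc n) ^ m) / of_nat m)) sums (- ln (1 - q ^ Suc n))"
      by (rule sums_minus)
    hence "(\<lambda>m. (q ^ Suc n) ^ m / real m) sums (- ln (1 - q ^ Suc n))"
      by simp
    thus ?thesis
      using sums_Suc_iff[of "\<lambda>m. (q ^ Suc n) ^ m / real m" "- ln (1 - q ^ Suc n)"]
      by (simp add: f_def)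
  qed
  have conv: "convergent_prod (\<lambda>n. 1 - q ^ Suc n)"
    using q by (intro convergent_prod_one_minus_powers) auto
  have pos: "1 - q ^ Suc n > 0" for n
    using qn[of n] by simp
  show "(\<Prod>n. 1 - q ^ Suc n) > 0"
    by (rule less_0_prodinf[OF conv pos])
  have f_nonneg: "f (n, m) \<ge> 0" for n m
    using q by (simp add: f_def)
  have "(\<lambda>n. ln (1 - q ^ Suc n)) sums ln (\<Prod>n. 1 - q ^ Suc n)"
    using summable_sums[OF summable_ln_real[OF conv pos]] suminf_ln_real[OF conv pos] by simp
  hence "(\<lambda>n. - ln (1 - q ^ Suc n)) sums - ln (\<Prod>n. 1 - q ^ Suc n)"
    by (rule sums_minus)
  moreover have "- ln (1 - q ^ Suc n) \<ge> 0" for n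
    using qn[of n] by simp
  ultimately have outer: "((\<lambda>n. - ln (1 - q ^ Suc n)) has_sum - ln (\<Prod>n. 1 - q ^ Suc n)) UNIV"
    by (rule sums_nonneg_imp_has_sum)
  have inner: "((\<lambda>m. f (n, m)) has_sum - ln (1 - q ^ Suc n)) UNIV" for n
    by (rule sums_nonneg_imp_has_sum[OF row f_nonneg])
  have "f summable_on UNIV \<times> UNIV"
    by (rule summable_on_SigmaI[where g = "\<lambda>n. - ln (1 - q ^ Suc n)"])
       (use inner outer f_nonneg has_sum_imp_summable in auto)
  hence "(f has_sum - ln (\<Prod>n. 1 - q ^ Suc n)) (UNIV \<times> UNIV)"
    by (intro has_sum_SigmaI[OF inner outer])
  hence swapped: "((\<lambda>(m, n). f (n, m)) has_sum - ln (\<Prod>n. 1 - q ^ Suc n)) (UNIV \<times> UNIV)"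
    by (subst (asm) has_sum_swap)
  have column: "((\<lambda>n. f (n, m)) has_sum q ^ Suc m / (real (Suc m) * (1 - q ^ Suc m))) UNIV" for m
  proof (rule sums_nonneg_imp_has_sum[OF _ f_nonneg])
    have "(\<lambda>n. q ^ Suc m / real (Suc m) * (q ^ Suc m) ^ n) sums
        (q ^ Suc m / real (Suc m) * (1 / (1 - q ^ Suc m)))"
      using qn[of m] by (intro sums_mult geometric_sums) auto
    moreover have "q ^ Suc m / real (Suc m) * (q ^ Suc m) ^ n = f (n, m)" for n
    proof -
      have "q ^ Suc m * (q ^ Suc m) ^ n = (q ^ Suc n) ^ Suc m"
        by (metis power_Suc power_mult mult.commute)
      thus ?thesis by (simp only: f_def prod.case times_divide_eq_left)
    qed
    ultimately show "(\<lambda>n. f (n, m)) sums (q ^ Suc m / (real (Suc m) * (1 - q ^ Suc m)))"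
      by simp
  qed
  have "((\<lambda>m. q ^ Suc m / (real (Suc m) * (1 - q ^ Suc m))) has_sum - ln (\<Prod>n. 1 - q ^ Suc n)) UNIV"
    by (rule has_sum_SigmaD[OF swapped]) (use column in simp)
  thus "(\<lambda>m. q ^ Suc m / (real (Suc m) * (1 - q ^ Suc m))) sums - ln (\<Prod>n. 1 - q ^ Suc n)"
    by (rule has_sum_imp_sums)
qed

text \<open>
  The transformation law of \<open>\<eta> ^ 24\<close> on the imaginary axis. Subtracting the asymptotics
  for \<open>y\<close> and \<open>1 / y\<close>, the harmonic sums and the square double sums cancel. What is left is a
  multiple of \<open>\<Sum> 1 / m\<^sup>2 = pi\<^sup>2 / 6\<close>, which matches the factor \<open>q ^ (1 / 24)\<close> of the eta
  function, and \<open>ln y / 2\<close>, which is the weight.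
\<close>

lemma euler_prod_inversion_real:
  assumes y: "y > (0::real)"
  defines "P \<equiv> (\<lambda>y. \<Prod>n. 1 - exp (- 2 * pi * y) ^ Suc n)"
  shows "exp (- 2 * pi / y) * P (1 / y) ^ 24 = y ^ 12 * (exp (- 2 * pi * y) * P y ^ 24)"
proof -
  define L where "L = (\<lambda>y M. \<Sum>m=1..M. 1 / (real m * (exp (2 * pi * (real m * y)) - 1)))"
  define Q where "Q = (\<lambda>M. \<Sum>m=1..M. 1 / (real m)\<^sup>2)"
  have Lambert: "L y \<longlonglongrightarrow> - ln (P y)" and P_pos: "P y > 0" if y: "y > 0" for y
  proof -
    define q where "q = exp (- 2 * pi * y)"
    have q: "0 < q" "q < 1" using y by (auto simp: q_def)
    show "P y > 0"
      unfolding P_def using prodinf_eq_exp_Lambert(2)[OF q] by (simp add: q_def)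
    have qm: "q ^ m / (real m * (1 - q ^ m)) = 1 / (real m * (exp (2 * pi * (real m * y)) - 1))" for m
    proof -
      have "exp (2 * pi * (real m * y)) = inverse (q ^ m)"
      proof -
        have "exp (2 * pi * (real m * y)) = exp (2 * pi * y) ^ m"
          using exp_of_nat_mult[of m "2 * pi * y"] by (simp add: mult_ac)
        thus ?thesis by (simp add: q_def exp_minus power_inverse)
      qed
      moreover have "inverse t - 1 = (1 - t) / t" if "t \<noteq> 0" for t :: real
        using that by (simp add: field_simps)
      ultimately show ?thesis
        using q by simp
    qed
    have "(\<lambda>M. \<Sum>m<M. q ^ Suc m / (real (Suc m) * (1 - q ^ Suc m))) \<longlonglongrightarrow> - ln (P y)"
      using prodinf_eq_exp_Lambert(1)[OF q] by (simp add: sums_def P_def q_def)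
    also have "(\<lambda>M. \<Sum>m<M. q ^ Suc m / (real (Suc m) * (1 - q ^ Suc m))) = L y"
      unfolding L_def qm
      by (intro ext sum.reindex_bij_witness[of _ "\<lambda>m. m - 1" Suc]) auto
    finally show "L y \<longlonglongrightarrow> - ln (P y)" .
  qed
  have Q: "Q \<longlonglongrightarrow> pi\<^sup>2 / 6"
  proof -
    have "(\<lambda>M. \<Sum>m<M. 1 / (real m + 1)\<^sup>2) \<longlonglongrightarrow> pi\<^sup>2 / 6"
      using inverse_squares_sums by (simp add: sums_def add_ac)
    also have "(\<lambda>M. \<Sum>m<M. 1 / (real m + 1)\<^sup>2) = Q"
      unfolding Q_def
      by (intro ext sum.reindex_bij_witness[of _ "\<lambda>m. m - 1" Suc]) auto
    finally show ?thesis .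
  qed
  have y': "1 / y > 0" using y by simp
  have "(\<lambda>M. L y M - L (1 / y) M - (1 / (2 * pi * y) - 1 / (2 * pi * (1 / y))) * Q M)
      \<longlonglongrightarrow> arctan_int y / pi - arctan_int (1 / y) / pi"
    by (rule Lim_transform_eventually[OF tendsto_diff
          [OF Lambert_partial_sum_asymptotics[OF y] Lambert_partial_sum_asymptotics[OF y']]])
       (simp only: box_sum_symmetric[OF y], simp add: L_def Q_def algebra_simps)
  moreover have "(\<lambda>M. L y M - L (1 / y) M - (1 / (2 * pi * y) - 1 / (2 * pi * (1 / y))) * Q M)
      \<longlonglongrightarrow> - ln (P y) - (- ln (P (1 / y))) - (1 / (2 * pi * y) - 1 / (2 * pi * (1 / y))) * (pi\<^sup>2 / 6)"
    by (intro tendsto_diff tendsto_mult tendsto_const Lambert Q y y')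
  ultimately have "- ln (P y) - (- ln (P (1 / y))) - (1 / (2 * pi * y) - 1 / (2 * pi * (1 / y))) * (pi\<^sup>2 / 6)
      = arctan_int y / pi - arctan_int (1 / y) / pi"
    using LIMSEQ_unique by blast
  also have "\<dots> = ln y / 2"
    using arctan_int_inversion[OF y] by (simp add: field_simps)
  finally have eq: "- ln (P y) + ln (P (1 / y)) -
      (1 / (2 * pi * y) - 1 / (2 * pi * (1 / y))) * (pi\<^sup>2 / 6) = ln y / 2"
    by simp
  have c: "(1 / (2 * pi * y) - 1 / (2 * pi * (1 / y))) * (pi\<^sup>2 / 6) = (2 * pi / y - 2 * pi * y) / 24"
    using y by (simp add: field_simps power2_eq_square)
  have "24 * ln (P (1 / y)) = 24 * ln (P y) + 12 * ln y + 2 * pi / y - 2 * pi * y"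
  proof -
    have "24 * l' = 24 * l + 12 * m + a - b" if "- l + l' - (a - b) / 24 = m / 2" for l l' m a b :: real
      using that by (simp add: field_simps)
    from this[OF eq[unfolded c]] show ?thesis .
  qed
  hence "exp (24 * ln (P (1 / y)) - 2 * pi / y) = exp (12 * ln y + (24 * ln (P y) - 2 * pi * y))"
    by simp
  moreover have pw: "exp (24 * ln (P t)) = P t ^ 24" if "t > 0" for t
    using P_pos[OF that] exp_of_nat_mult[of 24 "ln (P t)"] by simp
  moreover have "exp (12 * ln y) = y ^ 12"
    using y exp_of_nat_mult[of 12 "ln y"] by simp
  ultimately have "P (1 / y) ^ 24 * exp (- (2 * pi / y)) = y ^ 12 * (P y ^ 24 * exp (- (2 * pi * y)))"
    unfolding diff_conv_add_uminus exp_add pw[OF y] pw[OF y'] by simp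
  thus ?thesis
    by (simp add: mult_ac)
qed


section \<open>The 24th power of the eta function\<close>

definition unit_exp :: "complex \<Rightarrow> complex" where
  "unit_exp z = exp (2 * of_real pi * \<i> * z)"

text \<open>
  The 24th power of the Dedekind eta function, that is, the modular discriminant \<open>\<Delta>\<close>. Its
  transformation laws involve no roots of unity, which is why everything below is phrased with it.
\<close>

definition eta24 :: "complex \<Rightarrow> complex" where
  "eta24 \<tau> = unit_exp \<tau> * (\<Prod>n. 1 - unit_exp \<tau> ^ Suc n) ^ 24"

lemma unit_exp_add: "unit_exp (a + b) = unit_exp a * unit_exp b"
  by (simp add: unit_exp_def ring_distribs exp_add)

lemma unit_exp_of_nat_mult: "unit_exp (of_nat n * z) = unit_exp z ^ n"
  by (simp add: unit_exp_def mult_ac flip: exp_of_nat_mult)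

lemma unit_exp_0 [simp]: "unit_exp 0 = 1"
  by (simp add: unit_exp_def)

lemma unit_exp_minus: "unit_exp (- z) = inverse (unit_exp z)"
  by (simp add: unit_exp_def exp_minus)

lemma unit_exp_nonzero [simp]: "unit_exp z \<noteq> 0"
  by (simp add: unit_exp_def)

lemma unit_exp_of_int [simp]: "unit_exp (of_int n) = 1"
  using exp_integer_2pi[of "of_int n"] by (simp add: unit_exp_def mult_ac)

lemma norm_unit_exp: "norm (unit_exp z) = exp (- 2 * pi * Im z)"
  by (simp add: unit_exp_def norm_exp_eq_Re)

lemma norm_unit_exp_less_1: "Im z > 0 \<Longrightarrow> norm (unit_exp z) < 1"
  by (simp add: norm_unit_exp)

lemma unit_exp_holomorphic [holomorphic_intros]:
  "f holomorphic_on A \<Longrightarrow> (\<lambda>z. unit_exp (f z)) holomorphic_on A"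
  unfolding unit_exp_def by (intro holomorphic_intros)

lemma dedekind_eta_power_24: "dedekind_eta \<tau> ^ 24 = eta24 \<tau>"
proof -
  have "q_pow (1 / 24) \<tau> ^ 24 = unit_exp \<tau>"
    unfolding q_pow_def unit_exp_def by (simp add: of_rat_divide mult_ac flip: exp_of_nat_mult)
  moreover have "q_pow 1 \<tau> = unit_exp \<tau>"
    by (simp add: q_pow_def unit_exp_def)
  ultimately show ?thesis
    by (simp add: dedekind_eta_def eta24_def power_mult_distrib)
qed

lemma eta24_holomorphic: "eta24 holomorphic_on {\<tau>. Im \<tau> > 0}"
proof -
  have "((\<lambda>u. \<Prod>n. 1 - u ^ Suc n) \<circ> unit_exp) holomorphic_on {\<tau>. Im \<tau> > 0}"
    by (rule holomorphic_on_compose_gen[OF _ intdisc_holomorphic[OF intdisc_euler_product]])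
       (auto intro!: holomorphic_intros norm_unit_exp_less_1)
  thus ?thesis
    unfolding eta24_def by (auto simp: o_def intro!: holomorphic_intros)
qed

lemma eta24_nonzero: "Im \<tau> > 0 \<Longrightarrow> eta24 \<tau> \<noteq> 0"
  using prodinf_one_minus_powers_nonzero[OF norm_unit_exp_less_1[of \<tau>]] by (simp add: eta24_def)

lemma eta24_imaginary_axis:
  assumes "y > 0"
  shows "eta24 (\<i> * of_real y) =
           of_real (exp (- 2 * pi * y) * (\<Prod>n. 1 - exp (- 2 * pi * y) ^ Suc n) ^ 24)"
proof -
  define q where "q = exp (- 2 * pi * y)"
  have q: "norm q < 1" using assms by (simp add: q_def)
  have u: "unit_exp (\<i> * of_real y) = of_real q"
    by (simp add: unit_exp_def q_def mult_ac flip: exp_of_real)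
  have "(\<lambda>N. \<Prod>n\<le>N. 1 - of_real q ^ Suc n :: complex) \<longlonglongrightarrow> (\<Prod>n. 1 - of_real q ^ Suc n)"
    using q by (intro convergent_prod_LIMSEQ convergent_prod_one_minus_powers) simp
  moreover have "(\<lambda>N. of_real (\<Prod>n\<le>N. 1 - q ^ Suc n) :: complex) \<longlonglongrightarrow> of_real (\<Prod>n. 1 - q ^ Suc n)"
    using q by (intro tendsto_of_real convergent_prod_LIMSEQ convergent_prod_one_minus_powers)
  ultimately have "(\<Prod>n. 1 - of_real q ^ Suc n :: complex) = of_real (\<Prod>n. 1 - q ^ Suc n)"
    by (intro LIMSEQ_unique[of "\<lambda>N. \<Prod>n\<le>N. 1 - of_real q ^ Suc n"]) simp_all
  thus ?thesis
    unfolding eta24_def u q_def[symmetric] by simp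
qed

lemma Im_minus_inverse: "\<tau> \<noteq> 0 \<Longrightarrow> Im (- 1 / \<tau>) = Im \<tau> / (norm \<tau>)\<^sup>2"
  by (simp add: Im_divide cmod_power2)

text \<open>
  Both sides are holomorphic on the upper half-plane and agree on the imaginary axis.
\<close>

theorem eta24_inversion:
  assumes "Im \<tau> > 0"
  shows "eta24 (- 1 / \<tau>) = \<tau> ^ 12 * eta24 \<tau>"
proof -
  define H where "H = {\<tau>. Im \<tau> > 0}"
  define U where "U = {\<i> * of_real y | y. y > (0::real)}"
  define D where "D = (\<lambda>\<tau>. eta24 (- 1 / \<tau>) - \<tau> ^ 12 * eta24 \<tau>)"
  have inv: "- 1 / z \<in> H" if "z \<in> H" for z
    using that Im_minus_inverse[of z] by (cases "z = 0") (auto simp: H_def)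
  have "(eta24 \<circ> (\<lambda>z. - 1 / z)) holomorphic_on H"
    by (rule holomorphic_on_compose_gen[OF _ eta24_holomorphic])
       (use inv in \<open>auto intro!: holomorphic_intros simp: H_def\<close>)
  hence hol: "D holomorphic_on H"
    unfolding D_def using eta24_holomorphic by (auto intro!: holomorphic_intros simp: o_def H_def)
  have "D \<tau> = 0"
  proof (rule analytic_continuation[OF hol])
    show "open H" "connected H"
      unfolding H_def by (auto simp: open_halfspace_Im_gt intro: convex_connected convex_halfspace_Im_gt)
    show "U \<subseteq> H" "\<i> \<in> H" "\<tau> \<in> H"
      using assms by (auto simp: U_def H_def)
    show "\<i> islimpt U"
      unfolding islimpt_approachable
    proof (intro allI impI)
      fix e :: real assume e: "e > 0"
      define x where "x = \<i> * of_real (1 + e / 2)"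
      have "x - \<i> = \<i> * of_real (e / 2)" by (simp add: x_def algebra_simps)
      hence "dist x \<i> = norm (\<i> * of_real (e / 2))" by (simp only: dist_norm)
      also have "\<dots> = e / 2" using e by (simp add: norm_mult)
      finally have "dist x \<i> = e / 2" .
      thus "\<exists>x'\<in>U. x' \<noteq> \<i> \<and> dist x' \<i> < e"
        using e by (intro bexI[of _ x]) (auto simp: U_def x_def intro!: exI[of _ "1 + e / 2"])
    qed
    show "D z = 0" if "z \<in> U" for z
    proof -
      obtain y where y: "z = \<i> * of_real y" "y > 0" using \<open>z \<in> U\<close> by (auto simp: U_def)
      have "- 1 / z = \<i> * of_real (1 / y)" using y by (simp add: field_simps)
      moreover define E where "E = exp (- 2 * pi * y) * (\<Prod>n. 1 - exp (- 2 * pi * y) ^ Suc n) ^ 24"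
      have "eta24 (\<i> * of_real (1 / y)) = of_real (y ^ 12 * E)"
        using euler_prod_inversion_real[OF y(2)] eta24_imaginary_axis[of "1 / y"] y(2)
        by (simp add: E_def)
      moreover have "z ^ 12 = of_real (y ^ 12)"
      proof -
        have "\<i> ^ 12 = (\<i> ^ 2) ^ 6" by (simp only: flip: power_mult) simp
        thus ?thesis by (simp add: y power_mult_distrib)
      qed
      moreover have "eta24 z = of_real E"
        using eta24_imaginary_axis[OF y(2)] by (simp add: E_def y(1))
      ultimately show ?thesis
        by (simp add: D_def)
    qed
  qed
  thus ?thesis by (simp add: D_def)
qed

lemma eta24_translation: "eta24 (\<tau> + 1) = eta24 \<tau>"
  using unit_exp_of_int[of 1] by (simp add: eta24_def unit_exp_add)



section \<open>Integral expansions at the cusp\<close>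

text \<open>
  \<open>qser k N h f\<close> says that \<open>f \<tau> = q ^ (N / k) * h (q ^ (1 / k))\<close> on the upper half-plane. The pair
  \<open>(N, h 0)\<close> is the order and the leading coefficient of \<open>f\<close> at infinity, provided that \<open>h 0 \<noteq> 0\<close>.
  Admitting \<open>h 0 = 0\<close> makes functions of different order summable over a common \<open>N\<close>.
\<close>

definition qser :: "nat \<Rightarrow> int \<Rightarrow> (complex \<Rightarrow> complex) \<Rightarrow> (complex \<Rightarrow> complex) \<Rightarrow> bool" where
  "qser k N h f \<longleftrightarrow> k > 0 \<and> intdisc h \<and>
     (\<forall>\<tau>. Im \<tau> > 0 \<longrightarrow> f \<tau> = unit_exp (of_int N * \<tau> / of_nat k) * h (unit_exp (\<tau> / of_nat k)))"

lemma qser_refine: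
  assumes "qser k N h f" "m > 0"
  shows "qser (k * m) (N * int m) (\<lambda>u. h (u ^ m)) f"
proof -
  have "unit_exp (\<tau> / of_nat k) = unit_exp (\<tau> / of_nat (k * m)) ^ m" for \<tau>
    using assms by (simp flip: unit_exp_of_nat_mult)
  moreover have "of_int (N * int m) * \<tau> / of_nat (k * m) = of_int N * \<tau> / of_nat k" for \<tau> :: complex
    using assms by (simp add: field_simps)
  moreover have "intdisc (\<lambda>u. h (1 * u ^ m))"
    using assms by (intro intdisc_compose) (auto simp: qser_def)
  ultimately show ?thesis
    using assms by (simp add: qser_def)
qed

lemma qser_lower:
  assumes "qser k N h f" "M \<le> N"
  shows "qser k M (\<lambda>u. u ^ nat (N - M) * h u) f"
proof -
  have "unit_exp (of_int N * \<tau> / of_nat k) =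
      unit_exp (of_int M * \<tau> / of_nat k) * unit_exp (\<tau> / of_nat k) ^ nat (N - M)" for \<tau>
    using assms by (simp add: algebra_simps diff_divide_distrib flip: unit_exp_of_nat_mult unit_exp_add)
  thus ?thesis
    using assms by (auto simp: qser_def intro!: intdisc_mult intdisc_power_id)
qed

lemma qser_mult:
  assumes "qser k N h f" "qser k M g e"
  shows "qser k (N + M) (\<lambda>u. h u * g u) (\<lambda>\<tau>. f \<tau> * e \<tau>)"
  using assms by (auto simp: qser_def algebra_simps add_divide_distrib unit_exp_add intro!: intdisc_mult)

lemma qser_add:
  assumes "qser k N h f" "qser k N g e"
  shows "qser k N (\<lambda>u. h u + g u) (\<lambda>\<tau>. f \<tau> + e \<tau>)"
  using assms by (auto simp: qser_def algebra_simps intro!: intdisc_add)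

lemma qser_const:
  assumes "algebraic_int c" "k > 0"
  shows "qser k 0 (\<lambda>_. c) (\<lambda>_. c)"
  using assms by (auto simp: qser_def intro!: intdisc_const)

lemma qser_cmult:
  assumes "algebraic_int c" "qser k N h f"
  shows "qser k N (\<lambda>u. c * h u) (\<lambda>\<tau>. c * f \<tau>)"
  using qser_mult[OF qser_const[OF assms(1), of k] assms(2)] assms(2) by (simp add: qser_def)

lemma qser_minus:
  assumes "qser k N h f"
  shows "qser k N (\<lambda>u. - h u) (\<lambda>\<tau>. - f \<tau>)"
  using assms by (auto simp: qser_def intro!: intdisc_minus)

lemma qser_power:
  assumes "qser k N h f"
  shows "qser k (N * int m) (\<lambda>u. h u ^ m) (\<lambda>\<tau>. f \<tau> ^ m)"
proof (induction m)
  case 0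
  show ?case using qser_const[of 1 k] assms by (simp add: qser_def)
next
  case (Suc m)
  show ?case using qser_mult[OF assms Suc] by (simp add: algebra_simps)
qed

lemma qser_inverse:
  assumes "qser k N h f" "\<And>u. norm u < 1 \<Longrightarrow> h u \<noteq> 0" "algebraic_int (inverse (h 0))"
  shows "qser k (- N) (\<lambda>u. inverse (h u)) (\<lambda>\<tau>. inverse (f \<tau>))"
proof -
  have "unit_exp (of_int (- N) * \<tau> / of_nat k) = inverse (unit_exp (of_int N * \<tau> / of_nat k))" for \<tau>
    by (simp add: unit_exp_minus)
  thus ?thesis
    using assms by (auto simp: qser_def intro!: intdisc_inverse)
qed

lemma unit_exp_rational_algebraic_int:
  assumes "k > 0"
  shows "algebraic_int (unit_exp (of_int b / of_nat k))"
proof (rule algebraic_int_of_power)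
  have "unit_exp (of_int b / of_nat k) ^ k = 1"
    using assms by (simp flip: unit_exp_of_nat_mult)
  thus "algebraic_int (unit_exp (of_int b / of_nat k) ^ k)" by simp
qed fact

text \<open>
  Substituting \<open>(a * \<tau> + b) / d\<close> replaces \<open>q ^ (1 / k)\<close> by a root of unity times a power of
  \<open>q ^ (1 / (k * d))\<close>.
\<close>

lemma qser_affine:
  assumes f: "qser k N h f" and a: "a > 0" and d: "d > 0"
  shows "qser (k * d) (N * int a)
    (\<lambda>u. unit_exp (of_int (N * b) / of_nat (k * d)) * h (unit_exp (of_int b / of_nat (k * d)) * u ^ a))
    (\<lambda>\<tau>. f ((of_nat a * \<tau> + of_int b) / of_nat d))"
proof -
  have k: "k * d > 0" using f d by (simp add: qser_def)
  have "norm (unit_exp (of_int b / of_nat (k * d))) \<le> 1"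
    by (simp add: norm_unit_exp)
  hence "intdisc (\<lambda>u. unit_exp (of_int (N * b) / of_nat (k * d)) *
      h (unit_exp (of_int b / of_nat (k * d)) * u ^ a))"
    using f a k
    by (intro intdisc_mult intdisc_const intdisc_compose unit_exp_rational_algebraic_int)
       (auto simp: qser_def)
  moreover have "f ((of_nat a * \<tau> + of_int b) / of_nat d) =
      unit_exp (of_int (N * int a) * \<tau> / of_nat (k * d)) *
      (unit_exp (of_int (N * b) / of_nat (k * d)) *
       h (unit_exp (of_int b / of_nat (k * d)) * unit_exp (\<tau> / of_nat (k * d)) ^ a))"
    if \<tau>: "Im \<tau> > 0" for \<tau>
  proof -
    have "Im ((of_nat a * \<tau> + of_int b) / of_nat d) > 0"
      using a d \<tau> by simp
    hence "f ((of_nat a * \<tau> + of_int b) / of_nat d) =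
        unit_exp (of_int N * ((of_nat a * \<tau> + of_int b) / of_nat d) / of_nat k) *
        h (unit_exp ((of_nat a * \<tau> + of_int b) / of_nat d / of_nat k))"
      using f by (simp add: qser_def)
    also have "of_int N * ((of_nat a * \<tau> + of_int b) / of_nat d) / of_nat k =
        of_int (N * int a) * \<tau> / of_nat (k * d) + of_int (N * b) / of_nat (k * d)"
      by (simp add: algebra_simps add_divide_distrib)
    also have "(of_nat a * \<tau> + of_int b) / of_nat d / of_nat k =
        of_int b / of_nat (k * d) + of_nat a * (\<tau> / of_nat (k * d))"
      by (simp add: algebra_simps add_divide_distrib)
    finally show ?thesis
      unfolding unit_exp_add unit_exp_of_nat_mult by (simp only: mult_ac)
  qed
  ultimately show ?thesis
    using k by (simp add: qser_def)
qed

lemma qser_divide: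
  assumes f: "qser k N h f" and h: "h 0 = 0"
  obtains g where "qser k (N + 1) g f"
proof -
  obtain g where g: "intdisc g" "\<And>u. norm u < 1 \<Longrightarrow> h u = u * g u"
    using intdisc_divide_id[of h] f h by (auto simp: qser_def)
  have "f \<tau> = unit_exp (of_int (N + 1) * \<tau> / of_nat k) * g (unit_exp (\<tau> / of_nat k))"
    if "Im \<tau> > 0" for \<tau>
  proof -
    have "norm (unit_exp (\<tau> / of_nat k)) < 1"
      using that f by (intro norm_unit_exp_less_1) (auto simp: qser_def)
    thus ?thesis
      using f that g(2) by (simp add: qser_def algebra_simps add_divide_distrib unit_exp_add)
  qed
  thus ?thesis
    using f g(1) by (intro that[of g]) (auto simp: qser_def)
qed

lemma qser_holomorphic:
  assumes "qser k N h f"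
  shows "f holomorphic_on {\<tau>. Im \<tau> > 0}"
proof -
  have "(h \<circ> (\<lambda>\<tau>. unit_exp (\<tau> / of_nat k))) holomorphic_on {\<tau>. Im \<tau> > 0}"
    by (rule holomorphic_on_compose_gen[OF _ intdisc_holomorphic])
       (use assms in \<open>auto simp: qser_def intro!: holomorphic_intros norm_unit_exp_less_1\<close>)
  hence "(\<lambda>\<tau>. unit_exp (of_int N * \<tau> / of_nat k) * h (unit_exp (\<tau> / of_nat k)))
      holomorphic_on {\<tau>. Im \<tau> > 0}"
    using assms by (auto simp: o_def qser_def intro!: holomorphic_intros)
  thus ?thesis
    by (rule holomorphic_transform) (use assms in \<open>auto simp: qser_def\<close>)
qed

lemma qser_tendsto_cusp:
  assumes "k > 0" "intdisc h"
  shows "((\<lambda>\<tau>. h (unit_exp (\<tau> / of_nat k))) \<longlongrightarrow> h 0) (filtercomap Im at_top)"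
proof -
  have "filterlim (\<lambda>t. exp (- (2 * pi / k) * t)) (nhds 0) at_top"
    using assms by real_asymp
  hence "((\<lambda>\<tau>. exp (- (2 * pi / k) * Im \<tau>)) \<longlongrightarrow> 0) (filtercomap Im at_top)"
    by (rule filterlim_compose) (rule filterlim_filtercomap)
  moreover have "norm (unit_exp (\<tau> / of_nat k)) = exp (- (2 * pi / k) * Im \<tau>)" for \<tau>
    by (simp add: norm_unit_exp)
  ultimately have "((\<lambda>\<tau>. unit_exp (\<tau> / of_nat k)) \<longlongrightarrow> 0) (filtercomap Im at_top)"
    by (subst tendsto_norm_zero_iff[symmetric]) simp
  moreover have "isCont h 0"
    using assms(2) has_fps_expansion_imp_continuous by (auto simp: intdisc_def)
  ultimately show ?thesis
    by (rule isCont_tendsto_compose[rotated])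
qed

section \<open>Modular invariants and the maximum principle\<close>

text \<open>
  The two maps generate the modular group, so this is invariance under all of it.
\<close>

definition modular_invariant :: "(complex \<Rightarrow> complex) \<Rightarrow> bool" where
  "modular_invariant f \<longleftrightarrow> (\<forall>\<tau>. Im \<tau> > 0 \<longrightarrow> f (\<tau> + 1) = f \<tau> \<and> f (- 1 / \<tau>) = f \<tau>)"

lemma periodic_int_shift:
  assumes "\<And>\<tau>. Im \<tau> > 0 \<Longrightarrow> f (\<tau> + 1) = f \<tau>" "Im \<tau> > 0"
  shows "f (\<tau> + of_int n) = (f \<tau> :: complex)"
proof (induction n rule: int_induct[where k = 0])
  case (step1 i)
  thus ?case using assms(1)[of "\<tau> + of_int i"] assms(2) by (simp add: add_ac)
next
  case (step2 i)
  thus ?case using assms(1)[of "\<tau> + of_int (i - 1)"] assms(2) by (simp add: add_ac)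
qed simp

text \<open>
  A translation brings the real part into \<open>[-1/2, 1/2]\<close>. If then \<open>Im \<tau> < 1 / 2\<close>, one has
  \<open>(norm \<tau>)\<^sup>2 \<le> 1 / 2\<close>, so that \<open>\<tau> \<mapsto> - 1 / \<tau>\<close> at least doubles the imaginary part. Hence finitely
  many steps suffice. The target is larger than the usual fundamental domain, but it is
  compact up to the cusp and that is all that is used of it.
\<close>

lemma fundamental_strip_reduction:
  assumes "Im \<tau> > 0"
  shows "\<exists>\<tau>'. \<bar>Re \<tau>'\<bar> \<le> 1 / 2 \<and> Im \<tau>' \<ge> 1 / 2 \<and> (\<forall>f. modular_invariant f \<longrightarrow> f \<tau>' = f \<tau>)"
proof -
  obtain n where "(1 / 2) / Im \<tau> < 2 ^ n"
    using real_arch_pow[of 2] by auto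
  hence "Im \<tau> * 2 ^ n \<ge> 1 / 2"
    using assms by (simp add: field_simps)
  thus ?thesis
    using assms
  proof (induction n arbitrary: \<tau>)
    case (0 \<tau>)
    define z where "z = \<tau> + of_int (- round (Re \<tau>))"
    have "\<bar>Re z\<bar> \<le> 1 / 2"
      using of_int_round_abs_le[of "Re \<tau>"] by (simp add: z_def abs_minus_commute)
    moreover have "f z = f \<tau>" if "modular_invariant f" for f
      unfolding z_def using that 0 by (intro periodic_int_shift) (auto simp: modular_invariant_def)
    ultimately show ?case
      using 0 by (intro exI[of _ z]) (auto simp: z_def)
  next
    case (Suc n \<tau>)
    show ?case
    proof (cases "Im \<tau> \<ge> 1 / 2")
      case True
      have "Im \<tau> * 1 \<le> Im \<tau> * 2 ^ n"
        using Suc.prems by (intro mult_left_mono) auto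
      hence "1 / 2 \<le> Im \<tau> * 2 ^ n"
        using True by linarith
      thus ?thesis using Suc.prems by (intro Suc.IH) auto
    next
      case False
      define z where "z = \<tau> + of_int (- round (Re \<tau>))"
      have z: "\<bar>Re z\<bar> \<le> 1 / 2" "Im z = Im \<tau>" "z \<noteq> 0"
        using of_int_round_abs_le[of "Re \<tau>"] Suc.prems by (auto simp: z_def abs_minus_commute complex_eq_iff)
      have fz: "f z = f \<tau>" if "modular_invariant f" for f
        unfolding z_def using that Suc.prems by (intro periodic_int_shift) (auto simp: modular_invariant_def)
      have "(Re z)\<^sup>2 \<le> (1 / 2)\<^sup>2" "(Im z)\<^sup>2 \<le> (1 / 2)\<^sup>2"
        using z False Suc.prems by (auto simp: abs_le_square_iff[symmetric])
      hence "(norm z)\<^sup>2 \<le> 1 / 2"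
        unfolding cmod_power2 by (simp add: power_divide)
      hence "Im (- 1 / z) \<ge> 2 * Im \<tau>"
        using z Suc.prems by (subst Im_minus_inverse) (auto simp: field_simps)
      hence "Im (- 1 / z) * 2 ^ n \<ge> 2 * Im \<tau> * 2 ^ n"
        by (intro mult_right_mono) auto
      hence "\<exists>\<tau>'. \<bar>Re \<tau>'\<bar> \<le> 1 / 2 \<and> Im \<tau>' \<ge> 1 / 2 \<and>
          (\<forall>f. modular_invariant f \<longrightarrow> f \<tau>' = f (- 1 / z))"
        using Suc.prems \<open>Im (- 1 / z) \<ge> 2 * Im \<tau>\<close> by (intro Suc.IH) auto
      moreover have "f (- 1 / z) = f \<tau>" if "modular_invariant f" for f
        using that fz[OF that] Suc.prems z(2) by (auto simp: modular_invariant_def)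
      ultimately show ?thesis by metis
    qed
  qed
qed

text \<open>
  Suppose \<open>f - h 0\<close> is not zero. It tends to \<open>0\<close> at the cusp, so by the reduction to a
  strip its modulus attains its supremum over the whole half-plane on a compact set. By the maximum
  modulus principle the difference is constant, which contradicts its limit.
\<close>

theorem modular_invariant_bounded_constant:
  assumes inv: "modular_invariant f" and q: "qser k 0 h f" and \<tau>: "Im \<tau> > 0"
  shows "f \<tau> = h 0"
proof (rule ccontr)
  assume neq: "f \<tau> \<noteq> h 0"
  define H where "H = {\<tau>. Im \<tau> > 0}"
  define g where "g = (\<lambda>\<tau>. f \<tau> - h 0)"
  have "((\<lambda>\<tau>. norm (h (unit_exp (\<tau> / of_nat k)) - h 0)) \<longlongrightarrow> 0) (filtercomap Im at_top)"
    using qser_tendsto_cusp[of k h] q by (intro tendsto_norm_zero LIM_zero) (auto simp: qser_def)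
  hence "eventually (\<lambda>z. norm (h (unit_exp (z / of_nat k)) - h 0) < norm (g \<tau>)) (filtercomap Im at_top)"
    by (rule order_tendstoD) (use neq in \<open>simp add: g_def\<close>)
  then obtain Y0 where Y0: "\<And>z. Im z \<ge> Y0 \<Longrightarrow> norm (h (unit_exp (z / of_nat k)) - h 0) < norm (g \<tau>)"
    by (auto simp: eventually_filtercomap_at_top_linorder)
  define Y where "Y = max Y0 1"
  \<comment> \<open>Near the cusp \<open>g\<close> is smaller than at the point \<open>\<tau>\<close>, so it attains its maximum below the height \<open>Y\<close>.\<close>
  have small: "norm (g z) < norm (g \<tau>)" if "Im z \<ge> Y" for z
  proof -
    have "Im z > 0" "Im z \<ge> Y0" using that by (auto simp: Y_def)
    thus ?thesis using Y0[of z] q by (simp add: g_def qser_def)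
  qed
  have g_inv: "modular_invariant g"
    using inv by (auto simp: modular_invariant_def g_def)
  have hol: "g holomorphic_on H"
    unfolding g_def H_def using qser_holomorphic[OF q] by (intro holomorphic_intros)
  define K where "K = cbox (Complex (- (1 / 2)) (1 / 2)) (Complex (1 / 2) Y)"
  have K: "z \<in> K \<longleftrightarrow> \<bar>Re z\<bar> \<le> 1 / 2 \<and> 1 / 2 \<le> Im z \<and> Im z \<le> Y" for z
    by (auto simp: K_def in_cbox_complex_iff)
  have KH: "K \<subseteq> H" by (auto simp: K H_def)
  have "K \<noteq> {}" using K[of "\<i>"] by (auto simp: Y_def)
  moreover have "continuous_on K (\<lambda>z. norm (g z))"
    using hol KH by (intro continuous_intros holomorphic_on_imp_continuous_on[OF holomorphic_on_subset])
  moreover have "compact K" by (simp add: K_def)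
  ultimately obtain \<xi> where \<xi>: "\<xi> \<in> K" "\<And>z. z \<in> K \<Longrightarrow> norm (g z) \<le> norm (g \<xi>)"
    using continuous_attains_sup[of K "\<lambda>z. norm (g z)"] by blast
  have reduced: "norm (g z) < norm (g \<tau>) \<or> norm (g z) \<le> norm (g \<xi>)" if z: "Im z > 0" for z
  proof -
    obtain z' where z': "\<bar>Re z'\<bar> \<le> 1 / 2" "Im z' \<ge> 1 / 2" "g z' = g z"
      using fundamental_strip_reduction[OF z] g_inv by blast
    show ?thesis
      using small[of z'] \<xi>(2)[of z'] z' K[of z'] by (cases "Im z' \<ge> Y") auto
  qed
  have "norm (g \<tau>) \<le> norm (g \<xi>)"
    using reduced[OF \<tau>] by simp
  hence max: "norm (g z) \<le> norm (g \<xi>)" if "z \<in> H" for z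
    using reduced[of z] that by (auto simp: H_def)
  have "g constant_on H"
  proof (rule maximum_modulus_principle[OF hol])
    show "open H" "connected H"
      unfolding H_def by (auto simp: open_halfspace_Im_gt intro: convex_connected convex_halfspace_Im_gt)
    thus "open H" by simp
    show "\<xi> \<in> H" using \<xi>(1) KH by blast
  qed (use max in auto)
  moreover have "\<tau> \<in> H" "\<i> * of_real Y \<in> H"
    using \<tau> by (auto simp: H_def Y_def)
  ultimately have "g \<tau> = g (\<i> * of_real Y)"
    unfolding constant_on_def by metis
  thus False using small[of "\<i> * of_real Y"] by simp
qed


definition eta24_disc :: "complex \<Rightarrow> complex" where
  "eta24_disc u = (\<Prod>n. 1 - u ^ Suc n) ^ 24"

lemma eta24_disc_0: "eta24_disc 0 = 1"
  by (simp add: eta24_disc_def)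

lemma eta24_disc_nonzero: "norm u < 1 \<Longrightarrow> eta24_disc u \<noteq> 0"
  using prodinf_one_minus_powers_nonzero[of u] by (simp add: eta24_disc_def)

lemma qser_eta24: "qser 1 1 eta24_disc eta24"
  unfolding qser_def eta24_disc_def
  by (auto simp: eta24_def simp del: power_Suc intro!: intdisc_power intdisc_euler_product)

section \<open>Modular invariants are polynomials in the j-function\<close>

definition alg_unit :: "complex \<Rightarrow> bool" where
  "alg_unit c \<longleftrightarrow> c \<noteq> 0 \<and> algebraic_int c \<and> algebraic_int (inverse c)"

lemma alg_unit_mult: "alg_unit a \<Longrightarrow> alg_unit b \<Longrightarrow> alg_unit (a * b)"
  by (auto simp: alg_unit_def intro: algebraic_int_mult)

lemma alg_unit_unit_exp: "k > 0 \<Longrightarrow> alg_unit (unit_exp (of_int b / of_nat k))"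
  using unit_exp_rational_algebraic_int[of k b] unit_exp_rational_algebraic_int[of k "- b"]
  by (simp add: alg_unit_def unit_exp_minus)

text \<open>
  The expansions that may be inverted: the leading coefficient is a unit, and \<open>h\<close> has no zeros in
  the disc, so that \<open>1 / h\<close> is holomorphic there too.
\<close>

definition qser_unit :: "nat \<Rightarrow> int \<Rightarrow> (complex \<Rightarrow> complex) \<Rightarrow> (complex \<Rightarrow> complex) \<Rightarrow> bool" where
  "qser_unit k N h f \<longleftrightarrow> qser k N h f \<and> alg_unit (h 0) \<and> (\<forall>u. norm u < 1 \<longrightarrow> h u \<noteq> 0)"

lemma qser_unit_refine:
  assumes "qser_unit k N h f" "m > 0"
  shows "qser_unit (k * m) (N * int m) (\<lambda>u. h (u ^ m)) f"
  using assms qser_refine[of k N h f m]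
  by (auto simp: qser_unit_def norm_power power_less_one_iff zero_power)

lemma qser_unit_mult:
  assumes "qser_unit k N h f" "qser_unit k M g e"
  shows "qser_unit k (N + M) (\<lambda>u. h u * g u) (\<lambda>\<tau>. f \<tau> * e \<tau>)"
  using assms qser_mult[of k N h f M g e] by (auto simp: qser_unit_def intro: alg_unit_mult)

lemma qser_unit_inverse:
  assumes "qser_unit k N h f"
  shows "qser_unit k (- N) (\<lambda>u. inverse (h u)) (\<lambda>\<tau>. inverse (f \<tau>))"
  using assms qser_inverse[of k N h f] by (auto simp: qser_unit_def alg_unit_def)

lemma qser_unit_eta24_affine:
  assumes "a > 0" "d > 0"
  obtains h where "qser_unit d (int a) h (\<lambda>\<tau>. eta24 ((of_nat a * \<tau> + of_int b) / of_nat d))"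
    "h 0 = unit_exp (of_int b / of_nat d)"
proof -
  define h where "h = (\<lambda>u. unit_exp (of_int b / of_nat d) * eta24_disc (unit_exp (of_int b / of_nat d) * u ^ a))"
  have "qser d (int a) h (\<lambda>\<tau>. eta24 ((of_nat a * \<tau> + of_int b) / of_nat d))"
    using qser_affine[OF qser_eta24 assms, of b] by (simp add: h_def)
  moreover have h0: "h 0 = unit_exp (of_int b / of_nat d)"
    using assms by (simp add: h_def eta24_disc_0 zero_power)
  moreover have "norm (unit_exp (of_int b / of_nat d) * u ^ a) < 1" if "norm u < 1" for u
    using that assms by (simp add: norm_mult norm_unit_exp norm_power power_less_one_iff)
  hence "h u \<noteq> 0" if "norm u < 1" for u
    using that eta24_disc_nonzero by (simp add: h_def)
  ultimately show ?thesis
    using that[of h] alg_unit_unit_exp[OF assms(2)] by (simp add: qser_unit_def)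
qed

text \<open>
  This is \<open>j - 768\<close> for the classical modular invariant \<open>j\<close>. The function
  \<open>x = eta24 \<tau> / eta24 (2 * \<tau>)\<close> is invariant under \<open>\<Gamma>\<^sub>0(2)\<close>, a subgroup of index \<open>3\<close>, and the three
  summands are its images under the modular group. Their sum is therefore invariant. The factors
  \<open>2 ^ 12\<close> come from the weight. Only \<open>x\<close> itself has a pole at infinity, and it has order one.
\<close>

definition shifted_j :: "complex \<Rightarrow> complex" where
  "shifted_j \<tau> = eta24 \<tau> / eta24 (2 * \<tau>)
     + 2 ^ 12 * (eta24 \<tau> / eta24 (\<tau> / 2)) + 2 ^ 12 * (eta24 \<tau> / eta24 ((\<tau> + 1) / 2))"

lemma shifted_j_modular_invariant: "modular_invariant shifted_j"
  unfolding modular_invariant_def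
proof (intro allI impI conjI)
  fix \<tau> :: complex assume \<tau>: "Im \<tau> > 0"
  have "eta24 (2 * (\<tau> + 1)) = eta24 (2 * \<tau>)"
    using eta24_translation[of "2 * \<tau>"] eta24_translation[of "2 * \<tau> + 1"] by (simp add: algebra_simps)
  moreover have "eta24 ((\<tau> + 1 + 1) / 2) = eta24 (\<tau> / 2)"
    using eta24_translation[of "\<tau> / 2"] by (simp add: add_divide_distrib add_ac)
  ultimately show "shifted_j (\<tau> + 1) = shifted_j \<tau>"
    by (simp add: shifted_j_def eta24_translation)
next
  fix \<tau> :: complex assume \<tau>: "Im \<tau> > 0"
  have [simp]: "\<tau> \<noteq> 0" "\<tau> - 1 \<noteq> 0" using \<tau> by (auto simp: complex_eq_iff)
  have 0: "eta24 (- 1 / \<tau>) = \<tau> ^ 12 * eta24 \<tau>"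
    using \<tau> by (rule eta24_inversion)
  have 1: "eta24 (2 * (- 1 / \<tau>)) = (\<tau> / 2) ^ 12 * eta24 (\<tau> / 2)"
    using eta24_inversion[of "\<tau> / 2"] \<tau> by simp
  have 2: "eta24 (- 1 / \<tau> / 2) = (2 * \<tau>) ^ 12 * eta24 (2 * \<tau>)"
    using eta24_inversion[of "2 * \<tau>"] \<tau> by (simp add: mult.commute)
  have 3: "eta24 ((- 1 / \<tau> + 1) / 2) = \<tau> ^ 12 * eta24 ((\<tau> + 1) / 2)"
  proof -
    define z where "z = (\<tau> - 1) / 2"
    have z: "Im z > 0" "z \<noteq> 0" using \<tau> by (auto simp: z_def)
    \<comment> \<open>The matrix relating \<open>(- 1 / \<tau> + 1) / 2\<close> to \<open>(\<tau> + 1) / 2\<close> is composed of inversion, shift by \<open>-2\<close>, inversion, shift by \<open>-1\<close>; \<open>v\<close> is an intermediate point.\<close>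
    define v where "v = - 1 / z - 2"
    have v: "Im v > 0" using z Im_minus_inverse[of z] by (simp add: v_def)
    have "eta24 (- 1 / z) = eta24 v"
      using eta24_translation[of v] eta24_translation[of "v + 1"] by (simp add: v_def)
    hence "eta24 v = z ^ 12 * eta24 z" using eta24_inversion[OF z(1)] by simp
    moreover have "eta24 ((\<tau> + 1) / 2) = eta24 z"
      using eta24_translation[of z] by (simp add: z_def field_simps)
    moreover have "v * z = - \<tau>"
      using z(2) by (simp add: v_def algebra_simps) (simp add: z_def field_simps)
    hence "v ^ 12 * z ^ 12 = \<tau> ^ 12"
      by (simp flip: power_mult_distrib)
    moreover have E: "- 1 / v = (- 1 / \<tau> + 1) / 2"
    proof -
      have "v = - \<tau> / z" using \<open>v * z = - \<tau>\<close> z(2) by (simp add: field_simps)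
      thus ?thesis by (simp add: z_def field_simps)
    qed
    ultimately have "eta24 ((- 1 / \<tau> + 1) / 2) = v ^ 12 * (z ^ 12 * eta24 ((\<tau> + 1) / 2))"
      using eta24_inversion[OF v] unfolding E by simp
    thus ?thesis
      using \<open>v ^ 12 * z ^ 12 = \<tau> ^ 12\<close> by (simp flip: mult.assoc)
  qed
  show "shifted_j (- 1 / \<tau>) = shifted_j \<tau>"
    unfolding shifted_j_def 0 1 2 3 by (simp add: power_mult_distrib power_divide)
qed

lemma qser_shifted_j: obtains h where "qser 2 (- 2) h shifted_j" "h 0 = 1"
proof -
  have U: "qser_unit 1 1 eta24_disc eta24"
    using qser_eta24 eta24_disc_0 eta24_disc_nonzero by (auto simp: qser_unit_def alg_unit_def)
  obtain h1 where h1: "qser_unit 1 2 h1 (\<lambda>\<tau>. eta24 (2 * \<tau>))" "h1 0 = 1"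
    by (rule qser_unit_eta24_affine[of 2 1 0]) auto
  obtain h2 where h2: "qser_unit 2 1 h2 (\<lambda>\<tau>. eta24 (\<tau> / 2))"
    by (rule qser_unit_eta24_affine[of 1 2 0]) auto
  obtain h3 where h3: "qser_unit 2 1 h3 (\<lambda>\<tau>. eta24 ((\<tau> + 1) / 2))"
    by (rule qser_unit_eta24_affine[of 1 2 1]) auto
  define p1 where "p1 = (\<lambda>u. eta24_disc u * inverse (h1 u))"
  have "qser_unit 1 (- 1) p1 (\<lambda>\<tau>. eta24 \<tau> / eta24 (2 * \<tau>))"
    using qser_unit_mult[OF U qser_unit_inverse[OF h1(1)]] by (simp add: p1_def divide_inverse)
  from qser_unit_refine[OF this, of 2]
  have q1: "qser 2 (- 2) (\<lambda>u. p1 (u ^ 2)) (\<lambda>\<tau>. eta24 \<tau> / eta24 (2 * \<tau>))"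
    by (simp add: qser_unit_def)
  have U2: "qser_unit 2 2 (\<lambda>u. eta24_disc (u ^ 2)) eta24"
    using qser_unit_refine[OF U, of 2] by simp
  have q: "\<exists>g. qser 2 (- 2) (\<lambda>u. u ^ 3 * g u) (\<lambda>\<tau>. 2 ^ 12 * (eta24 \<tau> / f \<tau>))"
    if "qser_unit 2 1 h f" for h f
  proof -
    have "qser 2 1 (\<lambda>u. eta24_disc (u ^ 2) * inverse (h u)) (\<lambda>\<tau>. eta24 \<tau> / f \<tau>)"
      using qser_unit_mult[OF U2 qser_unit_inverse[OF that]] by (simp add: qser_unit_def divide_inverse)
    hence "qser 2 1 (\<lambda>u. 2 ^ 12 * (eta24_disc (u ^ 2) * inverse (h u))) (\<lambda>\<tau>. 2 ^ 12 * (eta24 \<tau> / f \<tau>))"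
      by (intro qser_cmult) auto
    from qser_lower[OF this, of "- 2"] show ?thesis by auto
  qed
  obtain g2 g3 where
    g2: "qser 2 (- 2) (\<lambda>u. u ^ 3 * g2 u) (\<lambda>\<tau>. 2 ^ 12 * (eta24 \<tau> / eta24 (\<tau> / 2)))" and
    g3: "qser 2 (- 2) (\<lambda>u. u ^ 3 * g3 u) (\<lambda>\<tau>. 2 ^ 12 * (eta24 \<tau> / eta24 ((\<tau> + 1) / 2)))"
    using q[OF h2] q[OF h3] by blast
  have "qser 2 (- 2) (\<lambda>u. p1 (u ^ 2) + u ^ 3 * g2 u + u ^ 3 * g3 u) shifted_j"
    unfolding shifted_j_def[abs_def] by (intro qser_add q1 g2 g3)
  thus ?thesis
    by (rule that) (simp add: p1_def eta24_disc_0 h1(2))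
qed

text \<open>
  Invariance under \<open>\<tau> \<mapsto> \<tau> + 1\<close> forces the exponents of \<open>q\<close> to be integers: comparing leading
  terms at \<open>\<tau>\<close> and \<open>\<tau> + 1\<close> gives \<open>h 0 = \<zeta> * h 0\<close> for the root of unity \<open>\<zeta> = exp (- 2 * pi * \<i> * N / k)\<close>.
\<close>

lemma qser_constant_term_eq_0:
  assumes f: "qser k (- int N) h f" and per: "\<And>\<tau>. Im \<tau> > 0 \<Longrightarrow> f (\<tau> + 1) = f \<tau>"
    and dvd: "\<not> k dvd N"
  shows "h 0 = 0"
proof -
  have k: "k > 0" and h: "intdisc h" using f by (auto simp: qser_def)
  define \<zeta> where "\<zeta> = unit_exp (of_int (- int N) / of_nat k)"
  have \<zeta>: "\<zeta> \<noteq> 1"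
  proof
    assume "\<zeta> = 1"
    hence "\<exists>n. Im (2 * of_real pi * \<i> * (of_int (- int N) / of_nat k)) = of_int (2 * n) * pi"
      unfolding \<zeta>_def unit_exp_def exp_eq_1 by blast
    moreover have "2 * of_real pi * \<i> * (of_int (- int N) / of_nat k) =
        \<i> * of_real (2 * pi * (- real N / real k))"
      by simp
    ultimately obtain n :: int where "2 * pi * (- real N / real k) = of_int (2 * n) * pi"
      by (metis Im_i_times Re_complex_of_real)
    hence "pi * (2 * (- real N / real k)) = pi * (2 * of_int n)"
      by (simp add: mult_ac)
    hence "- real N / real k = of_int n"
      by (subst (asm) mult_cancel_left) simp
    hence "real N = real_of_int (- n) * real k"
      using k by (simp add: field_simps)
    hence "real_of_int (int N) = real_of_int (- n * int k)"
      by simp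
    hence "int N = - n * int k"
      by (simp only: of_int_eq_iff)
    hence "int k dvd int N" by simp
    thus False using dvd by simp
  qed
  define c where "c = unit_exp (1 / of_nat k)"
  have "intdisc (\<lambda>u. h (c * u ^ 1))"
    using h k unit_exp_rational_algebraic_int[OF k, of 1]
    by (intro intdisc_compose) (auto simp: c_def norm_unit_exp)
  hence h': "intdisc (\<lambda>u. \<zeta> * h (c * u))"
    unfolding \<zeta>_def using unit_exp_rational_algebraic_int[OF k, of "- int N"]
    by (intro intdisc_mult intdisc_const) auto
  have "eventually (\<lambda>\<tau>. Im \<tau> > 0) (filtercomap Im at_top)"
    using eventually_gt_at_top by (rule eventually_filtercomapI)
  hence ev: "eventually (\<lambda>\<tau>. \<zeta> * h (c * unit_exp (\<tau> / of_nat k)) = h (unit_exp (\<tau> / of_nat k)))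
      (filtercomap Im at_top)"
  proof eventually_elim
    case (elim \<tau>)
    have "f (\<tau> + 1) = unit_exp (of_int (- int N) * (\<tau> + 1) / of_nat k) * h (unit_exp ((\<tau> + 1) / of_nat k))"
      using f elim by (simp add: qser_def)
    also have "of_int (- int N) * (\<tau> + 1) / of_nat k =
        of_int (- int N) * \<tau> / of_nat k + of_int (- int N) / of_nat k"
      by (simp add: distrib_left add_divide_distrib diff_divide_distrib)
    also have "(\<tau> + 1) / of_nat k = 1 / of_nat k + \<tau> / of_nat k"
      by (simp add: add_divide_distrib)
    finally have "f (\<tau> + 1) = unit_exp (of_int (- int N) * \<tau> / of_nat k) *
        (\<zeta> * h (c * unit_exp (\<tau> / of_nat k)))"
      by (simp only: unit_exp_add \<zeta>_def c_def mult.assoc)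
    moreover have "f \<tau> = unit_exp (of_int (- int N) * \<tau> / of_nat k) * h (unit_exp (\<tau> / of_nat k))"
      using f elim by (simp add: qser_def)
    ultimately show ?case
      using per[OF elim] by simp
  qed
  have nontriv: "filtercomap Im at_top \<noteq> bot"
  proof (rule filtercomap_neq_bot)
    fix P :: "real \<Rightarrow> bool" assume "eventually P at_top"
    then obtain x where "P x" by (auto simp: eventually_at_top_linorder)
    thus "\<exists>z. P (Im z)" by (intro exI[of _ "Complex 0 x"]) simp
  qed
  have "((\<lambda>\<tau>. \<zeta> * h (c * unit_exp (\<tau> / of_nat k))) \<longlongrightarrow> h 0) (filtercomap Im at_top)"
    using ev by (intro Lim_transform_eventually[OF qser_tendsto_cusp[OF k h]]) (auto elim: eventually_mono)
  moreover have "((\<lambda>\<tau>. \<zeta> * h (c * unit_exp (\<tau> / of_nat k))) \<longlongrightarrow> \<zeta> * h 0) (filtercomap Im at_top)"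
    using qser_tendsto_cusp[OF k h'] by simp
  ultimately have "h 0 = \<zeta> * h 0"
    using tendsto_unique[OF nontriv] by blast
  thus ?thesis using \<zeta> by auto
qed

text \<open>
  Remove the pole at infinity one order at a time, by subtracting multiples of powers of
  \<open>shifted_j\<close>. The latter has leading coefficient \<open>1\<close>, so all coefficients remain algebraic integers.
  Once no pole is left, the function is constant. The statement keeps track of the degree and of the
  coefficient at the top, since both are needed to read off a monic equation later. The width \<open>k\<close>
  is even because \<open>shifted_j\<close> is expanded in powers of \<open>q ^ (1 / 2)\<close>.
\<close>

theorem modular_invariant_eq_poly_shifted_j:
  assumes k: "even k" and inv: "modular_invariant f" and f: "qser k (- int N) h f"
  shows "\<exists>p. (\<forall>n. algebraic_int (coeff p n)) \<and> (\<forall>\<tau>. Im \<tau> > 0 \<longrightarrow> f \<tau> = poly p (shifted_j \<tau>)) \<and>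
    k * degree p \<le> N \<and> (k dvd N \<longrightarrow> coeff p (N div k) = h 0) \<and> (\<not> k dvd N \<longrightarrow> h 0 = 0)"
  using inv f
proof (induction N arbitrary: f h)
  case (0 f h)
  have "f \<tau> = h 0" if "Im \<tau> > 0" for \<tau>
    using modular_invariant_bounded_constant[OF 0(1) _ that] 0(2) by simp
  moreover have "algebraic_int (h 0)"
    using 0(2) intdisc_0 by (auto simp: qser_def)
  ultimately show ?case
    by (intro exI[of _ "[:h 0:]"]) (auto simp: coeff_pCons split: nat.splits)
next
  case (Suc N f h)
  have k0: "k > 0" and alg: "algebraic_int (h 0)"
    using Suc.prems(2) intdisc_0 by (auto simp: qser_def)
  show ?case
  proof (cases "k dvd Suc N")
    case True
    define M where "M = Suc N div k"
    have M: "Suc N = k * M" "M > 0"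
    proof -
      show "Suc N = k * M" using True unfolding M_def by (rule dvd_mult_div_cancel[symmetric])
      thus "M > 0" by (intro Nat.gr0I) simp
    qed
    obtain m where "k = 2 * m" using k by (elim evenE)
    hence m: "m > 0" "2 * m = k" "- 2 * int m = - int k" using k0 by auto
    obtain hJ where hJ: "qser 2 (- 2) hJ shifted_j" "hJ 0 = 1"
      by (rule qser_shifted_j)
    have "qser k (- int k) (\<lambda>u. hJ (u ^ m)) shifted_j"
      using qser_refine[OF hJ(1) m(1)] unfolding m(2,3) .
    moreover have "- int k * int M = - int (Suc N)"
      unfolding M(1) by simp
    ultimately have JM: "qser k (- int (Suc N)) (\<lambda>u. hJ (u ^ m) ^ M) (\<lambda>\<tau>. shifted_j \<tau> ^ M)"
      using qser_power[of k "- int k" _ shifted_j M] by metis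
    have q: "qser k (- int (Suc N)) (\<lambda>u. h u + - (h 0 * hJ (u ^ m) ^ M)) (\<lambda>\<tau>. f \<tau> + - (h 0 * shifted_j \<tau> ^ M))"
      by (rule qser_add[OF Suc.prems(2) qser_minus[OF qser_cmult[OF alg JM]]])
    have "h 0 + - (h 0 * hJ (0 ^ m) ^ M) = 0"
      using hJ(2) m(1) by (simp add: zero_power)
    from qser_divide[OF q this]
    obtain g where "qser k (- int (Suc N) + 1) g (\<lambda>\<tau>. f \<tau> + - (h 0 * shifted_j \<tau> ^ M))" .
    hence g: "qser k (- int N) g (\<lambda>\<tau>. f \<tau> + - (h 0 * shifted_j \<tau> ^ M))"
      by simp
    have "modular_invariant (\<lambda>\<tau>. f \<tau> + - (h 0 * shifted_j \<tau> ^ M))"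
      using Suc.prems(1) shifted_j_modular_invariant by (auto simp: modular_invariant_def)
    from Suc.IH[OF this g] obtain p where p: "\<And>n. algebraic_int (coeff p n)"
      "\<And>\<tau>. Im \<tau> > 0 \<Longrightarrow> f \<tau> + - (h 0 * shifted_j \<tau> ^ M) = poly p (shifted_j \<tau>)" "k * degree p \<le> N"
      by blast
    have "k * degree p < k * M" using p(3) unfolding M(1)[symmetric] by simp
    hence deg: "degree p < M" by simp
    define p' where "p' = p + monom (h 0) M"
    have "algebraic_int (coeff p' n)" for n
      using p(1) alg by (auto simp: p'_def intro!: algebraic_int_add)
    moreover have "f \<tau> = poly p' (shifted_j \<tau>)" if "Im \<tau> > 0" for \<tau>
      using p(2)[OF that] by (simp add: p'_def poly_monom algebra_simps)
    moreover have "degree p' \<le> M"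
      unfolding p'_def using deg by (intro degree_add_le degree_monom_le) auto
    hence "k * degree p' \<le> Suc N"
      unfolding M(1) by (rule mult_le_mono2)
    moreover have "coeff p' (Suc N div k) = h 0"
      unfolding M_def[symmetric] using deg by (simp add: p'_def coeff_eq_0)
    ultimately show ?thesis
      using True by (intro exI[of _ p']) blast
  next
    case False
    have h0: "h 0 = 0"
      by (rule qser_constant_term_eq_0[OF Suc.prems(2) _ False])
         (use Suc.prems(1) in \<open>auto simp: modular_invariant_def\<close>)
    obtain g where "qser k (- int (Suc N) + 1) g f"
      by (rule qser_divide[OF Suc.prems(2) h0])
    hence "qser k (- int N) g f" by simp
    from Suc.IH[OF Suc.prems(1) this] obtain p where "\<forall>n. algebraic_int (coeff p n)"
      "\<forall>\<tau>. Im \<tau> > 0 \<longrightarrow> f \<tau> = poly p (shifted_j \<tau>)" "k * degree p \<le> N"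
      by blast
    thus ?thesis
      using False h0 by (intro exI[of _ p]) auto
  qed
qed



section \<open>Integer matrices and the Hermite normal form\<close>

lemma Im_mobius:
  fixes a b c d :: int
  assumes "Im \<tau> > 0" "a * d - b * c > 0"
  shows "of_int c * \<tau> + of_int d \<noteq> 0" "Im ((of_int a * \<tau> + of_int b) / (of_int c * \<tau> + of_int d)) > 0"
proof -
  show nz: "of_int c * \<tau> + of_int d \<noteq> 0"
  proof
    assume *: "of_int c * \<tau> + of_int d = 0"
    hence "Im (of_int c * \<tau> + of_int d) = 0" by simp
    hence "c = 0" using assms(1) by simp
    thus False using * assms(2) by simp
  qed
  have "Im ((of_int a * \<tau> + of_int b) / (of_int c * \<tau> + of_int d)) =
      of_int (a * d - b * c) * Im \<tau> / (norm (of_int c * \<tau> + of_int d))\<^sup>2"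
    by (simp add: Im_divide cmod_power2 algebra_simps)
  moreover have "real_of_int (a * d - b * c) > 0"
    using assms(2) by (simp only: of_int_0_less_iff)
  moreover have "(norm (of_int c * \<tau> + of_int d))\<^sup>2 > 0"
    using nz by simp
  ultimately show "Im ((of_int a * \<tau> + of_int b) / (of_int c * \<tau> + of_int d)) > 0"
    using assms(1) by (simp only: divide_pos_pos mult_pos_pos)
qed

lemma Im_minus_inverse_pos: "Im \<tau> > 0 \<Longrightarrow> Im (- 1 / \<tau>) > 0"
  using Im_mobius(2)[of \<tau> 0 0 "- 1" 1] by simp

text \<open>
  Every integer matrix of determinant \<open>n > 0\<close> is the product of a matrix in the modular group and an upper
  triangular one with entries \<open>gcd a c\<close>, \<open>b'\<close>, \<open>n div gcd a c\<close>. The Euclidean algorithm on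
  the first column \<open>(a, c)\<close> finds it using translations and the inversion only, so the result holds for
  each \<open>f\<close> that transforms with an even weight \<open>k\<close> under these two maps.
\<close>

lemma mobius_hermite_normal_form:
  fixes a b c d :: int and f :: "complex \<Rightarrow> complex"
  assumes k: "even k"
    and T: "\<And>\<tau>. Im \<tau> > 0 \<Longrightarrow> f (\<tau> + 1) = f \<tau>"
    and S: "\<And>\<tau>. Im \<tau> > 0 \<Longrightarrow> f (- 1 / \<tau>) = \<tau> ^ k * f \<tau>"
    and det: "a * d - b * c = n" "n > 0"
  obtains b' where "0 \<le> b'" "b' < n div gcd a c"
    "\<And>\<tau>. Im \<tau> > 0 \<Longrightarrow> f ((of_int a * \<tau> + of_int b) / (of_int c * \<tau> + of_int d)) =
       ((of_int c * \<tau> + of_int d) / of_int (n div gcd a c)) ^ k *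
       f ((of_int (gcd a c) * \<tau> + of_int b') / of_int (n div gcd a c))"
  using det
proof (induction "nat \<bar>c\<bar>" arbitrary: a b c d thesis rule: less_induct)
  case less
  show ?case
  proof (cases "c = 0")
    case True
    \<comment> \<open>Negating all entries if necessary makes the diagonal positive; the even weight does not see the sign.\<close>
    define s where "s = sgn a"
    have ad: "a * d = n" using less.prems True by simp
    hence a0: "a \<noteq> 0" "d \<noteq> 0" using det(2) by auto
    have s: "s * s = 1" "\<bar>a\<bar> = s * a" "s = 1 \<or> s = - 1"
      using a0 by (auto simp: s_def sgn_if)
    have d': "n div gcd a c = s * d"
    proof -
      have "n = \<bar>a\<bar> * (s * d)" using ad s by (simp add: algebra_simps)
      thus ?thesis using True a0 by simp
    qed
    have d'_pos: "s * d > 0"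
      using ad det(2) by (auto simp: s_def sgn_if zero_less_mult_iff)
    define b' where "b' = (s * b) mod (s * d)"
    define m where "m = (s * b) div (s * d)"
    have "f ((of_int a * \<tau> + of_int b) / (of_int c * \<tau> + of_int d)) =
       ((of_int c * \<tau> + of_int d) / of_int (n div gcd a c)) ^ k *
       f ((of_int (gcd a c) * \<tau> + of_int b') / of_int (n div gcd a c))" if \<tau>: "Im \<tau> > 0" for \<tau>
    proof -
      define z where "z = (of_int (gcd a c) * \<tau> + of_int b') / of_int (n div gcd a c)"
      have "Im z > 0"
        unfolding z_def d' using \<tau> d'_pos a0 True by (simp flip: of_int_mult)
      hence "f (z + of_int m) = f z"
        by (intro periodic_int_shift T)
      also have "z + of_int m = (of_int a * \<tau> + of_int b) / (of_int c * \<tau> + of_int d)"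
      proof -
        have "s * b = m * (s * d) + b'"
          by (simp only: m_def b'_def div_mult_mod_eq)
        hence sb: "of_int (s * b) = (of_int m * of_int (s * d) + of_int b' :: complex)"
          by (simp only: of_int_add of_int_mult)
        have nz: "of_int (s * d) \<noteq> (0 :: complex)" "of_int s \<noteq> (0 :: complex)"
          using d'_pos s(3) by (simp_all only: of_int_eq_0_iff) auto
        have "z + of_int m = (of_int (s * a) * \<tau> + of_int (s * b)) / of_int (s * d)"
        proof -
          have "(x + y) / D + m = (x + (m * D + y)) / D" if "D \<noteq> 0" for x y m D :: complex
            using that by (simp add: field_simps)
          moreover have "z = (of_int (s * a) * \<tau> + of_int b') / of_int (s * d)"
            unfolding z_def d' using s(2) True by simp
          ultimately show ?thesis
            unfolding sb using nz(1) by metis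
        qed
        also have "\<dots> = (of_int s * (of_int a * \<tau> + of_int b)) / (of_int s * of_int d)"
          by (simp only: of_int_mult distrib_left mult.assoc)
        also have "\<dots> = (of_int a * \<tau> + of_int b) / (of_int c * \<tau> + of_int d)"
          using \<open>of_int s \<noteq> 0\<close> True by simp
        finally show ?thesis .
      qed
      moreover have "((of_int c * \<tau> + of_int d) / of_int (n div gcd a c)) ^ k = 1"
      proof -
        have "(of_int c * \<tau> + of_int d) / of_int (n div gcd a c) = 1 / of_int s"
          unfolding d' using a0 True by simp
        moreover have "of_int s ^ k = (1 :: complex)"
          using s(3) k by auto
        ultimately show ?thesis by (simp only: power_divide power_one) simp
      qed
      ultimately show ?thesis by (simp add: z_def)
    qed
    moreover have "0 \<le> b'" "b' < n div gcd a c"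
      unfolding b'_def d' using pos_mod_sign[OF d'_pos] pos_mod_bound[OF d'_pos] by blast+
    ultimately show ?thesis using less.prems(1) by blast
  next
    case False
    \<comment> \<open>A translation replaces \<open>a\<close> by \<open>a mod c\<close>, and the inversion then moves it to the lower left corner.\<close>
    define q where "q = a div c"
    define a1 where "a1 = a mod c"
    define b1 where "b1 = b - q * d"
    have a: "a = q * c + a1" by (simp add: q_def a1_def)
    have det1: "(- c) * b1 - (- d) * a1 = n"
      using less.prems(2) by (simp add: a b1_def algebra_simps)
    have gcd: "gcd (- c) a1 = gcd a c"
      unfolding a1_def using gcd_red_int[of a c] by simp
    have lt: "nat \<bar>a1\<bar> < nat \<bar>c\<bar>"
      using False abs_mod_less[of c a] by (simp add: a1_def)
    obtain b' where b': "0 \<le> b'" "b' < n div gcd a c"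
      "\<And>\<tau>. Im \<tau> > 0 \<Longrightarrow> f ((of_int (- c) * \<tau> + of_int (- d)) / (of_int a1 * \<tau> + of_int b1)) =
       ((of_int a1 * \<tau> + of_int b1) / of_int (n div gcd a c)) ^ k *
       f ((of_int (gcd a c) * \<tau> + of_int b') / of_int (n div gcd a c))"
      using less.hyps[OF lt _ det1 det(2)] unfolding gcd by blast
    show ?thesis
    proof (rule less.prems(1)[OF b'(1,2)])
      fix \<tau> :: complex assume \<tau>: "Im \<tau> > 0"
      define z where "z = (of_int (- c) * \<tau> + of_int (- d)) / (of_int a1 * \<tau> + of_int b1)"
      have nz: "of_int a1 * \<tau> + of_int b1 \<noteq> 0" and z: "Im z > 0"
        using Im_mobius[OF \<tau>, of "- c" b1 "- d" a1] det1 det(2) by (auto simp: z_def)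
      have nz2: "of_int c * \<tau> + of_int d \<noteq> 0"
        using Im_mobius(1)[OF \<tau>, of a d b c] less.prems(2) det(2) by simp
      have "Im (- 1 / z) > 0" using z by (rule Im_minus_inverse_pos)
      hence "f (- 1 / z + of_int q) = f (- 1 / z)"
        by (intro periodic_int_shift T)
      also have "\<dots> = z ^ k * f z"
        using z by (rule S)
      also have "f z = ((of_int a1 * \<tau> + of_int b1) / of_int (n div gcd a c)) ^ k *
         f ((of_int (gcd a c) * \<tau> + of_int b') / of_int (n div gcd a c))"
        unfolding z_def by (rule b'(3)[OF \<tau>])
      also have "z ^ k * \<dots> = (z * (of_int a1 * \<tau> + of_int b1) / of_int (n div gcd a c)) ^ k *
         f ((of_int (gcd a c) * \<tau> + of_int b') / of_int (n div gcd a c))"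
        by (simp add: power_mult_distrib power_divide)
      also have "z * (of_int a1 * \<tau> + of_int b1) = - (of_int c * \<tau> + of_int d)"
        using nz by (simp add: z_def)
      also have "(- (of_int c * \<tau> + of_int d) / of_int (n div gcd a c)) ^ k =
          ((of_int c * \<tau> + of_int d) / of_int (n div gcd a c)) ^ k"
        using k by (simp only: power_divide power_minus_even)
      also have "- 1 / z + of_int q = (of_int a * \<tau> + of_int b) / (of_int c * \<tau> + of_int d)"
      proof -
        have "- 1 / z = (of_int a1 * \<tau> + of_int b1) / (of_int c * \<tau> + of_int d)"
        proof -
          have "of_int (- c) * \<tau> + of_int (- d) = - (of_int c * \<tau> + of_int d)" by simp
          moreover have "- 1 / (- x / y) = y / x" for x y :: complex by simp
          ultimately show ?thesis by (simp only: z_def)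
        qed
        hence "- 1 / z + of_int q =
            (of_int a1 * \<tau> + of_int b1 + of_int q * (of_int c * \<tau> + of_int d)) / (of_int c * \<tau> + of_int d)"
        proof -
          have "x / y + t = (x + t * y) / y" if "y \<noteq> 0" for x y t :: complex
            using that by (simp add: field_simps)
          from this[OF nz2] show ?thesis
            using \<open>- 1 / z = _\<close> by (simp only:)
        qed
        also have "of_int a1 * \<tau> + of_int b1 + of_int q * (of_int c * \<tau> + of_int d) = of_int a * \<tau> + of_int b"
          by (simp add: a b1_def algebra_simps)
        finally show ?thesis .
      qed
      finally show "f ((of_int a * \<tau> + of_int b) / (of_int c * \<tau> + of_int d)) =
       ((of_int c * \<tau> + of_int d) / of_int (n div gcd a c)) ^ k *
       f ((of_int (gcd a c) * \<tau> + of_int b') / of_int (n div gcd a c))" .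
    qed
  qed
qed

section \<open>Families of functions permuted by the modular group\<close>

text \<open>
  Functions are cut off outside the half-plane, so that two of them are equal as soon as they agree where it
  matters. This makes it possible to speak of finite sets of functions.
\<close>

definition on_uhp :: "(complex \<Rightarrow> complex) \<Rightarrow> complex \<Rightarrow> complex" where
  "on_uhp f = (\<lambda>\<tau>. if Im \<tau> > 0 then f \<tau> else 0)"

definition integral_qser :: "(complex \<Rightarrow> complex) \<Rightarrow> bool" where
  "integral_qser f \<longleftrightarrow> (\<exists>k N h. qser k N h f)"

text \<open>
  Finite sets of functions with integral expansions that are mapped into themselves, and hence permuted, by the modular
  group. Symmetric expressions in the members are then modular invariants.
\<close>

definition modular_family :: "(complex \<Rightarrow> complex) set \<Rightarrow> bool" where
  "modular_family F \<longleftrightarrow> finite F \<and>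
     (\<forall>f\<in>F. on_uhp f = f \<and> integral_qser f \<and>
        on_uhp (\<lambda>\<tau>. f (\<tau> + 1)) \<in> F \<and> on_uhp (\<lambda>\<tau>. f (- 1 / \<tau>)) \<in> F)"

lemma integral_qser_common:
  assumes "integral_qser f" "integral_qser g"
  obtains k N h h' where "qser k N h f" "qser k N h' g"
proof -
  obtain k N h k' N' h' where q: "qser k N h f" "qser k' N' h' g"
    using assms by (auto simp: integral_qser_def)
  hence "k > 0" "k' > 0" by (auto simp: qser_def)
  from qser_refine[OF q(1) this(2)] qser_refine[OF q(2) this(1)]
  have "qser (k * k') (N * int k') (\<lambda>u. h (u ^ k')) f"
    "qser (k * k') (N' * int k) (\<lambda>u. h' (u ^ k)) g" by (simp_all add: mult.commute)
  from qser_lower[OF this(1), of "min (N * int k') (N' * int k)"]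
    qser_lower[OF this(2), of "min (N * int k') (N' * int k)"]
  show ?thesis using that by simp
qed

lemma integral_qser_add:
  assumes "integral_qser f" "integral_qser g"
  shows "integral_qser (\<lambda>\<tau>. f \<tau> + g \<tau>)"
  by (rule integral_qser_common[OF assms]) (use qser_add integral_qser_def in blast)

lemma integral_qser_mult:
  assumes "integral_qser f" "integral_qser g"
  shows "integral_qser (\<lambda>\<tau>. f \<tau> * g \<tau>)"
  by (rule integral_qser_common[OF assms]) (use qser_mult integral_qser_def in blast)

lemma integral_qser_const: "algebraic_int c \<Longrightarrow> integral_qser (\<lambda>_. c)"
  using qser_const[of c 1] integral_qser_def by auto

lemma integral_qser_minus: "integral_qser f \<Longrightarrow> integral_qser (\<lambda>\<tau>. - f \<tau>)"
  unfolding integral_qser_def using qser_minus by blast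

lemma integral_qser_coeff_prod:
  assumes "finite I" "\<And>i. i \<in> I \<Longrightarrow> integral_qser (g i)"
  shows "integral_qser (\<lambda>\<tau>. coeff (\<Prod>i\<in>I. [:- g i \<tau>, 1:]) n)"
  using assms
proof (induction I arbitrary: n rule: finite_induct)
  case empty
  show ?case by (cases n) (auto intro: integral_qser_const)
next
  case (insert i I)
  have eq: "(\<lambda>\<tau>. coeff (\<Prod>i\<in>insert i I. [:- g i \<tau>, 1:]) n) =
      (\<lambda>\<tau>. - g i \<tau> * coeff (\<Prod>i\<in>I. [:- g i \<tau>, 1:]) n +
         (case n of 0 \<Rightarrow> 0 | Suc m \<Rightarrow> coeff (\<Prod>i\<in>I. [:- g i \<tau>, 1:]) m))"
    using insert.hyps by (auto simp: coeff_pCons fun_eq_iff split: nat.splits)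
  show ?case
    unfolding eq
  proof (intro integral_qser_add integral_qser_mult integral_qser_minus)
    show "integral_qser (g i)" using insert.prems by simp
    show "integral_qser (\<lambda>\<tau>. coeff (\<Prod>i\<in>I. [:- g i \<tau>, 1:]) n)" using insert by simp
    show "integral_qser (\<lambda>\<tau>. case n of 0 \<Rightarrow> 0 | Suc m \<Rightarrow> coeff (\<Prod>i\<in>I. [:- g i \<tau>, 1:]) m)"
      using insert by (cases n) (auto intro: integral_qser_const)
  qed
qed

text \<open>
  Composition with a bijection of the half-plane is injective on functions, and an injective map of a
  finite set into itself is a permutation.
\<close>

lemma modular_family_prod:
  fixes \<phi> :: "complex \<Rightarrow> 'a :: comm_monoid_mult"
  assumes F: "modular_family F" and \<tau>: "Im \<tau> > 0"
  shows "(\<Prod>f\<in>F. \<phi> (f (\<tau> + 1))) = (\<Prod>f\<in>F. \<phi> (f \<tau>))"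
    and "(\<Prod>f\<in>F. \<phi> (f (- 1 / \<tau>))) = (\<Prod>f\<in>F. \<phi> (f \<tau>))"
proof -
  have shift: "(\<Prod>f\<in>F. \<phi> (f (\<gamma> \<tau>))) = (\<Prod>f\<in>F. \<phi> (f \<tau>))"
    if \<gamma>: "\<And>f. f \<in> F \<Longrightarrow> on_uhp (\<lambda>\<tau>. f (\<gamma> \<tau>)) \<in> F"
      and surj: "\<And>\<tau>. Im \<tau> > 0 \<Longrightarrow> \<exists>\<tau>'. Im \<tau>' > 0 \<and> \<gamma> \<tau>' = \<tau>" for \<gamma> :: "complex \<Rightarrow> complex"
  proof -
    define \<Gamma> where "\<Gamma> = (\<lambda>f. on_uhp (\<lambda>\<tau>. f (\<gamma> \<tau>)))"
    have inj: "inj_on \<Gamma> F"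
    proof (rule inj_onI)
      fix f g assume fg: "f \<in> F" "g \<in> F" "\<Gamma> f = \<Gamma> g"
      have "f z = g z" if z: "Im z > 0" for z
      proof -
        obtain z' where "Im z' > 0" "\<gamma> z' = z" using surj[OF z] by blast
        thus ?thesis using fun_cong[OF fg(3), of z'] by (simp add: \<Gamma>_def on_uhp_def)
      qed
      hence "on_uhp f = on_uhp g" by (auto simp: on_uhp_def)
      thus "f = g" using F fg by (auto simp: modular_family_def)
    qed
    have "\<Gamma> ` F \<subseteq> F" "finite F"
      using F \<gamma> by (auto simp: modular_family_def \<Gamma>_def)
    hence "bij_betw \<Gamma> F F"
      using inj endo_inj_surj[of F \<Gamma>] by (simp add: bij_betw_def)
    from prod.reindex_bij_betw[OF this, of "\<lambda>f. \<phi> (f \<tau>)"]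
    show ?thesis using \<tau> by (simp add: \<Gamma>_def on_uhp_def)
  qed
  show "(\<Prod>f\<in>F. \<phi> (f (\<tau> + 1))) = (\<Prod>f\<in>F. \<phi> (f \<tau>))"
  proof (rule shift)
    show "\<exists>\<tau>'. Im \<tau>' > 0 \<and> \<tau>' + 1 = \<tau>" if "Im \<tau> > 0" for \<tau>
      using that by (intro exI[of _ "\<tau> - 1"]) auto
  qed (use F in \<open>auto simp: modular_family_def\<close>)
  show "(\<Prod>f\<in>F. \<phi> (f (- 1 / \<tau>))) = (\<Prod>f\<in>F. \<phi> (f \<tau>))"
  proof (rule shift)
    show "\<exists>\<tau>'. Im \<tau>' > 0 \<and> - 1 / \<tau>' = \<tau>" if "Im \<tau> > 0" for \<tau>
      using that Im_minus_inverse_pos[OF that] by (intro exI[of _ "- 1 / \<tau>"]) auto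
  qed (use F in \<open>auto simp: modular_family_def\<close>)
qed

lemma integral_qser_modular_invariant:
  assumes f: "integral_qser f" "modular_invariant f" and \<tau>: "Im \<tau> > 0" "algebraic_int (shifted_j \<tau>)"
  shows "algebraic_int (f \<tau>)"
proof -
  obtain k N h where q: "qser k N h f"
    using f by (auto simp: integral_qser_def)
  have "qser (k * 2) (N * int 2) (\<lambda>u. h (u ^ 2)) f"
    using qser_refine[OF q, of 2] by simp
  moreover have "- int (nat \<bar>N * 2\<bar>) \<le> N * int 2"
    by simp
  ultimately have "qser (k * 2) (- int (nat \<bar>N * 2\<bar>))
      (\<lambda>u. u ^ nat (N * int 2 - - int (nat \<bar>N * 2\<bar>)) * h (u ^ 2)) f"
    by (rule qser_lower)
  from modular_invariant_eq_poly_shifted_j[OF _ f(2) this]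
  obtain p where "\<And>n. algebraic_int (coeff p n)" "f \<tau> = poly p (shifted_j \<tau>)"
    using \<tau>(1) by auto
  thus ?thesis using algebraic_int_poly[of p "shifted_j \<tau>"] \<tau>(2) by simp
qed

text \<open>
  The coefficients of \<open>\<Prod>f\<in>F. [:- f \<tau>, 1:]\<close> are modular invariants with integral expansions, hence polynomials
  in \<open>shifted_j\<close>. At the given \<open>\<tau>\<close> they are algebraic integers, and \<open>f \<tau>\<close> is a root of this monic polynomial.
\<close>

theorem modular_family_algebraic_int:
  assumes F: "modular_family F" and \<tau>: "Im \<tau> > 0" "algebraic_int (shifted_j \<tau>)" and f: "f \<in> F"
  shows "algebraic_int (f \<tau>)"
proof (rule algebraic_int_integral)
  define P where "P = (\<lambda>\<tau>. \<Prod>f\<in>F. [:- f \<tau>, 1:])"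
  have fin: "finite F" using F by (simp add: modular_family_def)
  show "poly (P \<tau>) (f \<tau>) = 0"
    using fin f by (auto simp: P_def poly_prod)
  show "lead_coeff (P \<tau>) = 1"
    by (simp add: P_def lead_coeff_prod)
  show "algebraic_int (coeff (P \<tau>) n)" for n
  proof (rule integral_qser_modular_invariant[OF _ _ \<tau>])
    show "integral_qser (\<lambda>\<tau>. coeff (P \<tau>) n)"
      unfolding P_def using F by (intro integral_qser_coeff_prod) (auto simp: modular_family_def)
    show "modular_invariant (\<lambda>\<tau>. coeff (P \<tau>) n)"
      using modular_family_prod[OF F, of _ "\<lambda>y. [:- y, 1:]"]
      by (auto simp: modular_invariant_def P_def)
  qed
qed

section \<open>Complex multiplication: integrality of the j-function\<close>

text \<open>
  A pole at infinity whose leading coefficient is a unit. The class is closed under products.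
\<close>

definition polar_unit :: "(complex \<Rightarrow> complex) \<Rightarrow> bool" where
  "polar_unit f \<longleftrightarrow> (\<exists>k N h. qser k N h f \<and> N < 0 \<and> alg_unit (h 0))"

lemma polar_unit_mult:
  assumes "polar_unit f" "polar_unit g"
  shows "polar_unit (\<lambda>\<tau>. f \<tau> * g \<tau>)"
proof -
  obtain k N h k' N' h' where q: "qser k N h f" "qser k' N' h' g"
    and *: "N < 0" "N' < 0" "alg_unit (h 0)" "alg_unit (h' 0)"
    using assms by (auto simp: polar_unit_def)
  have k: "k > 0" "k' > 0" using q by (auto simp: qser_def)
  have "qser (k * k') (N * int k') (\<lambda>u. h (u ^ k')) f"
    "qser (k * k') (N' * int k) (\<lambda>u. h' (u ^ k)) g"
    using qser_refine[OF q(1) k(2)] qser_refine[OF q(2) k(1)] by (simp_all add: mult.commute)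
  from qser_mult[OF this]
  have "qser (k * k') (N * int k' + N' * int k) (\<lambda>u. h (u ^ k') * h' (u ^ k)) (\<lambda>\<tau>. f \<tau> * g \<tau>)" .
  moreover have "N * int k' + N' * int k < 0"
    using * k by (intro add_neg_neg mult_neg_pos) auto
  moreover have "alg_unit (h (0 ^ k') * h' (0 ^ k))"
    using * k by (simp add: zero_power alg_unit_mult)
  ultimately show ?thesis unfolding polar_unit_def by blast
qed

lemma polar_unit_prod:
  assumes "finite F" "F \<noteq> {}" "\<And>i. i \<in> F \<Longrightarrow> polar_unit (g i)"
  shows "polar_unit (\<lambda>\<tau>. \<Prod>i\<in>F. g i \<tau>)"
  using assms by (induction F rule: finite_ne_induct) (auto intro: polar_unit_mult)

lemma integral_qser_shifted_j_affine:
  assumes "a > 0" "d > 0"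
  shows "integral_qser (\<lambda>\<tau>. shifted_j ((of_nat a * \<tau> + of_int b) / of_nat d))"
proof -
  obtain h where h: "qser 2 (- 2) h shifted_j"
    by (rule qser_shifted_j)
  show ?thesis
    using qser_affine[OF h assms, of b] unfolding integral_qser_def by blast
qed

text \<open>
  The two terms have pole orders \<open>1\<close> and \<open>a / d\<close> at infinity, with unit leading coefficients \<open>1\<close> and a root
  of unity. As \<open>a \<noteq> d\<close>, the term with the higher order determines the leading coefficient of the difference.
\<close>

lemma polar_unit_shifted_j_diff:
  assumes a: "a > 0" and d: "d > 0" and ad: "a \<noteq> d"
  shows "polar_unit (\<lambda>\<tau>. shifted_j \<tau> - shifted_j ((of_nat a * \<tau> + of_int b) / of_nat d))"
proof -
  obtain h where h: "qser 2 (- 2) h shifted_j" "h 0 = 1"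
    by (rule qser_shifted_j)
  define \<zeta> where "\<zeta> = unit_exp (of_int ((- 2) * b) / of_nat (2 * d))"
  define g where "g = (\<lambda>u. \<zeta> * h (unit_exp (of_int b / of_nat (2 * d)) * u ^ a))"
  have q1: "qser (2 * d) (- 2 * int d) (\<lambda>u. h (u ^ d)) shifted_j"
    using qser_refine[OF h(1) d] by simp
  have q2: "qser (2 * d) (- 2 * int a) g (\<lambda>\<tau>. shifted_j ((of_nat a * \<tau> + of_int b) / of_nat d))"
    using qser_affine[OF h(1) a d, of b] by (simp only: g_def \<zeta>_def)
  have g0: "g 0 = \<zeta>" using a h(2) by (simp add: g_def zero_power)
  have \<zeta>: "alg_unit \<zeta>" unfolding \<zeta>_def using d by (intro alg_unit_unit_exp) simp
  have "\<exists>k N h. qser k N h (\<lambda>\<tau>. shifted_j \<tau> + - shifted_j ((of_nat a * \<tau> + of_int b) / of_nat d)) \<and>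
      N < 0 \<and> alg_unit (h 0)"
  proof (cases "a < d")
    case True
    have "qser (2 * d) (- 2 * int d)
       (\<lambda>u. h (u ^ d) + - (u ^ nat (- 2 * int a - (- 2 * int d)) * g u))
       (\<lambda>\<tau>. shifted_j \<tau> + - shifted_j ((of_nat a * \<tau> + of_int b) / of_nat d))"
      using True by (intro qser_add qser_minus q1 qser_lower[OF q2]) auto
    moreover have "h (0 ^ d) + - (0 ^ nat (- 2 * int a - (- 2 * int d)) * g 0) = 1"
      using True d h(2) by (simp add: zero_power)
    moreover have "alg_unit 1" by (simp add: alg_unit_def)
    ultimately show ?thesis
      using d by (intro exI conjI) (assumption, auto)
  next
    case False
    hence "a > d" using ad by simp
    have "qser (2 * d) (- 2 * int a)
       (\<lambda>u. u ^ nat (- 2 * int d - (- 2 * int a)) * h (u ^ d) + - g u)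
       (\<lambda>\<tau>. shifted_j \<tau> + - shifted_j ((of_nat a * \<tau> + of_int b) / of_nat d))"
      using \<open>a > d\<close> by (intro qser_add qser_minus q2 qser_lower[OF q1]) auto
    moreover have "0 ^ nat (- 2 * int d - (- 2 * int a)) * h (0 ^ d) + - g 0 = - \<zeta>"
      using \<open>a > d\<close> g0 by (simp add: zero_power)
    moreover have "alg_unit (- \<zeta>)" using \<zeta> by (simp add: alg_unit_def)
    ultimately show ?thesis
      using a by (intro exI conjI) (assumption, auto)
  qed
  thus "polar_unit (\<lambda>\<tau>. shifted_j \<tau> - shifted_j ((of_nat a * \<tau> + of_int b) / of_nat d))"
    by (simp add: polar_unit_def)
qed

text \<open>
  All functions \<open>F \<circ> A\<close> for integer matrices \<open>A\<close> of determinant \<open>n\<close>. Taking all matrices instead of coset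
  representatives makes the action of the modular group obvious; for the functions of interest the set
  is finite because of the Hermite normal form.
\<close>

definition mobius_orbit :: "int \<Rightarrow> (complex \<Rightarrow> complex) \<Rightarrow> (complex \<Rightarrow> complex) set" where
  "mobius_orbit n F = {on_uhp (\<lambda>\<tau>. F ((of_int a * \<tau> + of_int b) / (of_int c * \<tau> + of_int d))) |
     a b c d. a * d - b * c = n}"

lemma on_uhp_cong: "(\<And>\<tau>. Im \<tau> > 0 \<Longrightarrow> f \<tau> = g \<tau>) \<Longrightarrow> on_uhp f = on_uhp g"
  by (auto simp: on_uhp_def)

lemma modular_family_mobius_orbit:
  assumes fin: "finite (mobius_orbit n F)"
    and int: "\<And>f. f \<in> mobius_orbit n F \<Longrightarrow> integral_qser f"
  shows "modular_family (mobius_orbit n F)"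
  unfolding modular_family_def
proof (intro conjI ballI fin int)
  fix f assume f: "f \<in> mobius_orbit n F"
  then obtain a b c d where abcd: "f = on_uhp (\<lambda>\<tau>. F ((of_int a * \<tau> + of_int b) / (of_int c * \<tau> + of_int d)))"
    and det: "a * d - b * c = n"
    by (auto simp: mobius_orbit_def)
  show "on_uhp f = f" by (auto simp: abcd on_uhp_def)
  have "on_uhp (\<lambda>\<tau>. f (\<tau> + 1)) =
      on_uhp (\<lambda>\<tau>. F ((of_int a * \<tau> + of_int (a + b)) / (of_int c * \<tau> + of_int (c + d))))"
    by (rule on_uhp_cong) (simp add: abcd on_uhp_def algebra_simps)
  moreover have "a * (c + d) - (a + b) * c = n" using det by (simp add: algebra_simps)
  ultimately show "on_uhp (\<lambda>\<tau>. f (\<tau> + 1)) \<in> mobius_orbit n F"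
    unfolding mobius_orbit_def by blast
  have "on_uhp (\<lambda>\<tau>. f (- 1 / \<tau>)) =
      on_uhp (\<lambda>\<tau>. F ((of_int b * \<tau> + of_int (- a)) / (of_int d * \<tau> + of_int (- c))))"
  proof (rule on_uhp_cong)
    fix \<tau> :: complex assume \<tau>: "Im \<tau> > 0"
    hence "Im (- 1 / \<tau>) > 0" "\<tau> \<noteq> 0" using Im_minus_inverse_pos by auto
    moreover have "(of_int a * (- 1 / \<tau>) + of_int b) / (of_int c * (- 1 / \<tau>) + of_int d) =
        (of_int b * \<tau> + of_int (- a)) / (of_int d * \<tau> + of_int (- c))"
    proof -
      have "of_int a * (- 1 / \<tau>) + of_int b = (of_int b * \<tau> + of_int (- a)) / \<tau>"
        "of_int c * (- 1 / \<tau>) + of_int d = (of_int d * \<tau> + of_int (- c)) / \<tau>"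
        using \<open>\<tau> \<noteq> 0\<close> by (simp_all add: field_simps)
      thus ?thesis using \<open>\<tau> \<noteq> 0\<close> by simp
    qed
    ultimately show "f (- 1 / \<tau>) = F ((of_int b * \<tau> + of_int (- a)) / (of_int d * \<tau> + of_int (- c)))"
      by (simp add: abcd on_uhp_def)
  qed
  moreover have "b * (- c) - (- a) * d = n" using det by (simp add: algebra_simps)
  ultimately show "on_uhp (\<lambda>\<tau>. f (- 1 / \<tau>)) \<in> mobius_orbit n F"
    unfolding mobius_orbit_def by blast
qed
lemma qser_cong: "(\<And>\<tau>. Im \<tau> > 0 \<Longrightarrow> f \<tau> = g \<tau>) \<Longrightarrow> qser k N h f \<longleftrightarrow> qser k N h g"
  by (simp add: qser_def)

lemma integral_qser_on_uhp: "integral_qser (on_uhp f) \<longleftrightarrow> integral_qser f"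
  unfolding integral_qser_def by (simp add: on_uhp_def cong: qser_cong)

lemma shifted_j_orbit_cases:
  assumes "f \<in> mobius_orbit n shifted_j" "n > 0"
  obtains a d :: nat and b :: int where "int a * int d = n" "0 \<le> b" "b < int d"
    "f = on_uhp (\<lambda>\<tau>. shifted_j ((of_nat a * \<tau> + of_int b) / of_nat d))"
proof -
  obtain a b c d where f: "f = on_uhp (\<lambda>\<tau>. shifted_j ((of_int a * \<tau> + of_int b) / (of_int c * \<tau> + of_int d)))"
    and det: "a * d - b * c = n"
    using assms by (auto simp: mobius_orbit_def)
  have dvd: "gcd a c dvd n"
    unfolding det[symmetric] by (intro dvd_diff) auto
  have g: "gcd a c > 0"
    using det assms(2) by (auto simp: zero_less_iff_neq_zero gcd_pos_int) 
  obtain b' where b': "0 \<le> b'" "b' < n div gcd a c"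
    "\<And>\<tau>. Im \<tau> > 0 \<Longrightarrow> shifted_j ((of_int a * \<tau> + of_int b) / (of_int c * \<tau> + of_int d)) =
       ((of_int c * \<tau> + of_int d) / of_int (n div gcd a c)) ^ 0 *
       shifted_j ((of_int (gcd a c) * \<tau> + of_int b') / of_int (n div gcd a c))"
    by (rule mobius_hermite_normal_form[of 0 shifted_j, OF _ _ _ det assms(2)])
       (use shifted_j_modular_invariant in \<open>auto simp: modular_invariant_def\<close>)
  have d: "n div gcd a c > 0" using b' by simp
  show ?thesis
  proof (rule that[of "nat (gcd a c)" "nat (n div gcd a c)" b'])
    show "f = on_uhp (\<lambda>\<tau>. shifted_j ((of_nat (nat (gcd a c)) * \<tau> + of_int b') / of_nat (nat (n div gcd a c))))"
      unfolding f using b'(3) g d by (intro on_uhp_cong) simp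
  qed (use b' g d dvd in auto)
qed

lemma shifted_j_orbit_family:
  assumes n: "n > 0"
  shows "modular_family (mobius_orbit n shifted_j)"
proof (rule modular_family_mobius_orbit)
  define G where "G = (\<lambda>(a::nat, b::int, d::nat). on_uhp (\<lambda>\<tau>. shifted_j ((of_nat a * \<tau> + of_int b) / of_nat d)))"
  have "mobius_orbit n shifted_j \<subseteq> G ` ({..nat n} \<times> {0..n} \<times> {..nat n})"
  proof
    fix f assume "f \<in> mobius_orbit n shifted_j"
    then obtain a d :: nat and b :: int where *: "int a * int d = n" "0 \<le> b" "b < int d"
      "f = on_uhp (\<lambda>\<tau>. shifted_j ((of_nat a * \<tau> + of_int b) / of_nat d))"
      by (rule shifted_j_orbit_cases[OF _ n])
    have "a > 0" "d > 0" using * n by (auto intro: Nat.gr0I)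
    hence "int a * 1 \<le> int a * int d" "1 * int d \<le> int a * int d"
      by (intro mult_left_mono mult_right_mono; simp)+
    hence "a \<le> nat n" "d \<le> nat n" "b \<le> n" using * by auto
    moreover have "f = G (a, b, d)" using * by (simp add: G_def)
    ultimately show "f \<in> G ` ({..nat n} \<times> {0..n} \<times> {..nat n})"
      using *(2) by (intro image_eqI[of _ _ "(a, b, d)"]) auto
  qed
  thus "finite (mobius_orbit n shifted_j)"
    by (rule finite_subset) auto
next
  fix f assume f: "f \<in> mobius_orbit n shifted_j"
  show "integral_qser f"
  proof (rule shifted_j_orbit_cases[OF f n])
    fix a d :: nat and b :: int
    assume *: "int a * int d = n" "f = on_uhp (\<lambda>\<tau>. shifted_j ((of_nat a * \<tau> + of_int b) / of_nat d))"
    have "a > 0" "d > 0" using * n by (auto intro: Nat.gr0I)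
    thus ?thesis
      unfolding *(2) integral_qser_on_uhp by (rule integral_qser_shifted_j_affine)
  qed
qed

lemma polar_unit_on_uhp: "polar_unit (\<lambda>\<tau>. g \<tau> - on_uhp f \<tau>) \<longleftrightarrow> polar_unit (\<lambda>\<tau>. g \<tau> - f \<tau>)"
  unfolding polar_unit_def by (simp add: on_uhp_def cong: qser_cong)

text \<open>
  The product of \<open>shifted_j - f\<close> over the orbit of \<open>shifted_j\<close> is a modular invariant, so it is a polynomial in
  \<open>shifted_j\<close>: the diagonal of the modular equation of level \<open>n\<close>. It vanishes at \<open>\<tau>\<close>, because one of the \<open>f\<close> is
  composition with the matrix that fixes \<open>\<tau>\<close>. Since \<open>n\<close> is not a square, no factor loses its
  leading term, so the leading coefficient of the polynomial is a unit.
\<close>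

theorem shifted_j_fixed_point_algebraic_int:
  fixes a b c d :: int
  assumes \<tau>: "Im \<tau> > 0"
    and fixed: "(of_int a * \<tau> + of_int b) / (of_int c * \<tau> + of_int d) = \<tau>"
    and det: "a * d - b * c = n" "n > 0" and nonsquare: "\<And>s. n \<noteq> s * s"
  shows "algebraic_int (shifted_j \<tau>)"
proof -
  define F where "F = mobius_orbit n shifted_j"
  have F: "modular_family F"
    unfolding F_def by (rule shifted_j_orbit_family[OF det(2)])
  define f where "f = on_uhp (\<lambda>\<tau>. shifted_j ((of_int a * \<tau> + of_int b) / (of_int c * \<tau> + of_int d)))"
  have f: "f \<in> F" "f \<tau> = shifted_j \<tau>"
    using det(1) fixed \<tau> by (auto simp: f_def F_def mobius_orbit_def on_uhp_def)
  have fin: "finite F" using F by (simp add: modular_family_def)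
  define \<Phi> where "\<Phi> = (\<lambda>\<tau>. \<Prod>f\<in>F. shifted_j \<tau> - f \<tau>)"
  have zero: "\<Phi> \<tau> = 0"
    unfolding \<Phi>_def using fin f by (intro prod_zero bexI[of _ f]) auto
  have inv: "modular_invariant \<Phi>"
    unfolding modular_invariant_def
  proof (intro allI impI)
    fix z :: complex assume z: "Im z > 0"
    have J: "shifted_j (z + 1) = shifted_j z" "shifted_j (- 1 / z) = shifted_j z"
      using shifted_j_modular_invariant z by (auto simp: modular_invariant_def)
    show "\<Phi> (z + 1) = \<Phi> z \<and> \<Phi> (- 1 / z) = \<Phi> z"
      unfolding \<Phi>_def J using modular_family_prod[OF F z, of "\<lambda>y. shifted_j z - y"] by blast
  qed
  have "polar_unit \<Phi>"
    unfolding \<Phi>_def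
  proof (rule polar_unit_prod[OF fin])
    show "F \<noteq> {}" using f by auto
    show "polar_unit (\<lambda>\<tau>. shifted_j \<tau> - g \<tau>)" if "g \<in> F" for g
    proof (rule shifted_j_orbit_cases[OF that[unfolded F_def] det(2)])
      fix a d :: nat and b :: int
      assume *: "int a * int d = n" "g = on_uhp (\<lambda>\<tau>. shifted_j ((of_nat a * \<tau> + of_int b) / of_nat d))"
      have "a > 0" "d > 0" using * det by (auto intro: Nat.gr0I)
      moreover have "a \<noteq> d" using *(1) nonsquare[of "int a"] by auto
      ultimately show ?thesis
        unfolding *(2) polar_unit_on_uhp by (rule polar_unit_shifted_j_diff)
    qed
  qed
  then obtain k N h where q: "qser k N h \<Phi>" "N < 0" "alg_unit (h 0)"
    by (auto simp: polar_unit_def)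
  \<comment> \<open>Passing to \<open>q ^ (1 / (2 * k))\<close> makes the width even.\<close>
  define l where "l = k * 2"
  define M where "M = nat (- N * 2)"
  have l: "l > 0" using q by (simp add: l_def qser_def)
  have "qser l (- int M) (\<lambda>u. h (u ^ 2)) \<Phi>"
    using qser_refine[OF q(1), of 2] q(2) by (simp add: l_def M_def)
  from modular_invariant_eq_poly_shifted_j[OF _ inv this]
  obtain p where p: "\<And>n. algebraic_int (coeff p n)" "\<Phi> \<tau> = poly p (shifted_j \<tau>)"
    "l * degree p \<le> M" "l dvd M \<Longrightarrow> coeff p (M div l) = h 0" "\<not> l dvd M \<Longrightarrow> h 0 = 0"
    using \<tau> by (auto simp: l_def)
  have h0: "h 0 \<noteq> 0" "algebraic_int (inverse (h 0))" using q(3) by (auto simp: alg_unit_def)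
  hence "l dvd M" using p(5) by blast
  hence lead: "coeff p (M div l) = h 0" and "M = l * (M div l)"
    using p(4) by auto
  hence "degree p \<le> M div l"
    using p(3) l by (metis nat_mult_le_cancel1)
  hence deg: "degree p = M div l"
    using lead h0(1) le_degree[of p "M div l"] by simp
  show ?thesis
  proof (rule algebraic_int_integral[of "Polynomial.smult (inverse (h 0)) p"])
    show "lead_coeff (Polynomial.smult (inverse (h 0)) p) = 1"
      using lead h0(1) by (simp add: deg)
    show "algebraic_int (coeff (Polynomial.smult (inverse (h 0)) p) n)" for n
      using p(1) h0(2) by (auto intro: algebraic_int_mult)
    show "poly (Polynomial.smult (inverse (h 0)) p) (shifted_j \<tau>) = 0"
      using zero p(2) by simp
  qed
qed

text \<open>
  The matrix with rows \<open>(p, - c)\<close> and \<open>(a, p + b)\<close> fixes the root \<open>\<tau>\<close> for each integer \<open>p\<close>. With \<open>t = 2 * p + b\<close> its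
  determinant \<open>n\<close> satisfies \<open>4 * n = t\<^sup>2 + D\<close>, where \<open>D > 0\<close> is minus the discriminant. For \<open>t > D\<close> this lies
  strictly between \<open>t\<^sup>2\<close> and \<open>(t + 1)\<^sup>2\<close>, so \<open>n\<close> is not a square.
\<close>

theorem shifted_j_quadratic_algebraic_int:
  fixes a b c :: int
  assumes \<tau>: "Im \<tau> > 0" and a: "a \<noteq> 0"
    and quad: "of_int a * \<tau>\<^sup>2 + of_int b * \<tau> + of_int c = 0"
  shows "algebraic_int (shifted_j \<tau>)"
proof -
  define D where "D = 4 * a * c - b\<^sup>2"
  have D: "D > 0"
  proof -
    have eqs: "a * ((Re \<tau>)\<^sup>2 - (Im \<tau>)\<^sup>2) + b * Re \<tau> + c = 0" "Im \<tau> * (2 * a * Re \<tau> + b) = 0"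
      using arg_cong[OF quad, of Re] arg_cong[OF quad, of Im]
      by (simp_all add: power2_eq_square algebra_simps)
    hence "2 * a * Re \<tau> + b = 0" using \<tau> by simp
    hence b: "real_of_int b = - 2 * a * Re \<tau>" by simp
    have c: "real_of_int c = a * ((Re \<tau>)\<^sup>2 + (Im \<tau>)\<^sup>2)"
      using eqs(1) unfolding b by (simp add: power2_eq_square algebra_simps)
    have "real_of_int D = 4 * (real_of_int a)\<^sup>2 * (Im \<tau>)\<^sup>2"
      unfolding D_def using b c by (simp add: power2_eq_square algebra_simps)
    also have "\<dots> > 0" using a \<tau> by simp
    finally show ?thesis by simp
  qed
  \<comment> \<open>Any \<open>p\<close> that makes \<open>t > D\<close> would do.\<close>
  define p where "p = D + \<bar>b\<bar>"
  define t where "t = 2 * p + b"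
  have t: "t > D" using D by (simp add: t_def p_def)
  define n where "n = p * (p + b) - (- c) * a"
  have n4: "4 * n = t * t + D"
    by (simp add: n_def t_def D_def power2_eq_square algebra_simps)
  have "4 * n > 0" unfolding n4 using D t by (intro add_nonneg_pos) auto
  hence n: "n > 0" by simp
  have nonsquare: "n \<noteq> s * s" for s
  proof
    assume "n = s * s"
    define r where "r = 2 * \<bar>s\<bar>"
    have r: "r * r = t * t + D" "r \<ge> 0" using n4 \<open>n = s * s\<close> by (auto simp: r_def)
    have "t < r"
    proof (rule ccontr)
      assume "\<not> t < r"
      hence "r * r \<le> t * t" using r(2) by (intro mult_mono) auto
      thus False using r(1) D by simp
    qed
    hence "(t + 1) * (t + 1) \<le> r * r" using t D by (intro mult_mono) auto
    thus False using r(1) t D by (simp add: algebra_simps)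
  qed
  have det: "p * (p + b) - (- c) * a = n" by (simp add: n_def)
  have nz: "of_int a * \<tau> + of_int (p + b) \<noteq> 0"
    using Im_mobius(1)[OF \<tau>, of p "p + b" "- c" a] n by (simp add: n_def)
  have "of_int p * \<tau> + of_int (- c) = \<tau> * (of_int a * \<tau> + of_int (p + b))"
    using quad by (simp add: power2_eq_square algebra_simps add_eq_0_iff)
  hence "(of_int p * \<tau> + of_int (- c)) / (of_int a * \<tau> + of_int (p + b)) = \<tau>"
    using nz by simp
  from shifted_j_fixed_point_algebraic_int[OF \<tau> this det n nonsquare] show ?thesis .
qed



section \<open>The orbit of the eta quotient\<close>

definition q_unit :: "(complex \<Rightarrow> complex) \<Rightarrow> bool" where
  "q_unit f \<longleftrightarrow> (\<exists>k N h. qser_unit k N h f)"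

lemma q_unit_mult:
  assumes "q_unit f" "q_unit g"
  shows "q_unit (\<lambda>\<tau>. f \<tau> * g \<tau>)"
proof -
  obtain k N h k' N' h' where q: "qser_unit k N h f" "qser_unit k' N' h' g"
    using assms by (auto simp: q_unit_def)
  hence k: "k > 0" "k' > 0" by (auto simp: qser_unit_def qser_def)
  have "qser_unit (k * k') (N' * int k) (\<lambda>u. h' (u ^ k)) g"
    using qser_unit_refine[OF q(2) k(1)] by (simp add: mult.commute)
  from qser_unit_mult[OF qser_unit_refine[OF q(1) k(2)] this]
  show ?thesis unfolding q_unit_def by blast
qed

lemma q_unit_inverse: "q_unit f \<Longrightarrow> q_unit (\<lambda>\<tau>. inverse (f \<tau>))"
  unfolding q_unit_def using qser_unit_inverse by blast

lemma q_unit_eta24_affine: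
  "a > 0 \<Longrightarrow> d > 0 \<Longrightarrow> q_unit (\<lambda>\<tau>. eta24 ((of_nat a * \<tau> + of_int b) / of_nat d))"
  by (rule qser_unit_eta24_affine[of a d b]) (auto simp: q_unit_def)

lemma q_unit_integral: "q_unit f \<Longrightarrow> integral_qser f"
  by (auto simp: q_unit_def integral_qser_def qser_unit_def)

lemma gcd_mult_coprime_int:
  fixes x y c :: int
  assumes "coprime x y"
  shows "gcd (x * y) c = gcd x c * gcd y c"
proof (rule zdvd_antisym_nonneg)
  have "coprime (gcd x c) (gcd y c)"
    using assms by (meson coprime_divisors gcd_dvd1)
  thus "gcd x c * gcd y c dvd gcd (x * y) c"
    by (intro gcd_greatest mult_dvd_mono divides_mult) auto
  obtain e f where ef: "gcd (x * y) c = e * f" "e dvd x" "f dvd y"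
    using division_decomp[of "gcd (x * y) c" x y] by auto
  hence "e dvd c" "f dvd c"
    by (metis dvd_mult_left dvd_mult_right gcd_dvd2)+
  thus "gcd (x * y) c dvd gcd x c * gcd y c"
    unfolding ef(1) using ef(2,3) by (intro mult_dvd_mono gcd_greatest)
qed simp_all

text \<open>
  The Hermite normal form for \<open>\<tau> \<mapsto> N * \<gamma> \<tau>\<close> with \<open>\<gamma>\<close> in the modular group. As \<open>a\<close> and \<open>c\<close> are coprime, the
  upper left entry is \<open>gcd N c\<close>, which does not depend on \<open>a\<close> and is multiplicative in coprime factors of \<open>N\<close>.
\<close>

lemma eta24_scaled_mobius:
  fixes a b c d N :: int
  assumes det: "a * d - b * c = 1" and N: "N > 0"
  obtains b' where "0 \<le> b'" "b' < N div gcd N c"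
    "\<And>\<tau>. Im \<tau> > 0 \<Longrightarrow> eta24 (of_int N * ((of_int a * \<tau> + of_int b) / (of_int c * \<tau> + of_int d))) =
       ((of_int c * \<tau> + of_int d) / of_int (N div gcd N c)) ^ 12 *
       eta24 ((of_int (gcd N c) * \<tau> + of_int b') / of_int (N div gcd N c))"
proof -
  have "coprime a c"
  proof (rule coprimeI)
    fix e assume "e dvd a" "e dvd c"
    hence "e dvd a * d - b * c" by simp
    thus "is_unit e" by (simp add: det)
  qed
  hence g: "gcd (N * a) c = gcd N c"
    by (simp add: gcd_mult_left_right_cancel coprime_commute)
  have det': "(N * a) * d - (N * b) * c = N"
    using arg_cong[OF det, of "\<lambda>x. N * x"] by (simp add: algebra_simps)
  obtain b' where b': "0 \<le> b'" "b' < N div gcd N c"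
    "\<And>\<tau>. Im \<tau> > 0 \<Longrightarrow> eta24 ((of_int (N * a) * \<tau> + of_int (N * b)) / (of_int c * \<tau> + of_int d)) =
       ((of_int c * \<tau> + of_int d) / of_int (N div gcd N c)) ^ 12 *
       eta24 ((of_int (gcd N c) * \<tau> + of_int b') / of_int (N div gcd N c))"
    by (rule mobius_hermite_normal_form[of 12 eta24, OF _ eta24_translation eta24_inversion det' N,
          unfolded g]) auto
  moreover have "(of_int (N * a) * \<tau> + of_int (N * b)) / (of_int c * \<tau> + of_int d) =
      of_int N * ((of_int a * \<tau> + of_int b) / (of_int c * \<tau> + of_int d))" for \<tau> :: complex
    by (simp add: algebra_simps)
  ultimately show ?thesis using that by metis
qed

text \<open>
  The 24th power of \<open>1 / w\<close>. The factors \<open>\<eta>(3\<tau>)\<close> and \<open>\<eta>(6\<tau>)\<close> of \<open>X(\<tau>)\<close> and \<open>X(3\<tau>)\<close> cancel.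
\<close>

definition eta_quot :: "complex \<Rightarrow> complex" where
  "eta_quot \<tau> = eta24 (2 * \<tau>) ^ 2 * eta24 (9 * \<tau>) / (eta24 \<tau> * eta24 (18 * \<tau>) ^ 2)"

text \<open>
  The shape of the images of \<open>eta_quot\<close> under the modular group, one triple for each of the
  matrices of determinant \<open>2\<close>, \<open>9\<close> and \<open>18\<close>. The constant \<open>d9 ^ 12\<close> in front decides the theorem: it
  is an integer, so \<open>1 / w\<close> has integral expansions at every cusp, whereas \<open>w\<close> itself
  would acquire denominators that are powers of \<open>3\<close>.
\<close>

definition eta_quot_conj :: "(nat \<times> int \<times> nat) \<times> (nat \<times> int \<times> nat) \<times> (nat \<times> int \<times> nat) \<Rightarrow> complex \<Rightarrow> complex" where
  "eta_quot_conj = (\<lambda>((a2, b2, d2), (a9, b9, d9), (a18, b18, d18)) \<tau>.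
     of_nat d9 ^ 12 * (eta24 ((of_nat a2 * \<tau> + of_int b2) / of_nat d2) ^ 2 *
       eta24 ((of_nat a9 * \<tau> + of_int b9) / of_nat d9) *
       inverse (eta24 \<tau> * eta24 ((of_nat a18 * \<tau> + of_int b18) / of_nat d18) ^ 2)))"

lemma eta_quot_conj_integral:
  assumes "a2 > 0" "d2 > 0" "a9 > 0" "d9 > 0" "a18 > 0" "d18 > 0"
  shows "integral_qser (eta_quot_conj ((a2, b2, d2), (a9, b9, d9), (a18, b18, d18)))"
proof -
  have "q_unit eta24"
    using q_unit_eta24_affine[of 1 1 0] by simp
  hence "q_unit (\<lambda>\<tau>. eta24 ((of_nat a2 * \<tau> + of_int b2) / of_nat d2) ^ 2 *
       eta24 ((of_nat a9 * \<tau> + of_int b9) / of_nat d9) *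
       inverse (eta24 \<tau> * eta24 ((of_nat a18 * \<tau> + of_int b18) / of_nat d18) ^ 2))"
    unfolding power2_eq_square
    by (intro q_unit_mult q_unit_inverse q_unit_eta24_affine assms)
  thus ?thesis
    unfolding eta_quot_conj_def prod.case
    by (intro integral_qser_mult integral_qser_const q_unit_integral algebraic_int_pow algebraic_int_of_nat)
qed

text \<open>
  The automorphy factors in a quotient of weight \<open>0\<close>: with \<open>x\<close>, \<open>y\<close> and \<open>x * y\<close> as the lower right
  entries for levels \<open>2\<close>, \<open>9\<close> and \<open>18\<close>, only \<open>y ^ 12\<close> survives.
\<close>

lemma weight_factor_cancel:
  fixes u x y p q r s :: complex
  assumes "u \<noteq> 0" "x \<noteq> 0" "y \<noteq> 0"
  shows "((u / x) ^ 12 * p) ^ 2 * ((u / y) ^ 12 * q) / ((u ^ 12 * r) * ((u / (x * y)) ^ 12 * s) ^ 2) =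
    y ^ 12 * (p ^ 2 * q * inverse (r * s ^ 2))"
proof -
  define a b c where "a = u ^ 12" "b = x ^ 12" "c = y ^ 12"
  have nz: "a \<noteq> 0" "b \<noteq> 0" "c \<noteq> 0" using assms by (simp_all add: a_b_c_def)
  have regroup: "(e * p) ^ 2 * (f * q) / ((g * r) * (h * s) ^ 2) =
      (e ^ 2 * f / (g * h ^ 2)) * (p ^ 2 * q * inverse (r * s ^ 2))" for e f g h
    by (simp only: power_mult_distrib divide_inverse inverse_mult_distrib mult_ac)
  have "(a / b) ^ 2 * (a / c) / (a * (a / (b * c)) ^ 2) = c"
    using nz by (simp add: power2_eq_square)
  thus ?thesis
    unfolding regroup power_divide power_mult_distrib[of x y 12] by (simp only: a_b_c_def)
qed

text \<open>
  Here it is essential that \<open>gcd 18 c = gcd 2 c * gcd 9 c\<close>. It makes the lower right entry for level \<open>18\<close> the product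
  of those for \<open>2\<close> and \<open>9\<close>, and so all powers of \<open>2\<close> in the constant cancel.
\<close>

lemma eta_quot_orbit_cases:
  assumes "f \<in> (mobius_orbit 1 eta_quot)"
  obtains p where "p \<in> ({1..18} \<times> {0..18} \<times> {1..18}) \<times> ({1..18} \<times> {0..18} \<times> {1..18}) \<times>
      ({1..18} \<times> {0..18} \<times> {1..18})" "f = on_uhp (eta_quot_conj p)"
proof -
  obtain a b c d :: int where f: "f = on_uhp (\<lambda>\<tau>. eta_quot ((of_int a * \<tau> + of_int b) / (of_int c * \<tau> + of_int d)))"
    and det: "a * d - b * c = 1"
    using assms by (auto simp: mobius_orbit_def)
  define \<gamma> where "\<gamma> = (\<lambda>\<tau>. (of_int a * \<tau> + of_int b) / (of_int c * \<tau> + of_int d) :: complex)"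
  define G where "G = (\<lambda>N. nat (gcd N c))"
  define D where "D = (\<lambda>N. nat (N div gcd N c))"
  have GD: "1 \<le> G N" "1 \<le> D N" "int (G N) = gcd N c" "int (D N) = N div gcd N c" "G N \<le> nat N" "D N \<le> nat N"
    if "N > 0" for N
  proof -
    define e where "e = gcd N c"
    have e: "e > 0" "e dvd N"
      using that by (simp_all add: e_def)
    hence le: "e \<le> N" using that by (intro zdvd_imp_le)
    moreover have D: "N div e > 0" using pos_imp_zdiv_pos_iff[OF e(1), of N] le by simp
    moreover have "1 * (N div e) \<le> e * (N div e)"
      using D e(1) by (intro mult_right_mono) linarith+
    hence "N div e \<le> N"
      using e(2) by simp
    ultimately show "1 \<le> G N" "1 \<le> D N" "int (G N) = gcd N c" "int (D N) = N div gcd N c"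
      "G N \<le> nat N" "D N \<le> nat N"
      using e(1) unfolding G_def D_def e_def[symmetric] by auto
  qed
  define P where "P = (\<lambda>N B. 0 \<le> B \<and> B < int (D N) \<and> (\<forall>\<tau>. Im \<tau> > 0 \<longrightarrow>
      eta24 (of_int N * \<gamma> \<tau>) = ((of_int c * \<tau> + of_int d) / of_nat (D N)) ^ 12 *
        eta24 ((of_nat (G N) * \<tau> + of_int B) / of_nat (D N))))"
  have ex: "\<exists>B. P N B" if N: "N > 0" for N
  proof (rule eta24_scaled_mobius[OF det N])
    fix b' assume b': "0 \<le> b'" "b' < N div gcd N c"
      "\<And>\<tau>. Im \<tau> > 0 \<Longrightarrow> eta24 (of_int N * ((of_int a * \<tau> + of_int b) / (of_int c * \<tau> + of_int d))) =
       ((of_int c * \<tau> + of_int d) / of_int (N div gcd N c)) ^ 12 *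
       eta24 ((of_int (gcd N c) * \<tau> + of_int b') / of_int (N div gcd N c))"
    have "of_int (N div gcd N c) = (of_nat (D N) :: complex)" "of_int (gcd N c) = (of_nat (G N) :: complex)"
      using arg_cong[OF GD(4)[OF N], of "of_int :: int \<Rightarrow> complex"]
        arg_cong[OF GD(3)[OF N], of "of_int :: int \<Rightarrow> complex"]
      by (simp_all only: of_int_of_nat_eq)
    from b'(3)[unfolded this] b'(1,2) have "P N b'"
      unfolding P_def \<gamma>_def GD(4)[OF N] by blast
    thus ?thesis ..
  qed
  define B where "B = (\<lambda>N. SOME B. P N B)"
  have "P N (B N)" if "N > 0" for N
    unfolding B_def by (rule someI_ex[OF ex[OF that]])
  hence B: "0 \<le> B N" "B N < int (D N)" "\<And>\<tau>. Im \<tau> > 0 \<Longrightarrow>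
      eta24 (of_int N * \<gamma> \<tau>) = ((of_int c * \<tau> + of_int d) / of_nat (D N)) ^ 12 *
        eta24 ((of_nat (G N) * \<tau> + of_int (B N)) / of_nat (D N))" if "N > 0" for N
    using that by (simp_all only: P_def)
  have G1: "G 1 = 1" "D 1 = 1" by (simp_all add: G_def D_def)
  hence "B 1 = 0" using B(1,2)[of 1] by simp
  have D18: "D 18 = D 2 * D 9"
  proof -
    have "gcd (2 * 9) c = gcd 2 c * gcd 9 c"
      by (rule gcd_mult_coprime_int) simp_all
    hence "int (G 18) = int (G 2) * int (G 9)" using GD(3)[of 18] GD(3)[of 2] GD(3)[of 9] by simp
    moreover have "int (G N) * int (D N) = N" if "N > 0" for N
      using GD(3,4)[OF that] by simp
    hence "int (G 18) * int (D 18) = 18" "int (G 2) * int (D 2) = 2" "int (G 9) * int (D 9) = 9"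
      by simp_all
    hence "int (G 18) * int (D 18) = (int (G 2) * int (D 2)) * (int (G 9) * int (D 9))"
      by simp
    ultimately have "int (G 18) * int (D 18) = int (G 18) * int (D 2 * D 9)"
      by (simp only: of_nat_mult mult_ac)
    moreover have "int (G 18) \<noteq> 0" using GD(1)[of 18] by simp
    ultimately have "int (D 18) = int (D 2 * D 9)" by (metis mult_left_cancel)
    thus ?thesis by (simp only: of_nat_eq_iff)
  qed
  define p where "p = ((G 2, B 2, D 2), (G 9, B 9, D 9), (G 18, B 18, D 18))"
  have "f = on_uhp (eta_quot_conj p)"
    unfolding f
  proof (rule on_uhp_cong)
    fix \<tau> :: complex assume \<tau>: "Im \<tau> > 0"
    define u where "u = of_int c * \<tau> + of_int d"
    define A where "A = (\<lambda>N. eta24 ((of_nat (G N) * \<tau> + of_int (B N)) / of_nat (D N)))"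
    have u: "u \<noteq> 0" using Im_mobius(1)[OF \<tau>, of a d b c] det by (simp add: u_def)
    have E: "eta24 (of_int N * \<gamma> \<tau>) = (u / of_nat (D N)) ^ 12 * A N" if "N > 0" for N
      using B(3)[OF that \<tau>] by (simp add: u_def A_def)
    have A1: "A 1 = eta24 \<tau>" by (simp add: A_def G1 \<open>B 1 = 0\<close>)
    have E1: "eta24 (\<gamma> \<tau>) = u ^ 12 * eta24 \<tau>" using E[of 1] A1 G1 by simp
    have E2: "eta24 (2 * \<gamma> \<tau>) = (u / of_nat (D 2)) ^ 12 * A 2"
      and E9: "eta24 (9 * \<gamma> \<tau>) = (u / of_nat (D 9)) ^ 12 * A 9"
      and E18: "eta24 (18 * \<gamma> \<tau>) = (u / (of_nat (D 2) * of_nat (D 9))) ^ 12 * A 18"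
      using E[of 2] E[of 9] E[of 18] by (simp_all add: D18)
    have "D 2 \<noteq> 0" "D 9 \<noteq> 0" using GD(2)[of 2] GD(2)[of 9] by simp_all
    hence nz: "(of_nat (D 2) :: complex) \<noteq> 0" "(of_nat (D 9) :: complex) \<noteq> 0"
      by (simp_all only: of_nat_eq_0_iff) simp_all
    have "eta_quot (\<gamma> \<tau>) = of_nat (D 9) ^ 12 * (A 2 ^ 2 * A 9 * inverse (eta24 \<tau> * A 18 ^ 2))"
      unfolding eta_quot_def E1 E2 E9 E18 by (rule weight_factor_cancel[OF u nz])
    also have "\<dots> = eta_quot_conj p \<tau>"
      by (simp only: eta_quot_conj_def p_def prod.case A_def)
    finally have "eta_quot (\<gamma> \<tau>) = eta_quot_conj p \<tau>" .
    thus "eta_quot ((of_int a * \<tau> + of_int b) / (of_int c * \<tau> + of_int d)) = eta_quot_conj p \<tau>"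
      by (simp only: \<gamma>_def)
  qed
  moreover have "p \<in> ({1..18} \<times> {0..18} \<times> {1..18}) \<times> ({1..18} \<times> {0..18} \<times> {1..18}) \<times>
      ({1..18} \<times> {0..18} \<times> {1..18})"
  proof -
    have "(G N, B N, D N) \<in> {1..18} \<times> {0..18} \<times> {1..18}" if "0 < N" "N \<le> 18" for N
    proof -
      have "nat N \<le> 18" using that by simp
      hence "G N \<le> 18" "D N \<le> 18" using GD(5,6)[OF that(1)] by linarith+
      moreover from this have "B N \<le> 18" using B(2)[OF that(1)] by linarith
      ultimately show ?thesis
        using GD(1,2)[OF that(1)] B(1)[OF that(1)] by (simp only: mem_Times_iff fst_conv snd_conv atLeastAtMost_iff)
    qed
    from this[of 2] this[of 9] this[of 18] show ?thesis
      unfolding p_def by (intro SigmaI) simp_all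
  qed
  ultimately show ?thesis by (intro that[of p])
qed

lemma eta_quot_orbit_family: "modular_family (mobius_orbit 1 eta_quot)"
proof (rule modular_family_mobius_orbit)
  define R where "R = {1..18::nat} \<times> {0..18::int} \<times> {1..18::nat}"
  have "mobius_orbit 1 eta_quot \<subseteq> (\<lambda>p. on_uhp (eta_quot_conj p)) ` (R \<times> R \<times> R)"
  proof
    fix f assume "f \<in> mobius_orbit 1 eta_quot"
    then obtain p where "p \<in> R \<times> R \<times> R" "f = on_uhp (eta_quot_conj p)"
      unfolding R_def by (rule eta_quot_orbit_cases)
    thus "f \<in> (\<lambda>p. on_uhp (eta_quot_conj p)) ` (R \<times> R \<times> R)"
      by (rule rev_image_eqI)
  qed
  moreover have "finite R" unfolding R_def by (intro finite_cartesian_product finite_atLeastAtMost finite_atLeastAtMost_int)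
  hence "finite ((\<lambda>p. on_uhp (eta_quot_conj p)) ` (R \<times> R \<times> R))"
    by (intro finite_imageI finite_cartesian_product)
  ultimately show "finite (mobius_orbit 1 eta_quot)"
    by (rule finite_subset)
next
  fix f assume "f \<in> mobius_orbit 1 eta_quot"
  then obtain p where p: "p \<in> ({1..18} \<times> {0..18} \<times> {1..18}) \<times> ({1..18} \<times> {0..18} \<times> {1..18}) \<times>
      ({1..18} \<times> {0..18} \<times> {1..18})" and f: "f = on_uhp (eta_quot_conj p)"
    by (rule eta_quot_orbit_cases)
  obtain a2 b2 d2 a9 b9 d9 a18 b18 d18 where p_eq: "p = ((a2, b2, d2), (a9, b9, d9), (a18, b18, d18))"
    by (metis surj_pair)
  show "integral_qser f"
    unfolding f p_eq integral_qser_on_uhp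
    by (rule eta_quot_conj_integral) (use p in \<open>simp_all add: p_eq\<close>)
qed

section \<open>The theorem\<close>

text \<open>
  The three elements \<open>1\<close>, \<open>\<tau>\<close>, \<open>\<tau>\<^sup>2\<close> of a two-dimensional space are linearly dependent over \<open>\<rat>\<close>, and the coefficient of
  \<open>\<tau>\<^sup>2\<close> in a nontrivial relation is not zero because \<open>\<tau>\<close> is not real.
\<close>

lemma quadratic_equation:
  assumes K: "imaginary_quadratic_field K" and \<tau>: "\<tau> \<in> K" "Im \<tau> > 0"
  obtains a b c :: int where "a \<noteq> 0" "of_int a * \<tau>\<^sup>2 + of_int b * \<tau> + of_int c = 0"
proof -
  interpret V: vector_space rat_scale by (rule vector_space_rat_scale)
  have dim: "V.dim K = 2" and sub: "complex_subfield K"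
    using K by (auto simp: imaginary_quadratic_field_def)
  obtain B where B: "V.independent B" "K \<subseteq> V.span B" "card B = 2"
    using V.basis_exists[of K] dim by metis
  have finB: "finite B" using B(3) by (metis card.infinite zero_neq_numeral)
  define S where "S = {1, \<tau>, \<tau>\<^sup>2}"
  have "1 \<in> K" "\<tau>\<^sup>2 \<in> K" using sub \<tau>(1) by (auto simp: complex_subfield_def power2_eq_square)
  hence S: "S \<subseteq> V.span B" using \<tau>(1) B(2) by (auto simp: S_def)
  have ne: "\<tau> \<noteq> 0" "\<tau> \<noteq> 1" "\<tau> \<noteq> - 1" using \<tau>(2) by auto
  have distinct: "1 \<noteq> \<tau>" "\<tau> \<noteq> \<tau>\<^sup>2" "1 \<noteq> \<tau>\<^sup>2"
  proof -
    show "1 \<noteq> \<tau>" using ne by simp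
    show "\<tau> \<noteq> \<tau>\<^sup>2" using ne by (simp add: power2_eq_square)
    have "(\<tau> - 1) * (\<tau> + 1) \<noteq> 0" using ne by (simp add: add_eq_0_iff2)
    thus "1 \<noteq> \<tau>\<^sup>2" by (auto simp: power2_eq_square algebra_simps)
  qed
  have "card S = 3" using distinct by (simp add: S_def)
  hence "V.dependent S"
    using V.independent_span_bound[OF finB _ S] B(3) by auto
  then obtain r where r: "\<exists>v\<in>S. r v \<noteq> 0" "(\<Sum>v\<in>S. rat_scale (r v) v) = 0"
    using V.dependent_finite[of S] by (auto simp: S_def)
  have eq: "of_rat (r 1) + of_rat (r \<tau>) * \<tau> + of_rat (r (\<tau>\<^sup>2)) * \<tau>\<^sup>2 = 0"
    using r(2) distinct by (simp add: S_def rat_scale_def add_ac)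
  have r2: "r (\<tau>\<^sup>2) \<noteq> 0"
  proof
    assume 0: "r (\<tau>\<^sup>2) = 0"
    have "(of_rat q :: complex) = of_real (of_rat q)" for q
      by (cases q) (simp add: of_rat_rat)
    hence real: "Im (of_rat q) = 0" "Re (of_rat q) = of_rat q" for q
      by simp_all
    have "of_rat (r \<tau>) * Im \<tau> = 0"
      using arg_cong[OF eq, of Im] 0 by (simp add: real)
    hence "r \<tau> = 0" using \<tau>(2) by simp
    moreover from this have "r 1 = 0" using eq 0 by simp
    ultimately show False using r(1) 0 by (auto simp: S_def)
  qed
  define num den where "num = (\<lambda>x. fst (quotient_of (r x)))" "den = (\<lambda>x. snd (quotient_of (r x)))"
  have den: "den x \<noteq> 0" "of_rat (r x) = (of_int (num x) / of_int (den x) :: complex)" for x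
  proof -
    have "r x = of_int (num x) / of_int (den x)"
      using quotient_of_div[of "r x" "num x" "den x"] by (simp add: num_den_def)
    thus "of_rat (r x) = (of_int (num x) / of_int (den x) :: complex)"
      by (simp only: of_rat_divide of_rat_of_int_eq)
    show "den x \<noteq> 0"
      using quotient_of_denom_pos'[of "r x"] by (simp add: num_den_def)
  qed
  define a b c where "a = num (\<tau>\<^sup>2) * den 1 * den \<tau>" "b = num \<tau> * den 1 * den (\<tau>\<^sup>2)"
    "c = num 1 * den \<tau> * den (\<tau>\<^sup>2)"
  have "num (\<tau>\<^sup>2) \<noteq> 0" using den[of "\<tau>\<^sup>2"] r2 by auto
  hence "a \<noteq> 0" using den(1) by (simp add: a_b_c_def)
  moreover have "of_int a * \<tau>\<^sup>2 + of_int b * \<tau> + of_int c = 0"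
  proof -
    have *: "a1 * d1 * d2 * \<tau>\<^sup>2 + b1 * d1 * d3 * \<tau> + c1 * d2 * d3 =
        d1 * d2 * d3 * (c1 / d1 + b1 / d2 * \<tau> + a1 / d3 * \<tau>\<^sup>2)"
      if "d1 \<noteq> 0" "d2 \<noteq> 0" "d3 \<noteq> 0" for a1 b1 c1 d1 d2 d3
      using that by (simp add: field_simps)
    show ?thesis
      unfolding a_b_c_def of_int_mult
      by (subst *) (use eq den(1) in \<open>simp_all only: den(2) of_int_eq_0_iff mult_zero_right\<close>, simp_all)
  qed
  ultimately show ?thesis using that by blast
qed

lemma w_power_24:
  assumes "Im \<tau> > 0"
  shows "(1 / w \<tau>) ^ 24 = eta_quot \<tau>"
proof -
  have X: "X \<tau> ^ 24 = eta24 \<tau> * eta24 (6 * \<tau>) ^ 2 / (eta24 (2 * \<tau>) ^ 2 * eta24 (3 * \<tau>))" for \<tau>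
  proof -
    have "(dedekind_eta z ^ 2) ^ 24 = eta24 z ^ 2" for z
    proof -
      have "(x ^ 2) ^ 24 = (x ^ 24) ^ 2" for x :: complex by (simp flip: power_mult)
      thus ?thesis by (simp only: dedekind_eta_power_24)
    qed
    thus ?thesis
      by (simp only: X_def power_divide power_mult_distrib dedekind_eta_power_24)
  qed
  have "eta24 \<tau> \<noteq> 0" "eta24 (2 * \<tau>) \<noteq> 0" "eta24 (3 * \<tau>) \<noteq> 0" "eta24 (6 * \<tau>) \<noteq> 0"
    "eta24 (9 * \<tau>) \<noteq> 0" "eta24 (18 * \<tau>) \<noteq> 0"
    using assms by (intro eta24_nonzero; simp)+
  thus ?thesis
    by (simp add: w_def eta_quot_def power_divide power_mult_distrib X)
qed

theorem theorem5p2: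
  fixes K :: "complex set" and \<tau> :: complex
  assumes "imaginary_quadratic_field K"
    and "\<tau> \<in> K \<inter> upper_half_plane"
  shows "algebraic_int (1 / w \<tau>)"
proof -
  have \<tau>: "\<tau> \<in> K" "Im \<tau> > 0"
    using assms(2) by (auto simp: upper_half_plane_def)
  obtain a b c :: int where "a \<noteq> 0" "of_int a * \<tau>\<^sup>2 + of_int b * \<tau> + of_int c = 0"
    using quadratic_equation[OF assms(1) \<tau>] .
  hence J: "algebraic_int (shifted_j \<tau>)"
    using shifted_j_quadratic_algebraic_int \<tau>(2) by blast
  have "on_uhp eta_quot \<in> mobius_orbit 1 eta_quot"
    unfolding mobius_orbit_def
    by (rule CollectI, rule exI[of _ 1], rule exI[of _ 0], rule exI[of _ 0], rule exI[of _ 1]) simp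
  hence "algebraic_int (on_uhp eta_quot \<tau>)"
    using modular_family_algebraic_int[OF eta_quot_orbit_family \<tau>(2) J] by blast
  hence "algebraic_int ((1 / w \<tau>) ^ 24)"
    using \<tau>(2) by (simp add: on_uhp_def w_power_24)
  thus ?thesis
    by (rule algebraic_int_of_power) simp
qed

end
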